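(* Let $\mathcal{A}$ be a commutative unital algebra over $\mathbb{C}$ with an action of a finite group $\Gamma$ by automorphisms. Let $h\in\langle\gamma\rangle$ be an element of a conjugacy class $\langle\gamma\rangle$ of $\Gamma$, let $\Gamma_h$ be the centralizer of $h$ in $\Gamma$, and let $\mathcal{C}_*(\mathcal{A})_h$ be the twisted Hochschild complex for the action of $h$. Then the conjugacy component $\mathcal{H}_*(\mathcal{A})_{\langle\gamma\rangle}$ of the Hochschild complex of $\mathcal{A}\rtimes\Gamma$ is quasi-isomorphic to the complex $\mathcal{C}_*(\mathcal{A})_h^{\Gamma_h}$ of $\Gamma_h$-invariants. The quasi-isomorphism is given by the chain map $G:\mathcal{H}_*(\mathcal{A})_{\langle\gamma\rangle}\to\mathcal{C}_*(\mathcal{A})_h^{\Gamma_h}$ with the explicit formula $$G(b_0h_0,\,b_1h_1,\ldots,\,b_nh_n)=\frac{1}{|\Gamma_h|}\sum_{g_0\in\Gamma_h}\big(hg_0h_0^{-1}(b_0),\;g_0(b_1),\;\ldots,\;g_0h_1\cdots h_{n-1}(b_n)\big),$$ where the $i$-th entry for $i\ge 2$ is $g_0h_1\cdots h_{i-1}(b_i)$.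
   Context: The cross-product $\mathcal{A}\rtimes\Gamma$ consists of sums $\sum_g a_g g$ with product $(ag)(bk)=a\,g(b)\,gk$. Its Hochschild complex is $\big((\mathcal{A}\rtimes\Gamma)^{\otimes n+1},b\big)$ with the usual Hochschild differential $b$. The subcomplex $\mathcal{H}_*(\mathcal{A})_{\langle\gamma\rangle}$ is spanned by the tensors $(b_0h_0,\ldots,b_nh_n)=b_0h_0\otimes\cdots\otimes b_nh_n$ ($b_i\in\mathcal{A}$, $h_i\in\Gamma$) with $h_1h_2\cdots h_nh_0\in\langle\gamma\rangle$. The Hochschild complex is the direct sum of these subcomplexes over the conjugacy classes of $\Gamma$. The twisted Hochschild complex has $\mathcal{C}_n(\mathcal{A})_h=\mathcal{A}^{\otimes n+1}$, with $(a_0,\ldots,a_n)$ standing for $a_0\otimes\cdots\otimes a_n$, and differential $$b_h(a_0\otimes\cdots\otimes a_n)=a_0h(a_1)\otimes a_2\otimes\cdots\otimes a_n+\sum_{i=1}^{n-1}(-1)^ia_0\otimes\cdots\otimes a_ia_{i+1}\otimes\cdots\otimes a_n+(-1)^na_na_0\otimes a_1\otimes\cdots\otimes a_{n-1}.$$ The centralizer $\Gamma_h=\{g\in\Gamma:gh=hg\}$ acts diagonally on $\mathcal{C}_*(\mathcal{A})_h$, and the superscript $\Gamma_h$ denotes invariants.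
   Formalization: In the formula for G the sum runs over all g_0 in Γ with g_0(h_1⋯h_n h_0)g_0^{-1} = h (a coset of Γ_h, equal to Γ_h when h_1⋯h_n h_0 = h) instead of over Γ_h; with Γ_h throughout, G is not a chain map. *)

theory Defs
  imports Complex_Main "HOL-Algebra.Algebra" "HOL-Algebra.Algebraic_Closure_Type"
begin

text \<open>
  Complex vector spaces are modules over the HOL-Algebra ring \<open>complex_ring\<close>.  The record type of
  modules extends that of rings; the fields \<open>mult\<close> and \<open>one\<close> play no role in the \<open>module\<close> locale
  and are left \<open>undefined\<close> for modules that carry no product.
\<close>

abbreviation complex_ring :: "complex ring" where
  "complex_ring \<equiv> ring_of_type_algebra"

definition linear_maps ::
    "(complex, 'v, 'm) module_scheme \<Rightarrow> (complex, 'w, 'n) module_scheme \<Rightarrow> ('v \<Rightarrow> 'w) set" where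
  "linear_maps V W = {f \<in> carrier V \<rightarrow> carrier W.
     (\<forall>x\<in>carrier V. \<forall>y\<in>carrier V. f (x \<oplus>\<^bsub>V\<^esub> y) = f x \<oplus>\<^bsub>W\<^esub> f y) \<and>
     (\<forall>c. \<forall>x\<in>carrier V. f (c \<odot>\<^bsub>V\<^esub> x) = c \<odot>\<^bsub>W\<^esub> f x)}"

definition linear_span :: "(complex, 'v, 'm) module_scheme \<Rightarrow> 'v set \<Rightarrow> 'v set" where
  "linear_span V S = \<Inter>{H. submodule H complex_ring V \<and> S \<subseteq> H}"

definition quotient_module ::
    "(complex, 'v, 'm) module_scheme \<Rightarrow> 'v set \<Rightarrow> (complex, 'v set) module" where
  "quotient_module V N =
     \<lparr>carrier = a_rcosets\<^bsub>V\<^esub> N, monoid.mult = undefined, monoid.one = undefined,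
      ring.zero = N, ring.add = set_add V,
      module.smult = (\<lambda>c T. \<Union>x\<in>T. N +>\<^bsub>V\<^esub> (c \<odot>\<^bsub>V\<^esub> x))\<rparr>"

definition free_module :: "'x set \<Rightarrow> (complex, 'x \<Rightarrow> complex) module" where
  "free_module S =
     \<lparr>carrier = {c. finite {x. c x \<noteq> 0} \<and> {x. c x \<noteq> 0} \<subseteq> S},
      monoid.mult = undefined, monoid.one = undefined,
      ring.zero = (\<lambda>_. 0), ring.add = (\<lambda>c d x. c x + d x),
      module.smult = (\<lambda>r c x. r * c x)\<rparr>"

definition free_gen :: "'x \<Rightarrow> 'x \<Rightarrow> complex" where
  "free_gen x = (\<lambda>y. if y = x then 1 else 0)"


section \<open>Tensor powers\<close>

definition vectors :: "('v, 'm) ring_scheme \<Rightarrow> nat \<Rightarrow> 'v list set" where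
  "vectors V n = {xs. length xs = n \<and> set xs \<subseteq> carrier V}"

definition tensor_relators ::
    "(complex, 'v, 'm) module_scheme \<Rightarrow> nat \<Rightarrow> ('v list \<Rightarrow> complex) set" where
  "tensor_relators V n =
     {\<lambda>ys. free_gen (xs[i := x \<oplus>\<^bsub>V\<^esub> y]) ys - free_gen (xs[i := x]) ys - free_gen (xs[i := y]) ys
        | xs i x y. xs \<in> vectors V n \<and> i < n \<and> x \<in> carrier V \<and> y \<in> carrier V} \<union>
     {\<lambda>ys. free_gen (xs[i := c \<odot>\<^bsub>V\<^esub> x]) ys - c * free_gen (xs[i := x]) ys
        | xs i c x. xs \<in> vectors V n \<and> i < n \<and> x \<in> carrier V}"

definition tensor_relations ::
    "(complex, 'v, 'm) module_scheme \<Rightarrow> nat \<Rightarrow> ('v list \<Rightarrow> complex) set" where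
  "tensor_relations V n = linear_span (free_module (vectors V n)) (tensor_relators V n)"

definition tensor_power ::
    "(complex, 'v, 'm) module_scheme \<Rightarrow> nat \<Rightarrow> (complex, ('v list \<Rightarrow> complex) set) module" where
  "tensor_power V n = quotient_module (free_module (vectors V n)) (tensor_relations V n)"

text \<open>The elementary tensor of the entries of a list.\<close>

definition tensor :: "(complex, 'v, 'm) module_scheme \<Rightarrow> 'v list \<Rightarrow> ('v list \<Rightarrow> complex) set" where
  "tensor V xs =
     tensor_relations V (length xs) +>\<^bsub>free_module (vectors V (length xs))\<^esub> free_gen xs"

text \<open>
  The linear map out of a tensor power induced by a multilinear map \<open>f\<close>: it sends the class of a
  formal combination \<open>c\<close> of lists to the corresponding combination of values of \<open>f\<close>.  This does
  not depend on the representative \<open>c\<close> when \<open>f\<close> is multilinear.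
\<close>

definition tensor_lift ::
    "(complex, 'w, 'm) module_scheme \<Rightarrow> ('v list \<Rightarrow> 'w) \<Rightarrow> ('v list \<Rightarrow> complex) set \<Rightarrow> 'w" where
  "tensor_lift W f T = the_elem ((\<lambda>c. \<Oplus>\<^bsub>W\<^esub>xs\<in>{xs. c xs \<noteq> 0}. c xs \<odot>\<^bsub>W\<^esub> f xs) ` T)"


section \<open>Chain complexes and quasi-isomorphisms\<close>

text \<open>The differential \<open>d n\<close> goes from degree \<open>n + 1\<close> to degree \<open>n\<close>.\<close>

definition chain_complex ::
    "(nat \<Rightarrow> (complex, 'v, 'm) module_scheme) \<Rightarrow> (nat \<Rightarrow> 'v \<Rightarrow> 'v) \<Rightarrow> bool" where
  "chain_complex C d \<longleftrightarrow>
     (\<forall>n. module complex_ring (C n)) \<and>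
     (\<forall>n. d n \<in> linear_maps (C (Suc n)) (C n)) \<and>
     (\<forall>n. \<forall>x\<in>carrier (C (Suc (Suc n))). d n (d (Suc n) x) = \<zero>\<^bsub>C n\<^esub>)"

definition cycles ::
    "(nat \<Rightarrow> (complex, 'v, 'm) module_scheme) \<Rightarrow> (nat \<Rightarrow> 'v \<Rightarrow> 'v) \<Rightarrow> nat \<Rightarrow> 'v set" where
  "cycles C d n =
     (case n of 0 \<Rightarrow> carrier (C 0) | Suc k \<Rightarrow> {x \<in> carrier (C (Suc k)). d k x = \<zero>\<^bsub>C k\<^esub>})"

definition boundaries ::
    "(nat \<Rightarrow> (complex, 'v, 'm) module_scheme) \<Rightarrow> (nat \<Rightarrow> 'v \<Rightarrow> 'v) \<Rightarrow> nat \<Rightarrow> 'v set" where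
  "boundaries C d n = d n ` carrier (C (Suc n))"

definition homology ::
    "(nat \<Rightarrow> (complex, 'v, 'm) module_scheme) \<Rightarrow> (nat \<Rightarrow> 'v \<Rightarrow> 'v) \<Rightarrow> nat
       \<Rightarrow> (complex, 'v set) module" where
  "homology C d n = quotient_module (C n\<lparr>carrier := cycles C d n\<rparr>) (boundaries C d n)"

definition chain_map ::
    "(nat \<Rightarrow> (complex, 'v, 'm) module_scheme) \<Rightarrow> (nat \<Rightarrow> 'v \<Rightarrow> 'v) \<Rightarrow>
     (nat \<Rightarrow> (complex, 'w, 'n) module_scheme) \<Rightarrow> (nat \<Rightarrow> 'w \<Rightarrow> 'w) \<Rightarrow>
     (nat \<Rightarrow> 'v \<Rightarrow> 'w) \<Rightarrow> bool" where
  "chain_map C d D e f \<longleftrightarrow>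
     chain_complex C d \<and> chain_complex D e \<and>
     (\<forall>n. f n \<in> linear_maps (C n) (D n)) \<and>
     (\<forall>n. \<forall>x\<in>carrier (C (Suc n)). f n (d n x) = e n (f (Suc n) x))"

definition homology_map ::
    "(nat \<Rightarrow> (complex, 'w, 'n) module_scheme) \<Rightarrow> (nat \<Rightarrow> 'w \<Rightarrow> 'w) \<Rightarrow>
     (nat \<Rightarrow> 'v \<Rightarrow> 'w) \<Rightarrow> nat \<Rightarrow> 'v set \<Rightarrow> 'w set" where
  "homology_map D e f n T = (\<Union>x\<in>T. boundaries D e n +>\<^bsub>D n\<^esub> f n x)"

definition quasi_isomorphism ::
    "(nat \<Rightarrow> (complex, 'v, 'm) module_scheme) \<Rightarrow> (nat \<Rightarrow> 'v \<Rightarrow> 'v) \<Rightarrow>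
     (nat \<Rightarrow> (complex, 'w, 'n) module_scheme) \<Rightarrow> (nat \<Rightarrow> 'w \<Rightarrow> 'w) \<Rightarrow>
     (nat \<Rightarrow> 'v \<Rightarrow> 'w) \<Rightarrow> bool" where
  "quasi_isomorphism C d D e f \<longleftrightarrow>
     chain_map C d D e f \<and>
     (\<forall>n. homology_map D e f n \<in> linear_maps (homology C d n) (homology D e n) \<and>
          bij_betw (homology_map D e f n) (carrier (homology C d n)) (carrier (homology D e n)))"


section \<open>Twisted Hochschild complexes\<close>

text \<open>
  The summand with index \<open>i\<close> of the twisted Hochschild differential of a list
  \<open>[a\<^sub>0, \<dots>, a\<^sub>n]\<close> with \<open>n \<ge> 1\<close>, without its sign.  The twist \<open>\<sigma>\<close> enters only for \<open>i = 0\<close>; for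
  \<open>\<sigma> = (\<lambda>a. a)\<close> this is the usual Hochschild complex, and \<open>B\<close> need not be commutative.
\<close>

definition hochschild_face ::
    "('v, 'm) ring_scheme \<Rightarrow> ('v \<Rightarrow> 'v) \<Rightarrow> nat \<Rightarrow> nat \<Rightarrow> 'v list \<Rightarrow> 'v list" where
  "hochschild_face B \<sigma> n i xs =
     (if i = 0 then (xs ! 0 \<otimes>\<^bsub>B\<^esub> \<sigma> (xs ! 1)) # drop 2 xs
      else if i < n then take i xs @ (xs ! i \<otimes>\<^bsub>B\<^esub> xs ! Suc i) # drop (i + 2) xs
      else (xs ! n \<otimes>\<^bsub>B\<^esub> xs ! 0) # take (n - 1) (drop 1 xs))"

definition hochschild_diff ::
    "(complex, 'v, 'm) module_scheme \<Rightarrow> ('v \<Rightarrow> 'v) \<Rightarrow> nat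
       \<Rightarrow> ('v list \<Rightarrow> complex) set \<Rightarrow> ('v list \<Rightarrow> complex) set" where
  "hochschild_diff B \<sigma> n =
     tensor_lift (tensor_power B (Suc n))
       (\<lambda>xs. \<Oplus>\<^bsub>tensor_power B (Suc n)\<^esub>i\<in>{..Suc n}.
          (- 1) ^ i \<odot>\<^bsub>tensor_power B (Suc n)\<^esub> tensor B (hochschild_face B \<sigma> (Suc n) i xs))"

definition hochschild_chains ::
    "(complex, 'v, 'm) module_scheme \<Rightarrow> nat \<Rightarrow> (complex, ('v list \<Rightarrow> complex) set) module" where
  "hochschild_chains B n = tensor_power B (Suc n)"


section \<open>Group actions and crossed products\<close>

definition algebra_action ::
    "('g, 'k) monoid_scheme \<Rightarrow> (complex, 'a, 'm) module_scheme \<Rightarrow> ('g \<Rightarrow> 'a \<Rightarrow> 'a) \<Rightarrow> bool" where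
  "algebra_action G A \<phi> \<longleftrightarrow>
     group_action G (carrier A) \<phi> \<and>
     (\<forall>g\<in>carrier G. \<phi> g \<in> ring_hom A A \<and> \<phi> g \<in> linear_maps A A)"

definition conj_class :: "('g, 'k) monoid_scheme \<Rightarrow> 'g \<Rightarrow> 'g set" where
  "conj_class G x = {g \<otimes>\<^bsub>G\<^esub> x \<otimes>\<^bsub>G\<^esub> inv\<^bsub>G\<^esub> g | g. g \<in> carrier G}"

definition centralizer :: "('g, 'k) monoid_scheme \<Rightarrow> 'g \<Rightarrow> 'g set" where
  "centralizer G h = {g \<in> carrier G. g \<otimes>\<^bsub>G\<^esub> h = h \<otimes>\<^bsub>G\<^esub> g}"

text \<open>
  The elements \<open>g\<close> with \<open>g x g\<inverse> = h\<close>.  In the quasi-isomorphism \<open>G\<close> on a tensor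
  \<open>(b\<^sub>0 h\<^sub>0, \<dots>, b\<^sub>n h\<^sub>n)\<close> the product \<open>x = h\<^sub>1 \<cdots> h\<^sub>n h\<^sub>0\<close> is only conjugate to \<open>h\<close>, and the
  average runs over this set: it is the centralizer \<open>\<Gamma>\<^sub>h\<close> itself if \<open>x = h\<close>, and the coset
  \<open>\<Gamma>\<^sub>h t\<close>, with \<open>t x t\<inverse> = h\<close>, in general.  Averaging over \<open>\<Gamma>\<^sub>h\<close> for every \<open>x\<close> would not
  commute with the face \<open>i = 0\<close>, which replaces \<open>x\<close> by \<open>h\<^sub>1\<inverse> x h\<^sub>1\<close>.
\<close>

definition conj_transporter :: "('g, 'k) monoid_scheme \<Rightarrow> 'g \<Rightarrow> 'g \<Rightarrow> 'g set" where
  "conj_transporter G x h = {g \<in> carrier G. g \<otimes>\<^bsub>G\<^esub> x \<otimes>\<^bsub>G\<^esub> inv\<^bsub>G\<^esub> g = h}"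

lemma (in group) conj_transporter_self:
  assumes "h \<in> carrier G"
  shows "conj_transporter G h h = centralizer G h"
  using assms by (auto simp: conj_transporter_def centralizer_def inv_solve_right')

lemma (in group) conj_transporter_coset:
  assumes "x \<in> carrier G" "h \<in> carrier G" "t \<in> conj_transporter G x h"
  shows "conj_transporter G x h = centralizer G h #> t"
proof
  have t: "t \<in> carrier G" and h: "h = t \<otimes> x \<otimes> inv t"
    using assms(3) by (auto simp: conj_transporter_def)
  show "conj_transporter G x h \<subseteq> centralizer G h #> t"
  proof
    fix g assume "g \<in> conj_transporter G x h"
    then have g: "g \<in> carrier G" and gh: "g \<otimes> x \<otimes> inv g = h"
      by (auto simp: conj_transporter_def)
    have gx: "g \<otimes> x = h \<otimes> g"
      using g gh assms(1) by (metis inv_solve_right m_closed assms(2))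
    have tx: "x \<otimes> inv t = inv t \<otimes> h"
      using t h assms(1) by (simp add: m_assoc[symmetric])
    have "(g \<otimes> inv t) \<otimes> h = h \<otimes> (g \<otimes> inv t)"
      using gx tx t g assms(1,2) by (metis m_assoc inv_closed)
    then have "g \<otimes> inv t \<in> centralizer G h"
      using g t by (auto simp: centralizer_def)
    moreover have "g = (g \<otimes> inv t) \<otimes> t"
      using g t by (simp add: m_assoc)
    ultimately show "g \<in> centralizer G h #> t"
      unfolding r_coset_def by blast
  qed
  show "centralizer G h #> t \<subseteq> conj_transporter G x h"
  proof
    fix g assume "g \<in> centralizer G h #> t"
    then obtain z where z: "z \<in> carrier G" "z \<otimes> h = h \<otimes> z" and g: "g = z \<otimes> t"
      by (auto simp: r_coset_def centralizer_def)
    have "g \<otimes> x \<otimes> inv g = z \<otimes> (t \<otimes> x \<otimes> inv t) \<otimes> inv z"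
      using z(1) t assms(1) by (simp add: g inv_mult_group m_assoc)
    also have "\<dots> = h"
      using z assms(2) h by (metis inv_solve_right' m_closed)
    finally show "g \<in> conj_transporter G x h"
      using z(1) t by (simp add: g conj_transporter_def)
  qed
qed

text \<open>
  The element \<open>\<Sum>g. a\<^sub>g g\<close> of the crossed product is the function \<open>g \<mapsto> a\<^sub>g\<close>, so for finite \<open>G\<close>
  every function from \<open>G\<close> to \<open>A\<close> occurs.  The product is \<open>(a g) (b k) = a g(b) g k\<close>.
\<close>

definition crossed_monom ::
    "('g, 'k) monoid_scheme \<Rightarrow> ('a, 'm) ring_scheme \<Rightarrow> 'a \<Rightarrow> 'g \<Rightarrow> 'g \<Rightarrow> 'a" where
  "crossed_monom G A a g = (\<lambda>x\<in>carrier G. if x = g then a else \<zero>\<^bsub>A\<^esub>)"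

definition crossed_product ::
    "('g, 'k) monoid_scheme \<Rightarrow> (complex, 'a, 'm) module_scheme \<Rightarrow> ('g \<Rightarrow> 'a \<Rightarrow> 'a)
       \<Rightarrow> (complex, 'g \<Rightarrow> 'a) module" where
  "crossed_product G A \<phi> =
     \<lparr>carrier = carrier G \<rightarrow>\<^sub>E carrier A,
      monoid.mult = (\<lambda>u v. \<lambda>x\<in>carrier G.
                \<Oplus>\<^bsub>A\<^esub>g\<in>carrier G. u g \<otimes>\<^bsub>A\<^esub> \<phi> g (v (inv\<^bsub>G\<^esub> g \<otimes>\<^bsub>G\<^esub> x))),
      monoid.one = crossed_monom G A \<one>\<^bsub>A\<^esub> \<one>\<^bsub>G\<^esub>,
      ring.zero = (\<lambda>x\<in>carrier G. \<zero>\<^bsub>A\<^esub>),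
      ring.add = (\<lambda>u v. \<lambda>x\<in>carrier G. u x \<oplus>\<^bsub>A\<^esub> v x),
      module.smult = (\<lambda>c u. \<lambda>x\<in>carrier G. c \<odot>\<^bsub>A\<^esub> u x)\<rparr>"

text \<open>\<open>list_product G [h\<^sub>1, \<dots>, h\<^sub>m] = h\<^sub>1 \<cdots> h\<^sub>m\<close>\<close>

definition list_product :: "('g, 'k) monoid_scheme \<Rightarrow> 'g list \<Rightarrow> 'g" where
  "list_product G hs = foldr (\<otimes>\<^bsub>G\<^esub>) hs \<one>\<^bsub>G\<^esub>"

text \<open>The elementary tensor \<open>(b\<^sub>0 h\<^sub>0, \<dots>, b\<^sub>n h\<^sub>n)\<close> for lists of length \<open>n + 1\<close>.\<close>

definition crossed_tensor ::
    "('g, 'k) monoid_scheme \<Rightarrow> (complex, 'a, 'm) module_scheme \<Rightarrow> ('g \<Rightarrow> 'a \<Rightarrow> 'a)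
       \<Rightarrow> 'a list \<Rightarrow> 'g list \<Rightarrow> (('g \<Rightarrow> 'a) list \<Rightarrow> complex) set" where
  "crossed_tensor G A \<phi> bs hs = tensor (crossed_product G A \<phi>) (map2 (crossed_monom G A) bs hs)"

text \<open>\<open>cyclic_product G [h\<^sub>0, h\<^sub>1, \<dots>, h\<^sub>n] = h\<^sub>1 \<cdots> h\<^sub>n h\<^sub>0\<close>\<close>

definition cyclic_product :: "('g, 'k) monoid_scheme \<Rightarrow> 'g list \<Rightarrow> 'g" where
  "cyclic_product G hs = list_product G (tl hs) \<otimes>\<^bsub>G\<^esub> hd hs"

text \<open>The differential is the one of the full Hochschild complex of the crossed product.\<close>

definition class_chains ::
    "('g, 'k) monoid_scheme \<Rightarrow> (complex, 'a, 'm) module_scheme \<Rightarrow> ('g \<Rightarrow> 'a \<Rightarrow> 'a) \<Rightarrow> 'g set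
       \<Rightarrow> nat \<Rightarrow> (complex, (('g \<Rightarrow> 'a) list \<Rightarrow> complex) set) module" where
  "class_chains G A \<phi> K n =
     (let H = hochschild_chains (crossed_product G A \<phi>) n in
      H\<lparr>carrier := linear_span H
          {crossed_tensor G A \<phi> bs hs | bs hs.
             length bs = Suc n \<and> length hs = Suc n \<and>
             set bs \<subseteq> carrier A \<and> set hs \<subseteq> carrier G \<and> cyclic_product G hs \<in> K}\<rparr>)"

definition diagonal_action ::
    "(complex, 'a, 'm) module_scheme \<Rightarrow> ('g \<Rightarrow> 'a \<Rightarrow> 'a) \<Rightarrow> nat \<Rightarrow> 'g
       \<Rightarrow> ('a list \<Rightarrow> complex) set \<Rightarrow> ('a list \<Rightarrow> complex) set" where
  "diagonal_action A \<phi> n g = tensor_lift (hochschild_chains A n) (\<lambda>xs. tensor A (map (\<phi> g) xs))"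

definition invariant_chains ::
    "(complex, 'a, 'm) module_scheme \<Rightarrow> ('g \<Rightarrow> 'a \<Rightarrow> 'a) \<Rightarrow> 'g set
       \<Rightarrow> nat \<Rightarrow> (complex, ('a list \<Rightarrow> complex) set) module" where
  "invariant_chains A \<phi> S n =
     (let C = hochschild_chains A n in
      C\<lparr>carrier := {t \<in> carrier C. \<forall>g\<in>S. diagonal_action A \<phi> n g t = t}\<rparr>)"

end

theory Submission
  imports Defs "HOL-Library.Function_Algebras"
begin

text \<open>
  Unrolling a cyclic product turns the conjugacy component into a quotient of a product of two
  simplicial objects.  Let \<open>(b\<^sub>0 h\<^sub>0, \<dots>, b\<^sub>n h\<^sub>n)\<close> be a tensor whose cyclic product \<open>x = h\<^sub>1 \<cdots> h\<^sub>n h\<^sub>0\<close>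
  is conjugate to \<open>h\<close>, and choose \<open>g\<^sub>0\<close> with \<open>g\<^sub>0 x g\<^sub>0\<inverse> = h\<close>.  Put \<open>g\<^sub>i = g\<^sub>0 h\<^sub>1 \<cdots> h\<^sub>i\<close> and let \<open>a\<^sub>i\<close> be
  the image of \<open>b\<^sub>i\<close> under the group element that precedes \<open>g\<^sub>i\<close> in cyclic order.  The tensor can be
  recovered from the lists \<open>a\<close> and \<open>g\<close> (\<open>roll\<close>), and all pairs of lists occur.  The \<open>i\<close>-th Hochschild
  face of the tensor is the \<open>i\<close>-th twisted face of \<open>a\<close> together with the deletion of \<open>g\<^sub>i\<close>
  (\<open>face_roll\<close>).  The twist by \<open>h\<close> appears because \<open>h\<^sub>0 = g\<^sub>n\<inverse> h g\<^sub>0\<close>, so going once around the cycle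
  multiplies by \<open>h\<close>.  The only choice is that of \<open>g\<^sub>0\<close>, and two choices differ by a translation of
  both lists by an element of the centralizer (\<open>roll_translate\<close>, \<open>unroll_roll_zero\<close>).  Hence the
  component consists of the coinvariants under the centralizer of \<open>C(A)\<^sub>h \<otimes> \<complex>[E\<Gamma>]\<close>, where
  \<open>E\<Gamma>\<close> is the simplicial set with \<open>n\<close>-simplices \<open>\<Gamma>\<^sup>n\<^sup>+\<^sup>1\<close>.

  A linear map out of the component is therefore the same thing as a function of \<open>(a, g)\<close> that is
  multilinear in \<open>a\<close> and invariant under translation (\<open>descend_roll\<close>).  The quasi-isomorphism
  forgets \<open>g\<close> and averages \<open>a\<close> over the centralizer.  In the other direction, \<open>a\<close> is sent to the
  average over \<open>k \<in> \<Gamma>\<close> of the tensors \<open>(a; k, \<dots>, k)\<close>.  One composite is the average over the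
  centralizer, which is the identity on invariants (\<open>to_twisted_from_twisted\<close>).  The other one is
  homotopic to the identity, because \<open>E\<Gamma>\<close> can be contracted to any vertex \<open>k\<close>: the prism operator
  replaces the vertices behind position \<open>i\<close> by \<open>k\<close> and inserts a unit behind \<open>a\<^sub>i\<close>
  (\<open>homotopy\<close>).  A single vertex \<open>k\<close> is not invariant under translation, but the average over all
  \<open>k\<close> is; this is where the finiteness of \<open>\<Gamma>\<close> and division by its order enter.

  Tensor powers are quotients of free modules.  A linear projection along the relations selects one
  normal form in every coset, and a tensor is identified with its normal form, a finitely supported
  function to the complex numbers.  Identities between chains are then identities between ordinary
  finite sums of functions, to be checked on elementary tensors only.
\<close>

section \<open>Finitely supported functions\<close>

definition fscale :: "complex \<Rightarrow> ('x \<Rightarrow> complex) \<Rightarrow> 'x \<Rightarrow> complex" (infixr "*\<^sub>c" 75) where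
  "r *\<^sub>c c = (\<lambda>x. r * c x)"

lemma fscale_apply [simp]: "(r *\<^sub>c c) x = r * c x"
  by (simp add: fscale_def)

interpretation cfun: vector_space fscale
  by unfold_locales (auto simp: fun_eq_iff algebra_simps)

interpretation cfun_pair: vector_space_pair fscale fscale
  by unfold_locales

lemma sum_fun_apply: "(\<Sum>i\<in>I. f i) x = (\<Sum>i\<in>I. f i x)" for f :: "'i \<Rightarrow> 'x \<Rightarrow> complex"
  by (induction I rule: infinite_finite_induct) auto

definition fin_supp :: "('x \<Rightarrow> complex) \<Rightarrow> bool" where
  "fin_supp c \<longleftrightarrow> finite {x. c x \<noteq> 0}"

lemma fin_supp_add [simp]: "fin_supp c \<Longrightarrow> fin_supp d \<Longrightarrow> fin_supp (c + d)"
  unfolding fin_supp_def by (rule finite_subset[of _ "{x. c x \<noteq> 0} \<union> {x. d x \<noteq> 0}"]) auto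

lemma fin_supp_scale [simp]: "fin_supp c \<Longrightarrow> fin_supp (r *\<^sub>c c)"
  unfolding fin_supp_def by (rule finite_subset[of _ "{x. c x \<noteq> 0}"]) auto

lemma fin_supp_uminus [simp]: "fin_supp (- c) \<longleftrightarrow> fin_supp c"
  by (simp add: fin_supp_def)

lemma fin_supp_gen [simp]: "fin_supp (free_gen x)"
  unfolding fin_supp_def free_gen_def by auto

text \<open>
  The linear extension of a function that is given on the basis \<open>free_gen x\<close>.
\<close>

definition lin_ext :: "('x \<Rightarrow> 'y \<Rightarrow> complex) \<Rightarrow> ('x \<Rightarrow> complex) \<Rightarrow> 'y \<Rightarrow> complex" where
  "lin_ext f c = (\<Sum>x | c x \<noteq> 0. c x *\<^sub>c f x)"

lemma lin_ext_superset:
  assumes "finite S" "{x. c x \<noteq> 0} \<subseteq> S"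
  shows "lin_ext f c = (\<Sum>x\<in>S. c x *\<^sub>c f x)"
  unfolding lin_ext_def using assms by (intro sum.mono_neutral_left) auto

lemma lin_ext_add:
  assumes "fin_supp c" "fin_supp d"
  shows "lin_ext f (c + d) = lin_ext f c + lin_ext f d"
proof -
  let ?S = "{x. c x \<noteq> 0} \<union> {x. d x \<noteq> 0}"
  have S: "finite ?S" using assms by (simp add: fin_supp_def)
  have "lin_ext f (c + d) = (\<Sum>x\<in>?S. (c + d) x *\<^sub>c f x)"
    by (rule lin_ext_superset) (use S in auto)
  also have "\<dots> = (\<Sum>x\<in>?S. c x *\<^sub>c f x) + (\<Sum>x\<in>?S. d x *\<^sub>c f x)"
    by (simp add: cfun.scale_left_distrib sum.distrib)
  also have "(\<Sum>x\<in>?S. c x *\<^sub>c f x) = lin_ext f c"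
    by (rule lin_ext_superset[symmetric]) (use S in auto)
  also have "(\<Sum>x\<in>?S. d x *\<^sub>c f x) = lin_ext f d"
    by (rule lin_ext_superset[symmetric]) (use S in auto)
  finally show ?thesis .
qed

lemma lin_ext_scale:
  assumes "fin_supp c"
  shows "lin_ext f (r *\<^sub>c c) = r *\<^sub>c lin_ext f c"
proof -
  have S: "finite {x. c x \<noteq> 0}" using assms by (simp add: fin_supp_def)
  have "lin_ext f (r *\<^sub>c c) = (\<Sum>x\<in>{x. c x \<noteq> 0}. (r *\<^sub>c c) x *\<^sub>c f x)"
    by (rule lin_ext_superset) (use S in auto)
  also have "\<dots> = r *\<^sub>c lin_ext f c"
    unfolding lin_ext_def by (simp add: cfun.scale_sum_right)
  finally show ?thesis .
qed

lemma fin_supp_diff [simp]: "fin_supp c \<Longrightarrow> fin_supp d \<Longrightarrow> fin_supp (c - d)"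
  using fin_supp_add[of c "- d"] by simp

lemma lin_ext_diff:
  assumes "fin_supp c" "fin_supp d"
  shows "lin_ext f (c - d) = lin_ext f c - lin_ext f d"
  using lin_ext_add[of "c - d" d f] assms by (simp add: algebra_simps)

lemma lin_ext_gen [simp]: "lin_ext f (free_gen x) = f x"
proof -
  have "{y. free_gen x y \<noteq> 0} = {x}" by (auto simp: free_gen_def)
  then show ?thesis by (simp add: lin_ext_def free_gen_def)
qed

lemma lin_ext_zero [simp]: "lin_ext f 0 = 0"
  by (simp add: lin_ext_def)

section \<open>Complex modules\<close>

lemma complex_ring_simps [simp]:
  "carrier complex_ring = UNIV" "\<one>\<^bsub>complex_ring\<^esub> = 1" "\<zero>\<^bsub>complex_ring\<^esub> = 0"
  "x \<otimes>\<^bsub>complex_ring\<^esub> y = x * y" "x \<oplus>\<^bsub>complex_ring\<^esub> y = x + y"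
  by (auto simp: ring_of_type_algebra_def)

lemma cring_complex_ring: "cring complex_ring"
  by (rule cring_from_type_algebra)

lemma complex_moduleI:
  fixes M (structure)
  assumes "abelian_group M"
    and "\<And>c x. x \<in> carrier M \<Longrightarrow> c \<odot> x \<in> carrier M"
    and "\<And>c d x. x \<in> carrier M \<Longrightarrow> (c + d) \<odot> x = c \<odot> x \<oplus> d \<odot> x"
    and "\<And>c x y. x \<in> carrier M \<Longrightarrow> y \<in> carrier M \<Longrightarrow> c \<odot> (x \<oplus> y) = c \<odot> x \<oplus> c \<odot> y"
    and "\<And>c d x. x \<in> carrier M \<Longrightarrow> (c * d) \<odot> x = c \<odot> (d \<odot> x)"
    and "\<And>x. x \<in> carrier M \<Longrightarrow> 1 \<odot> x = x"
  shows "module complex_ring M"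
  by (rule moduleI) (use assms cring_complex_ring in auto)

lemma complex_submoduleI:
  fixes M (structure)
  assumes "module complex_ring M" "H \<subseteq> carrier M" "\<zero> \<in> H"
    "\<And>a b. a \<in> H \<Longrightarrow> b \<in> H \<Longrightarrow> a \<oplus> b \<in> H"
    "\<And>c a. a \<in> H \<Longrightarrow> c \<odot> a \<in> H"
  shows "submodule H complex_ring M"
proof -
  interpret module complex_ring M by fact
  have inv: "\<ominus> a \<in> H" if "a \<in> H" for a
  proof -
    have "\<ominus> a = (\<ominus>\<^bsub>complex_ring\<^esub> 1) \<odot> a"
      using smult_l_minus[of 1 a] smult_one[of a] that assms(2) by auto
    then show ?thesis using that assms(5) by simp
  qed
  show ?thesis by (rule submoduleI) (use assms inv in auto)
qed

lemma complex_submoduleD: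
  fixes M (structure)
  assumes "module complex_ring M" "submodule H complex_ring M"
  shows "H \<subseteq> carrier M" "\<zero> \<in> H" "\<And>a b. a \<in> H \<Longrightarrow> b \<in> H \<Longrightarrow> a \<oplus> b \<in> H"
    "\<And>c a. a \<in> H \<Longrightarrow> c \<odot> a \<in> H" "\<And>a. a \<in> H \<Longrightarrow> \<ominus> a \<in> H"
proof -
  interpret module complex_ring M by fact
  note E = submoduleE[OF assms(2)]
  show "H \<subseteq> carrier M" "\<And>a b. a \<in> H \<Longrightarrow> b \<in> H \<Longrightarrow> a \<oplus> b \<in> H"
    "\<And>c a. a \<in> H \<Longrightarrow> c \<odot> a \<in> H" "\<And>a. a \<in> H \<Longrightarrow> \<ominus> a \<in> H"
    using E by auto
  show "\<zero> \<in> H"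
    using subgroup.one_closed[OF submodule.axioms(1)[OF assms(2)]] by simp
qed

lemma linear_span_submodule:
  assumes "module complex_ring M" "S \<subseteq> carrier M"
  shows "submodule (linear_span M S) complex_ring M"
proof (rule complex_submoduleI[OF assms(1)])
  have c: "submodule (carrier M) complex_ring M"
    using assms(1) by (rule module.carrier_is_submodule)
  then show "linear_span M S \<subseteq> carrier M"
    using assms by (auto simp: linear_span_def)
  show "\<zero>\<^bsub>M\<^esub> \<in> linear_span M S"
    using complex_submoduleD[OF assms(1)] by (auto simp: linear_span_def)
  show "a \<oplus>\<^bsub>M\<^esub> b \<in> linear_span M S" if "a \<in> linear_span M S" "b \<in> linear_span M S" for a b
    using complex_submoduleD(3)[OF assms(1)] that by (auto simp: linear_span_def)
  show "c \<odot>\<^bsub>M\<^esub> a \<in> linear_span M S" if "a \<in> linear_span M S" for c a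
    using complex_submoduleD(4)[OF assms(1)] that by (auto simp: linear_span_def)
qed

lemma linear_span_superset: "S \<subseteq> linear_span M S"
  by (auto simp: linear_span_def)

lemma linear_span_minimal: "submodule H complex_ring M \<Longrightarrow> S \<subseteq> H \<Longrightarrow> linear_span M S \<subseteq> H"
  by (auto simp: linear_span_def)

text \<open>
  The rules for computing with representatives: the scalar multiple of a coset is defined as a union
  over all representatives, and it is a single coset because submodules are closed under scaling.
\<close>

lemma quotient_module_facts:
  fixes M (structure)
  assumes M: "module complex_ring M" and N: "submodule N complex_ring M"
  shows "carrier (quotient_module M N) = (\<lambda>x. N +> x) ` carrier M"
    and "\<And>x y. x \<in> carrier M \<Longrightarrow> y \<in> carrier M \<Longrightarrow> N +> x = N +> y \<longleftrightarrow> x \<ominus> y \<in> N"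
    and "\<And>x y. x \<in> carrier M \<Longrightarrow> y \<in> carrier M \<Longrightarrow>
           (N +> x) \<oplus>\<^bsub>quotient_module M N\<^esub> (N +> y) = N +> (x \<oplus> y)"
    and "\<And>c x. x \<in> carrier M \<Longrightarrow> c \<odot>\<^bsub>quotient_module M N\<^esub> (N +> x) = N +> (c \<odot> x)"
    and "\<zero>\<^bsub>quotient_module M N\<^esub> = N +> \<zero>"
    and "\<And>x. x \<in> carrier M \<Longrightarrow> x \<in> N +> x"
    and "\<And>x y. x \<in> carrier M \<Longrightarrow> y \<in> N +> x \<Longrightarrow> y \<in> carrier M \<and> N +> y = N +> x"
    and "module complex_ring (quotient_module M N)"
proof -
  interpret module complex_ring M by fact
  note D = complex_submoduleD[OF M N]
  interpret N: abelian_subgroup N M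
    by (rule abelian_subgroupI3[OF additive_subgroupI[OF submodule.axioms(1)[OF N]] M.abelian_group_axioms])
  show car: "carrier (quotient_module M N) = (\<lambda>x. N +> x) ` carrier M"
    by (auto simp: quotient_module_def A_RCOSETS_def')

  have mem: "y \<in> N +> x \<longleftrightarrow> y \<ominus> x \<in> N" if "x \<in> carrier M" "y \<in> carrier M" for x y
    using N.a_rcos_module[OF that] by (simp add: minus_eq)
  show eq: "N +> x = N +> y \<longleftrightarrow> x \<ominus> y \<in> N" if "x \<in> carrier M" "y \<in> carrier M" for x y
    using that mem[of y x] N.a_repr_independence' N.a_repr_independenceD by metis
  show add: "(N +> x) \<oplus>\<^bsub>quotient_module M N\<^esub> (N +> y) = N +> (x \<oplus> y)"
    if "x \<in> carrier M" "y \<in> carrier M" for x y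
    using that by (simp add: quotient_module_def N.a_rcos_sum)
  show self: "x \<in> N +> x" if "x \<in> carrier M" for x
    using that by (rule N.a_rcos_self)
  show inn: "y \<in> carrier M \<and> N +> y = N +> x" if "x \<in> carrier M" "y \<in> N +> x" for x y
    using that N.a_elemrcos_carrier N.a_repr_independence' by metis
  show scale: "c \<odot>\<^bsub>quotient_module M N\<^esub> (N +> x) = N +> (c \<odot> x)" if x: "x \<in> carrier M" for c x
  proof -
    have "N +> (c \<odot> y) = N +> (c \<odot> x)" if y: "y \<in> N +> x" for y
    proof -
      have yc: "y \<in> carrier M" using inn x y by blast
      have "y \<ominus> x \<in> N" using y mem x yc by blast
      then have "c \<odot> (y \<ominus> x) \<in> N" by (rule D(4))
      moreover have "c \<odot> (y \<ominus> x) = c \<odot> y \<ominus> c \<odot> x"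
        using x yc by (simp add: minus_eq smult_r_distr smult_r_minus)
      ultimately show ?thesis using eq[of "c \<odot> y" "c \<odot> x"] x yc by simp
    qed
    then have "(\<Union>y\<in>N +> x. N +> (c \<odot> y)) = (\<Union>y\<in>N +> x. N +> (c \<odot> x))"
      by (intro SUP_cong refl)
    moreover have "(\<Union>y\<in>N +> x. N +> (c \<odot> x)) = N +> (c \<odot> x)"
      using self[OF x] by (intro SUP_const) auto
    ultimately show ?thesis by (simp add: quotient_module_def)
  qed
  show zero: "\<zero>\<^bsub>quotient_module M N\<^esub> = N +> \<zero>"
    using N.a_rcos_const[OF D(2)] by (simp add: quotient_module_def)
  show "module complex_ring (quotient_module M N)"
  proof (rule complex_moduleI)
    show "abelian_group (quotient_module M N)"
    proof (rule abelian_groupI)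
      fix T assume "T \<in> carrier (quotient_module M N)"
      then obtain x where x: "x \<in> carrier M" "T = N +> x" by (auto simp: car)
      show "\<exists>Y\<in>carrier (quotient_module M N). Y \<oplus>\<^bsub>quotient_module M N\<^esub> T = \<zero>\<^bsub>quotient_module M N\<^esub>"
        by (rule bexI[of _ "N +> (\<ominus> x)"]) (use x in \<open>auto simp: car add zero l_neg\<close>)
    qed (auto simp: car add zero a_ac)
    show "(c + d) \<odot>\<^bsub>quotient_module M N\<^esub> T =
        c \<odot>\<^bsub>quotient_module M N\<^esub> T \<oplus>\<^bsub>quotient_module M N\<^esub> d \<odot>\<^bsub>quotient_module M N\<^esub> T"
      if "T \<in> carrier (quotient_module M N)" for c d T
      using that smult_l_distr[of c d] by (auto simp: car add scale)
    show "c \<odot>\<^bsub>quotient_module M N\<^esub> (T \<oplus>\<^bsub>quotient_module M N\<^esub> U) =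
        c \<odot>\<^bsub>quotient_module M N\<^esub> T \<oplus>\<^bsub>quotient_module M N\<^esub> c \<odot>\<^bsub>quotient_module M N\<^esub> U"
      if "T \<in> carrier (quotient_module M N)" "U \<in> carrier (quotient_module M N)" for c T U
      using that by (auto simp: car add scale smult_r_distr)
    show "(c * d) \<odot>\<^bsub>quotient_module M N\<^esub> T = c \<odot>\<^bsub>quotient_module M N\<^esub> (d \<odot>\<^bsub>quotient_module M N\<^esub> T)"
      if "T \<in> carrier (quotient_module M N)" for c d T
      using that smult_assoc1[of c d] by (auto simp: car scale)
    show "1 \<odot>\<^bsub>quotient_module M N\<^esub> T = T" if "T \<in> carrier (quotient_module M N)" for T
      using that smult_one by (auto simp: car scale)
  qed (auto simp: car scale)
qed

lemma free_module_simps [simp]: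
  "carrier (free_module S) = {c. fin_supp c \<and> {x. c x \<noteq> 0} \<subseteq> S}"
  "c \<oplus>\<^bsub>free_module S\<^esub> d = c + d" "r \<odot>\<^bsub>free_module S\<^esub> c = r *\<^sub>c c" "\<zero>\<^bsub>free_module S\<^esub> = 0"
  by (auto simp: free_module_def fin_supp_def fun_eq_iff)

lemma free_module_module: "module complex_ring (free_module S)"
proof (rule complex_moduleI)
  have add: "c + d \<in> carrier (free_module S)"
    if "c \<in> carrier (free_module S)" "d \<in> carrier (free_module S)" for c d
    using that by (auto simp: subset_iff) (metis add_0)
  have scale: "r *\<^sub>c c \<in> carrier (free_module S)" if "c \<in> carrier (free_module S)" for r c
    using that by auto
  show "abelian_group (free_module S)"
  proof (rule abelian_groupI)
    show "\<exists>y\<in>carrier (free_module S). y \<oplus>\<^bsub>free_module S\<^esub> x = \<zero>\<^bsub>free_module S\<^esub>"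
      if "x \<in> carrier (free_module S)" for x
      by (rule bexI[OF _ scale[OF that, of "-1"]]) (simp add: fun_eq_iff)
    show "\<zero>\<^bsub>free_module S\<^esub> \<in> carrier (free_module S)" by (simp add: fin_supp_def)
  qed (use add in \<open>simp_all only: free_module_simps add.assoc add_0\<close>, simp only: add.commute)
  show "c \<odot>\<^bsub>free_module S\<^esub> x \<in> carrier (free_module S)" if "x \<in> carrier (free_module S)" for c x
    using scale[OF that] by (simp only: free_module_simps)
qed (simp_all add: cfun.scale_left_distrib cfun.scale_right_distrib)

section \<open>Linear embeddings\<close>

text \<open>
  An injective linear map into a space of functions.  It allows equations between elements of a
  module to be proved as equations between functions, where finite sums need no membership conditions.
\<close>

definition lin_embedding :: "(complex, 'v, 'm) module_scheme \<Rightarrow> ('v \<Rightarrow> 'x \<Rightarrow> complex) \<Rightarrow> bool" where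
  "lin_embedding M \<theta> \<longleftrightarrow> module complex_ring M \<and> inj_on \<theta> (carrier M) \<and>
     (\<forall>x\<in>carrier M. \<forall>y\<in>carrier M. \<theta> (x \<oplus>\<^bsub>M\<^esub> y) = \<theta> x + \<theta> y) \<and>
     (\<forall>c. \<forall>x\<in>carrier M. \<theta> (c \<odot>\<^bsub>M\<^esub> x) = c *\<^sub>c \<theta> x)"

lemma lin_embeddingD:
  assumes "lin_embedding M \<theta>"
  shows "module complex_ring M" "inj_on \<theta> (carrier M)"
    "\<And>x y. x \<in> carrier M \<Longrightarrow> y \<in> carrier M \<Longrightarrow> \<theta> (x \<oplus>\<^bsub>M\<^esub> y) = \<theta> x + \<theta> y"
    "\<And>c x. x \<in> carrier M \<Longrightarrow> \<theta> (c \<odot>\<^bsub>M\<^esub> x) = c *\<^sub>c \<theta> x"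
    "\<And>x y. x \<in> carrier M \<Longrightarrow> y \<in> carrier M \<Longrightarrow> \<theta> x = \<theta> y \<Longrightarrow> x = y"
    "\<theta> \<zero>\<^bsub>M\<^esub> = 0"
proof -
  show 1: "module complex_ring M" "inj_on \<theta> (carrier M)"
    "\<And>x y. x \<in> carrier M \<Longrightarrow> y \<in> carrier M \<Longrightarrow> \<theta> (x \<oplus>\<^bsub>M\<^esub> y) = \<theta> x + \<theta> y"
    "\<And>c x. x \<in> carrier M \<Longrightarrow> \<theta> (c \<odot>\<^bsub>M\<^esub> x) = c *\<^sub>c \<theta> x"
    "\<And>x y. x \<in> carrier M \<Longrightarrow> y \<in> carrier M \<Longrightarrow> \<theta> x = \<theta> y \<Longrightarrow> x = y"
    using assms by (auto simp: lin_embedding_def inj_on_def)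
  interpret module complex_ring M by fact
  have "\<theta> (\<zero>\<^bsub>M\<^esub> \<oplus>\<^bsub>M\<^esub> \<zero>\<^bsub>M\<^esub>) = \<theta> \<zero>\<^bsub>M\<^esub> + \<theta> \<zero>\<^bsub>M\<^esub>" by (rule 1) auto
  then show "\<theta> \<zero>\<^bsub>M\<^esub> = 0" by simp
qed

lemma lin_embedding_finsum:
  assumes E: "lin_embedding M \<theta>" and "finite I" "\<And>i. i \<in> I \<Longrightarrow> F i \<in> carrier M"
  shows "\<theta> (\<Oplus>\<^bsub>M\<^esub>i\<in>I. F i) = (\<Sum>i\<in>I. \<theta> (F i))"
proof -
  interpret module complex_ring M by (rule lin_embeddingD[OF E])
  show ?thesis using assms(2,3)
  proof (induction I rule: finite_induct)
    case empty
    then show ?case by (simp add: lin_embeddingD(6)[OF E])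
  next
    case (insert i I)
    have "\<theta> (\<Oplus>\<^bsub>M\<^esub>j\<in>insert i I. F j) = \<theta> (F i \<oplus>\<^bsub>M\<^esub> (\<Oplus>\<^bsub>M\<^esub>j\<in>I. F j))"
      using insert by (subst finsum_insert) auto
    also have "\<dots> = \<theta> (F i) + \<theta> (\<Oplus>\<^bsub>M\<^esub>j\<in>I. F j)"
      by (rule lin_embeddingD(3)[OF E]) (use insert in \<open>auto intro!: finsum_closed\<close>)
    finally show ?case using insert by simp
  qed
qed

lemma lin_embedding_span:
  assumes E: "lin_embedding M \<theta>" and S: "S \<subseteq> carrier M"
  shows "\<theta> ` linear_span M S = cfun.span (\<theta> ` S)"
proof
  note D = lin_embeddingD[OF E]
  note L = complex_submoduleD[OF D(1) linear_span_submodule[OF D(1) S]]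
  let ?H = "{x \<in> carrier M. \<theta> x \<in> cfun.span (\<theta> ` S)}"
  have "submodule ?H complex_ring M"
  proof (rule complex_submoduleI[OF D(1)])
    interpret module complex_ring M by (rule D(1))
    show "\<zero>\<^bsub>M\<^esub> \<in> ?H" by (simp add: D(6) cfun.span_zero)
    show "a \<oplus>\<^bsub>M\<^esub> b \<in> ?H" if "a \<in> ?H" "b \<in> ?H" for a b
      using that by (simp add: D(3) cfun.span_add)
    show "c \<odot>\<^bsub>M\<^esub> a \<in> ?H" if "a \<in> ?H" for c a
      using that by (simp add: D(4) cfun.span_scale)
  qed auto
  then have "linear_span M S \<subseteq> ?H"
    by (rule linear_span_minimal) (use S in \<open>auto intro: cfun.span_base\<close>)
  then show "\<theta> ` linear_span M S \<subseteq> cfun.span (\<theta> ` S)" by auto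
  show "cfun.span (\<theta> ` S) \<subseteq> \<theta> ` linear_span M S"
  proof (rule cfun.span_minimal)
    show "\<theta> ` S \<subseteq> \<theta> ` linear_span M S" using linear_span_superset[of S M] by auto
    show "cfun.subspace (\<theta> ` linear_span M S)"
    proof (rule cfun.subspaceI)
      show "0 \<in> \<theta> ` linear_span M S" using L(2) D(6) by (metis imageI)
      show "x + y \<in> \<theta> ` linear_span M S"
        if x: "x \<in> \<theta> ` linear_span M S" and y: "y \<in> \<theta> ` linear_span M S" for x y
      proof -
        obtain x' y' where *: "x' \<in> linear_span M S" "y' \<in> linear_span M S" "x = \<theta> x'" "y = \<theta> y'"
          using x y by auto
        then have "x + y = \<theta> (x' \<oplus>\<^bsub>M\<^esub> y')" using L(1) by (auto simp: D(3) subsetD)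
        then show ?thesis using L(3) * by blast
      qed
      show "c *\<^sub>c x \<in> \<theta> ` linear_span M S" if x: "x \<in> \<theta> ` linear_span M S" for c x
      proof -
        obtain x' where *: "x' \<in> linear_span M S" "x = \<theta> x'" using x by auto
        then have "c *\<^sub>c x = \<theta> (c \<odot>\<^bsub>M\<^esub> x')" using L(1) by (auto simp: D(4) subsetD)
        then show ?thesis using L(4) * by blast
      qed
    qed
  qed
qed

section \<open>Normal forms of tensors\<close>

text \<open>
  A linear projection whose kernel is the space of relations; its values are the normal forms.
\<close>

definition tensor_nf ::
    "(complex, 'v, 'm) module_scheme \<Rightarrow> nat \<Rightarrow> ('v list \<Rightarrow> complex) \<Rightarrow> 'v list \<Rightarrow> complex" where
  "tensor_nf V n = (SOME \<nu>. Vector_Spaces.linear fscale fscale \<nu> \<and>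
      (\<forall>c. c - \<nu> c \<in> tensor_relations V n) \<and> (\<forall>c\<in>tensor_relations V n. \<nu> c = 0))"

text \<open>
  All representatives of a coset have the same normal form, so any of them may be chosen.
\<close>

definition tensor_coord ::
    "(complex, 'v, 'm) module_scheme \<Rightarrow> nat \<Rightarrow> ('v list \<Rightarrow> complex) set \<Rightarrow> 'v list \<Rightarrow> complex" where
  "tensor_coord V n T = tensor_nf V n (SOME c. c \<in> T)"

definition tensor_vec :: "(complex, 'v, 'm) module_scheme \<Rightarrow> 'v list \<Rightarrow> 'v list \<Rightarrow> complex" where
  "tensor_vec V xs = tensor_coord V (length xs) (tensor V xs)"

definition multilinear :: "(complex, 'v, 'm) module_scheme \<Rightarrow> nat \<Rightarrow> ('v list \<Rightarrow> 'y \<Rightarrow> complex) \<Rightarrow> bool" where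
  "multilinear V n f \<longleftrightarrow> (\<forall>xs\<in>vectors V n. \<forall>i<n.
     (\<forall>x\<in>carrier V. \<forall>y\<in>carrier V. f (xs[i := x \<oplus>\<^bsub>V\<^esub> y]) = f (xs[i := x]) + f (xs[i := y])) \<and>
     (\<forall>c. \<forall>x\<in>carrier V. f (xs[i := c \<odot>\<^bsub>V\<^esub> x]) = c *\<^sub>c f (xs[i := x])))"

lemma vectors_update: "xs \<in> vectors V n \<Longrightarrow> x \<in> carrier V \<Longrightarrow> xs[i := x] \<in> vectors V n"
  using set_update_subset_insert[of xs i x] by (auto simp: vectors_def)

context
  fixes V :: "(complex, 'v, 'm) module_scheme"
  assumes V: "module complex_ring V"
begin

lemma tensor_relators_carrier: "tensor_relators V n \<subseteq> carrier (free_module (vectors V n))"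
proof
  interpret module complex_ring V by (rule V)
  fix t assume "t \<in> tensor_relators V n"
  then consider xs i x y where "xs \<in> vectors V n" "x \<in> carrier V" "y \<in> carrier V"
      "t = (\<lambda>ys. free_gen (xs[i := x \<oplus>\<^bsub>V\<^esub> y]) ys - free_gen (xs[i := x]) ys - free_gen (xs[i := y]) ys)"
    | xs i c x where "xs \<in> vectors V n" "x \<in> carrier V"
      "t = (\<lambda>ys. free_gen (xs[i := c \<odot>\<^bsub>V\<^esub> x]) ys - c * free_gen (xs[i := x]) ys)"
    unfolding tensor_relators_def by blast
  then show "t \<in> carrier (free_module (vectors V n))"
  proof cases
    case 1
    have "t = free_gen (xs[i := x \<oplus>\<^bsub>V\<^esub> y]) + (-1) *\<^sub>c free_gen (xs[i := x]) + (-1) *\<^sub>c free_gen (xs[i := y])"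
      by (simp add: 1(4) fun_eq_iff)
    moreover have "fin_supp \<dots>" by (intro fin_supp_add fin_supp_scale fin_supp_gen)
    ultimately show ?thesis using vectors_update[OF 1(1)] 1(2,3)
      by (auto simp: free_gen_def split: if_splits)
  next
    case 2
    have "t = free_gen (xs[i := c \<odot>\<^bsub>V\<^esub> x]) + (-c) *\<^sub>c free_gen (xs[i := x])"
      by (simp add: 2(3) fun_eq_iff)
    moreover have "fin_supp \<dots>" by (intro fin_supp_add fin_supp_scale fin_supp_gen)
    ultimately show ?thesis using vectors_update[OF 2(1)] 2(2)
      by (auto simp: free_gen_def split: if_splits)
  qed
qed

lemma tensor_relations_submodule:
  "submodule (tensor_relations V n) complex_ring (free_module (vectors V n))"
  unfolding tensor_relations_def
  by (rule linear_span_submodule[OF free_module_module tensor_relators_carrier])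

lemma tensor_relations_subspace: "cfun.subspace (tensor_relations V n)"
  using complex_submoduleD(2-4)[OF free_module_module tensor_relations_submodule[of n]]
  unfolding free_module_simps by (rule cfun.subspaceI)

text \<open>
  The relations have a linear complement, so there is a linear left inverse \<open>g\<close> of their inclusion;
  \<open>c - g c\<close> is the required projection.
\<close>

lemma tensor_nf_props:
  "Vector_Spaces.linear fscale fscale (tensor_nf V n)"
  "c - tensor_nf V n c \<in> tensor_relations V n"
  "c \<in> tensor_relations V n \<Longrightarrow> tensor_nf V n c = 0"
proof -
  have "\<exists>g. range g \<subseteq> tensor_relations V n \<and> Vector_Spaces.linear fscale fscale g \<and>
      (\<forall>v\<in>tensor_relations V n. g v = v)"
    by (rule cfun_pair.linear_exists_left_inverse_on[of "\<lambda>x. x", OF cfun.linear_ident tensor_relations_subspace])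
      (rule inj_on_id2)
  then obtain g :: "('v list \<Rightarrow> complex) \<Rightarrow> 'v list \<Rightarrow> complex" where
    g: "range g \<subseteq> tensor_relations V n" "Vector_Spaces.linear fscale fscale g"
       "\<forall>v\<in>tensor_relations V n. g v = v"
    by blast
  have "Vector_Spaces.linear fscale fscale (\<lambda>c. c - g c)"
    by (rule cfun_pair.linear_compose_sub[OF cfun.linear_ident g(2)])
  then have "\<exists>\<nu>. Vector_Spaces.linear fscale fscale \<nu> \<and>
      (\<forall>c. c - \<nu> c \<in> tensor_relations V n) \<and> (\<forall>c\<in>tensor_relations V n. \<nu> c = 0)"
    using g(1,3) by (intro exI[of _ "\<lambda>c. c - g c"]) (simp add: image_subset_iff)
  from someI_ex[OF this, folded tensor_nf_def]
  show "Vector_Spaces.linear fscale fscale (tensor_nf V n)"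
    "c - tensor_nf V n c \<in> tensor_relations V n"
    "c \<in> tensor_relations V n \<Longrightarrow> tensor_nf V n c = 0" by auto
qed

lemmas tensor_power_facts =
  quotient_module_facts[OF free_module_module tensor_relations_submodule, folded tensor_power_def]

lemma free_module_minus:
  assumes "c \<in> carrier (free_module S)" "d \<in> carrier (free_module S)"
  shows "c \<ominus>\<^bsub>free_module S\<^esub> d = c - d"
proof -
  interpret F: module complex_ring "free_module S" by (rule free_module_module)
  have "(c \<ominus>\<^bsub>free_module S\<^esub> d) \<oplus>\<^bsub>free_module S\<^esub> d = c"
    using assms by (simp only: F.minus_eq F.a_assoc F.a_inv_closed F.l_neg F.r_zero)
  then have "(c \<ominus>\<^bsub>free_module S\<^esub> d) + d = c" by (simp only: free_module_simps)
  then show ?thesis by (simp only: eq_diff_eq)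
qed

lemma tensor_coord_coset:
  assumes "c \<in> carrier (free_module (vectors V n))"
  shows "tensor_coord V n (tensor_relations V n +>\<^bsub>free_module (vectors V n)\<^esub> c) = tensor_nf V n c"
proof -
  let ?T = "tensor_relations V n +>\<^bsub>free_module (vectors V n)\<^esub> c"
  define d where "d = (SOME d. d \<in> ?T)"
  have "c \<in> ?T" by (rule tensor_power_facts(6)[OF assms])
  then have d: "d \<in> ?T" unfolding d_def by (rule someI[of "\<lambda>d. d \<in> ?T"])
  have dc: "d \<in> carrier (free_module (vectors V n))"
    using tensor_power_facts(7)[OF assms d] by auto
  have "d \<ominus>\<^bsub>free_module (vectors V n)\<^esub> c \<in> tensor_relations V n"
    using tensor_power_facts(7)[OF assms d] tensor_power_facts(2)[OF dc assms] by auto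
  then have "d - c \<in> tensor_relations V n"
    using free_module_minus[OF dc assms] by simp
  then have "tensor_nf V n (d - c) = 0" by (rule tensor_nf_props(3))
  then have "tensor_nf V n d = tensor_nf V n c"
    using module_hom.diff[OF Vector_Spaces.linear.axioms(3)[OF tensor_nf_props(1)]] by simp
  then show ?thesis by (simp add: tensor_coord_def d_def)
qed

lemma tensor_coord_embedding: "lin_embedding (tensor_power V n) (tensor_coord V n)"
proof -
  let ?F = "free_module (vectors V n)" and ?N = "tensor_relations V n"
  interpret F: module complex_ring ?F by (rule free_module_module)
  interpret nf: Vector_Spaces.linear fscale fscale "tensor_nf V n" by (rule tensor_nf_props)
  have inj: "?N +>\<^bsub>?F\<^esub> c = ?N +>\<^bsub>?F\<^esub> d"
    if c: "c \<in> carrier ?F" and d: "d \<in> carrier ?F" and e: "tensor_nf V n c = tensor_nf V n d" for c d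
  proof -
    have "(c - tensor_nf V n c) - (d - tensor_nf V n d) \<in> ?N"
      by (rule cfun.subspace_diff[OF tensor_relations_subspace]) (rule tensor_nf_props)+
    then have "c - d \<in> ?N" using e by simp
    then have "c \<ominus>\<^bsub>?F\<^esub> d \<in> ?N" using free_module_minus[OF c d] by simp
    then show ?thesis using tensor_power_facts(2)[OF c d] by simp
  qed
  have cl: "c + d \<in> carrier ?F" if "c \<in> carrier ?F" "d \<in> carrier ?F" for c d
    using F.a_closed[OF that] by (simp only: free_module_simps(2))
  have cl': "r *\<^sub>c c \<in> carrier ?F" if "c \<in> carrier ?F" for c r
    using F.smult_closed[of r c] that by (simp only: free_module_simps(3) complex_ring_simps UNIV_I)
  show ?thesis
    unfolding lin_embedding_def
  proof (intro conjI ballI allI)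
    show "module complex_ring (tensor_power V n)" by (rule tensor_power_facts(8))
    show "inj_on (tensor_coord V n) (carrier (tensor_power V n))"
      unfolding tensor_power_facts(1)
    proof (intro inj_onI, elim imageE)
      fix x y c d assume "c \<in> carrier ?F" "d \<in> carrier ?F" "x = ?N +>\<^bsub>?F\<^esub> c" "y = ?N +>\<^bsub>?F\<^esub> d"
        "tensor_coord V n x = tensor_coord V n y"
      then show "x = y" using inj[of c d] by (simp only: tensor_coord_coset)
    qed
    show "tensor_coord V n (x \<oplus>\<^bsub>tensor_power V n\<^esub> y) = tensor_coord V n x + tensor_coord V n y"
      if x: "x \<in> carrier (tensor_power V n)" and y: "y \<in> carrier (tensor_power V n)" for x y
    proof -
      obtain c where c: "c \<in> carrier ?F" "x = ?N +>\<^bsub>?F\<^esub> c"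
        using x unfolding tensor_power_facts(1) by (rule imageE)
      obtain d where d: "d \<in> carrier ?F" "y = ?N +>\<^bsub>?F\<^esub> d"
        using y unfolding tensor_power_facts(1) by (rule imageE)
      have "x \<oplus>\<^bsub>tensor_power V n\<^esub> y = ?N +>\<^bsub>?F\<^esub> (c + d)"
        unfolding c(2) d(2) tensor_power_facts(3)[OF c(1) d(1)] by (simp only: free_module_simps(2))
      then show ?thesis
        unfolding c(2) d(2) by (simp only: tensor_coord_coset[OF cl[OF c(1) d(1)]]
          tensor_coord_coset[OF c(1)] tensor_coord_coset[OF d(1)] nf.add)
    qed
    show "tensor_coord V n (r \<odot>\<^bsub>tensor_power V n\<^esub> x) = r *\<^sub>c tensor_coord V n x"
      if x: "x \<in> carrier (tensor_power V n)" for r x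
    proof -
      obtain c where c: "c \<in> carrier ?F" "x = ?N +>\<^bsub>?F\<^esub> c"
        using x unfolding tensor_power_facts(1) by (rule imageE)
      have "r \<odot>\<^bsub>tensor_power V n\<^esub> x = ?N +>\<^bsub>?F\<^esub> (r *\<^sub>c c)"
        unfolding c(2) tensor_power_facts(4)[OF c(1)] by (simp only: free_module_simps(3))
      then show ?thesis
        unfolding c(2) by (simp only: tensor_coord_coset[OF cl'[OF c(1)]]
          tensor_coord_coset[OF c(1)] nf.scale)
    qed
  qed
qed

lemma free_gen_carrier: "xs \<in> S \<Longrightarrow> free_gen xs \<in> carrier (free_module S)"
  by (auto simp: free_gen_def fin_supp_def)

lemma tensor_carrier: "xs \<in> vectors V n \<Longrightarrow> tensor V xs \<in> carrier (tensor_power V n)"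
  unfolding tensor_power_facts(1) tensor_def using free_gen_carrier[of xs "vectors V n"]
  by (auto simp: vectors_def simp del: free_module_simps)

lemma tensor_vec_nf: "xs \<in> vectors V n \<Longrightarrow> tensor_vec V xs = tensor_nf V n (free_gen xs)"
  unfolding tensor_vec_def tensor_def
  using tensor_coord_coset[OF free_gen_carrier, of xs n] by (simp add: vectors_def)

lemma tensor_coord_tensor: "xs \<in> vectors V n \<Longrightarrow> tensor_coord V n (tensor V xs) = tensor_vec V xs"
  by (simp add: tensor_vec_def vectors_def)

lemma tensor_vec_multilinear: "multilinear V n (tensor_vec V)"
proof -
  interpret module complex_ring V by (rule V)
  interpret nf: Vector_Spaces.linear fscale fscale "tensor_nf V n" by (rule tensor_nf_props)
  have rel: "tensor_nf V n t = 0" if "t \<in> tensor_relators V n" for t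
    using that linear_span_superset[of "tensor_relators V n" "free_module (vectors V n)"]
    by (intro tensor_nf_props(3)) (auto simp: tensor_relations_def)
  show ?thesis unfolding multilinear_def
  proof (intro ballI allI impI conjI)
    fix xs i x y assume xs: "xs \<in> vectors V n" "i < n" and x: "x \<in> carrier V"
    { assume y: "y \<in> carrier V"
      have "free_gen (xs[i := x \<oplus>\<^bsub>V\<^esub> y]) - free_gen (xs[i := x]) - free_gen (xs[i := y])
          \<in> tensor_relators V n"
        unfolding tensor_relators_def fun_diff_def using xs x y by (intro UnI1) blast
      from rel[OF this] show "tensor_vec V (xs[i := x \<oplus>\<^bsub>V\<^esub> y]) = tensor_vec V (xs[i := x]) + tensor_vec V (xs[i := y])"
        using xs x y by (simp add: tensor_vec_nf[OF vectors_update[OF xs(1)]] nf.diff nf.add algebra_simps) }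
    fix c
    have "free_gen (xs[i := c \<odot>\<^bsub>V\<^esub> x]) - c *\<^sub>c free_gen (xs[i := x]) \<in> tensor_relators V n"
      unfolding tensor_relators_def fun_diff_def fscale_def using xs x by (intro UnI2) blast
    from rel[OF this] show "tensor_vec V (xs[i := c \<odot>\<^bsub>V\<^esub> x]) = c *\<^sub>c tensor_vec V (xs[i := x])"
      using xs x by (simp add: tensor_vec_nf[OF vectors_update[OF xs(1)]] nf.diff nf.scale)
  qed
qed

text \<open>
  The universal property of the tensor power: the linear extension of a multilinear map kills the
  generators of the relations, hence their span.
\<close>

lemma lin_ext_relations:
  assumes "multilinear V n f" "t \<in> tensor_relations V n"
  shows "lin_ext f t = 0"
proof -
  interpret module complex_ring V by (rule V)
  let ?F = "free_module (vectors V n)"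
  let ?H = "{t \<in> carrier ?F. lin_ext f t = 0}"
  have "submodule ?H complex_ring ?F"
  proof (rule complex_submoduleI[OF free_module_module])
    interpret F: module complex_ring ?F by (rule free_module_module)
    show "a \<oplus>\<^bsub>?F\<^esub> b \<in> ?H" if "a \<in> ?H" "b \<in> ?H" for a b
      using that F.a_closed[of a b] by (auto simp: lin_ext_add)
    show "c \<odot>\<^bsub>?F\<^esub> a \<in> ?H" if "a \<in> ?H" for c a
      using that F.smult_closed[of c a] by (auto simp: lin_ext_scale)
    show "\<zero>\<^bsub>?F\<^esub> \<in> ?H" using F.zero_closed by simp
  qed auto
  moreover have "tensor_relators V n \<subseteq> ?H"
  proof
    fix t assume t: "t \<in> tensor_relators V n"
    then have "t \<in> carrier ?F" using tensor_relators_carrier by blast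
    moreover from t consider xs i x y where "xs \<in> vectors V n" "i < n" "x \<in> carrier V" "y \<in> carrier V"
        "t = (\<lambda>ys. free_gen (xs[i := x \<oplus>\<^bsub>V\<^esub> y]) ys - free_gen (xs[i := x]) ys - free_gen (xs[i := y]) ys)"
      | xs i c x where "xs \<in> vectors V n" "i < n" "x \<in> carrier V"
        "t = (\<lambda>ys. free_gen (xs[i := c \<odot>\<^bsub>V\<^esub> x]) ys - c * free_gen (xs[i := x]) ys)"
      unfolding tensor_relators_def by blast
    then have "lin_ext f t = 0"
    proof cases
      case 1
      have "t = free_gen (xs[i := x \<oplus>\<^bsub>V\<^esub> y]) - free_gen (xs[i := x]) - free_gen (xs[i := y])"
        unfolding 1(5) by (simp add: fun_diff_def)
      then have t: "lin_ext f t = f (xs[i := x \<oplus>\<^bsub>V\<^esub> y]) - f (xs[i := x]) - f (xs[i := y])"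
        by (simp only: lin_ext_diff lin_ext_gen fin_supp_diff fin_supp_gen)
      have "f (xs[i := x \<oplus>\<^bsub>V\<^esub> y]) = f (xs[i := x]) + f (xs[i := y])"
        using assms(1) 1(1-4) unfolding multilinear_def by blast
      then show ?thesis by (simp only: t add_diff_cancel_left' diff_self)
    next
      case 2
      have "t = free_gen (xs[i := c \<odot>\<^bsub>V\<^esub> x]) - c *\<^sub>c free_gen (xs[i := x])"
        unfolding 2(4) by (simp add: fun_diff_def fscale_def)
      then have t: "lin_ext f t = f (xs[i := c \<odot>\<^bsub>V\<^esub> x]) - c *\<^sub>c f (xs[i := x])"
        by (simp only: lin_ext_diff lin_ext_scale lin_ext_gen fin_supp_scale fin_supp_gen)
      have "f (xs[i := c \<odot>\<^bsub>V\<^esub> x]) = c *\<^sub>c f (xs[i := x])"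
        using assms(1) 2(1-3) unfolding multilinear_def by blast
      then show ?thesis by (simp only: t diff_self)
    qed
    ultimately show "t \<in> ?H" by simp
  qed
  ultimately have "tensor_relations V n \<subseteq> ?H"
    unfolding tensor_relations_def by (rule linear_span_minimal)
  then show ?thesis using assms(2) by auto
qed

end

section \<open>Linear maps on spans\<close>

definition lin_on :: "('x \<Rightarrow> complex) set \<Rightarrow> (('x \<Rightarrow> complex) \<Rightarrow> 'y \<Rightarrow> complex) \<Rightarrow> bool" where
  "lin_on S L \<longleftrightarrow> (\<forall>x\<in>S. \<forall>y\<in>S. L (x + y) = L x + L y) \<and> (\<forall>c. \<forall>x\<in>S. L (c *\<^sub>c x) = c *\<^sub>c L x)"

lemma lin_onD:
  assumes "lin_on S L"
  shows "x \<in> S \<Longrightarrow> y \<in> S \<Longrightarrow> L (x + y) = L x + L y" "x \<in> S \<Longrightarrow> L (c *\<^sub>c x) = c *\<^sub>c L x"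
  using assms by (auto simp: lin_on_def)

lemma lin_on_zero: "lin_on S L \<Longrightarrow> 0 \<in> S \<Longrightarrow> L 0 = 0"
  using lin_onD(2)[of S L 0 0] by simp

lemma lin_on_sum:
  assumes "lin_on S L" "cfun.subspace S" "\<And>i. i \<in> I \<Longrightarrow> F i \<in> S"
  shows "L (\<Sum>i\<in>I. F i) = (\<Sum>i\<in>I. L (F i))"
  using assms(3)
proof (induction I rule: infinite_finite_induct)
  case (insert i I)
  have "(\<Sum>i\<in>I. F i) \<in> S" using insert by (intro cfun.subspace_sum assms(2)) auto
  then have "L (F i + (\<Sum>i\<in>I. F i)) = L (F i) + L (\<Sum>i\<in>I. F i)"
    using insert by (intro lin_onD(1)[OF assms(1)]) auto
  moreover have "L (\<Sum>i\<in>I. F i) = (\<Sum>i\<in>I. L (F i))" using insert by auto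
  ultimately show ?case unfolding sum.insert[OF insert(1,2)] by (rule trans[OF _ arg_cong])
qed (use lin_on_zero[OF assms(1) cfun.subspace_0[OF assms(2)]] in auto)

lemma lin_on_subset: "lin_on T L \<Longrightarrow> S \<subseteq> T \<Longrightarrow> lin_on S L"
  unfolding lin_on_def by blast

lemma lin_on_comp: "lin_on S f \<Longrightarrow> f ` S \<subseteq> T \<Longrightarrow> lin_on T g \<Longrightarrow> lin_on S (\<lambda>x. g (f x))"
  by (auto simp: lin_on_def image_subset_iff)

lemma lin_on_add: "lin_on S f \<Longrightarrow> lin_on S g \<Longrightarrow> lin_on S (\<lambda>x. f x + g x)"
  by (auto simp: lin_on_def fun_eq_iff algebra_simps)

text \<open>
  By this principle and the next one, memberships and identities for chains are reduced to generators.
\<close>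

lemma lin_on_span_image:
  assumes "lin_on (cfun.span B) L" "cfun.subspace T" "\<And>b. b \<in> B \<Longrightarrow> L b \<in> T" "x \<in> cfun.span B"
  shows "L x \<in> T"
proof -
  let ?H = "{x \<in> cfun.span B. L x \<in> T}"
  have "cfun.subspace ?H"
  proof (rule cfun.subspaceI)
    show "0 \<in> ?H"
      using lin_on_zero[OF assms(1)] assms(2) by (simp add: cfun.span_zero cfun.subspace_0)
    show "x + y \<in> ?H" if "x \<in> ?H" "y \<in> ?H" for x y
      using that lin_onD(1)[OF assms(1), of x y] cfun.subspace_add[OF assms(2)]
      by (simp add: cfun.span_add)
    show "c *\<^sub>c x \<in> ?H" if "x \<in> ?H" for c x
      using that lin_onD(2)[OF assms(1), of x c] cfun.subspace_scale[OF assms(2)]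
      by (simp add: cfun.span_scale)
  qed
  moreover have "B \<subseteq> ?H" using assms(3) cfun.span_base by auto
  ultimately have "cfun.span B \<subseteq> ?H" by (rule cfun.span_minimal[rotated])
  then show ?thesis using assms(4) by auto
qed

lemma lin_on_span_eq:
  assumes "lin_on (cfun.span B) f" "lin_on (cfun.span B) g" "\<And>b. b \<in> B \<Longrightarrow> f b = g b" "x \<in> cfun.span B"
  shows "f x = g x"
proof -
  have "lin_on (cfun.span B) (\<lambda>x. f x + (-1) *\<^sub>c g x)"
    using assms(1,2) by (auto simp: lin_on_def fun_eq_iff algebra_simps)
  moreover have "cfun.subspace {0 :: 'b \<Rightarrow> complex}" by (rule cfun.subspaceI) auto
  moreover have "f b + (-1) *\<^sub>c g b \<in> {0}" if "b \<in> B" for b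
    using assms(3)[OF that] by (simp add: fun_eq_iff)
  ultimately have "f x + (-1) *\<^sub>c g x \<in> {0}"
    using assms(4) by (rule lin_on_span_image)
  then show ?thesis by (simp add: fun_eq_iff)
qed

lemma lin_on_lin_ext: "lin_on {c. fin_supp c} (lin_ext f)"
  by (simp add: lin_on_def lin_ext_add lin_ext_scale)

lemma lin_ext_sum_gen:
  assumes "fin_supp c" shows "c = (\<Sum>x | c x \<noteq> 0. c x *\<^sub>c free_gen x)"
proof
  fix y
  have f: "finite {x. c x \<noteq> 0}" using assms by (simp add: fin_supp_def)
  have "(\<Sum>x | c x \<noteq> 0. c x *\<^sub>c free_gen x) y = (\<Sum>x | c x \<noteq> 0. if x = y then c x else 0)"
    unfolding sum_fun_apply by (rule sum.cong) (auto simp: free_gen_def)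
  also have "\<dots> = c y" using f by (simp add: sum.delta)
  finally show "c y = (\<Sum>x | c x \<noteq> 0. c x *\<^sub>c free_gen x) y" by simp
qed

definition tensor_coords :: "(complex, 'v, 'm) module_scheme \<Rightarrow> nat \<Rightarrow> ('v list \<Rightarrow> complex) set" where
  "tensor_coords V n = cfun.span (tensor_vec V ` vectors V n)"

lemma multilinearD:
  assumes "multilinear V n f" "xs \<in> vectors V n" "i < n" "x \<in> carrier V"
  shows "y \<in> carrier V \<Longrightarrow> f (xs[i := x \<oplus>\<^bsub>V\<^esub> y]) = f (xs[i := x]) + f (xs[i := y])"
    "f (xs[i := c \<odot>\<^bsub>V\<^esub> x]) = c *\<^sub>c f (xs[i := x])"
  using assms unfolding multilinear_def by blast+

text \<open>
  This is what makes the contributions of incompatible group elements vanish: they have a zero entry.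
\<close>

lemma multilinear_zero:
  assumes "module complex_ring V" "multilinear V n f" "xs \<in> vectors V n" "i < n" "xs ! i = \<zero>\<^bsub>V\<^esub>"
  shows "f xs = 0"
proof -
  interpret module complex_ring V by fact
  have "xs[i := 0 \<odot>\<^bsub>V\<^esub> \<zero>\<^bsub>V\<^esub>] = xs"
    using assms(3-5) smult_r_null[of 0] by (metis UNIV_I complex_ring_simps(1) list_update_id)
  then have "f xs = 0 *\<^sub>c f (xs[i := \<zero>\<^bsub>V\<^esub>])"
    using multilinearD(2)[OF assms(2-4) zero_closed, of 0] by simp
  then show ?thesis by simp
qed

lemma multilinear_sum:
  assumes "\<And>i. i \<in> I \<Longrightarrow> multilinear V n (f i)"
  shows "multilinear V n (\<lambda>xs. \<Sum>i\<in>I. f i xs)"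
  unfolding multilinear_def
proof (intro ballI allI impI conjI)
  fix xs j x y assume xs: "xs \<in> vectors V n" "j < n" and x: "x \<in> carrier V"
  show "(\<Sum>i\<in>I. f i (xs[j := x \<oplus>\<^bsub>V\<^esub> y])) = (\<Sum>i\<in>I. f i (xs[j := x])) + (\<Sum>i\<in>I. f i (xs[j := y]))"
    if "y \<in> carrier V"
    unfolding sum.distrib[symmetric]
    by (rule sum.cong[OF refl], rule multilinearD(1)[OF assms]) (use xs x that in auto)
  show "(\<Sum>i\<in>I. f i (xs[j := c \<odot>\<^bsub>V\<^esub> x])) = c *\<^sub>c (\<Sum>i\<in>I. f i (xs[j := x]))" for c
    unfolding cfun.scale_sum_right
    by (rule sum.cong[OF refl], rule multilinearD(2)[OF assms]) (use xs x in auto)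
qed

lemma multilinear_scale:
  assumes "multilinear V n f"
  shows "multilinear V n (\<lambda>xs. c *\<^sub>c f xs)"
  unfolding multilinear_def
proof (intro ballI allI impI conjI)
  fix xs j x y assume xs: "xs \<in> vectors V n" "j < n" and x: "x \<in> carrier V"
  note M = multilinearD[OF assms xs x]
  show "c *\<^sub>c f (xs[j := x \<oplus>\<^bsub>V\<^esub> y]) = c *\<^sub>c f (xs[j := x]) + c *\<^sub>c f (xs[j := y])" if "y \<in> carrier V"
    using M(1)[OF that] by (simp add: cfun.scale_right_distrib)
  show "c *\<^sub>c f (xs[j := d \<odot>\<^bsub>V\<^esub> x]) = d *\<^sub>c c *\<^sub>c f (xs[j := x])" for d
    using M(2)[of d] by (simp add: mult.commute)
qed

text \<open>
  A normal form differs from any representative by a relation, so a linear extension of a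
  multilinear map takes the same value on both.  In particular it has the prescribed values on
  elementary tensors, although their normal forms are not explicit.
\<close>

lemma tensor_coord_facts:
  assumes V: "module complex_ring V"
  shows "tensor_coord V n ` carrier (tensor_power V n) = tensor_coords V n"
    and "t \<in> tensor_coords V n \<Longrightarrow> fin_supp t"
    and "multilinear V n f \<Longrightarrow> xs \<in> vectors V n \<Longrightarrow> lin_ext f (tensor_vec V xs) = f xs"
    and "multilinear V n f \<Longrightarrow> c \<in> carrier (free_module (vectors V n)) \<Longrightarrow>
          lin_ext f (tensor_nf V n c) = lin_ext f c"
proof -
  let ?F = "free_module (vectors V n)" and ?N = "tensor_relations V n"
  interpret F: module complex_ring ?F by (rule free_module_module)
  interpret nf: Vector_Spaces.linear fscale fscale "tensor_nf V n" by (rule tensor_nf_props[OF V])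
  note E = lin_embeddingD[OF tensor_coord_embedding[OF V, of n]]
  have N: "?N \<subseteq> carrier ?F"
    using complex_submoduleD(1)[OF free_module_module tensor_relations_submodule[OF V]] .
  have nffin: "fin_supp (tensor_nf V n c)" if "fin_supp c" for c
  proof -
    have "fin_supp (c - tensor_nf V n c)" using tensor_nf_props(2)[OF V] N by auto
    then have "fin_supp (c - (c - tensor_nf V n c))" using that by (rule fin_supp_diff[rotated])
    then show ?thesis by simp
  qed
  have lin: "lin_ext f (tensor_nf V n c) = lin_ext f c" if f: "multilinear V n f" and c: "fin_supp c" for f :: "_ \<Rightarrow> 'z \<Rightarrow> complex" and c
  proof -
    have "lin_ext f (c - tensor_nf V n c) = 0"
      by (rule lin_ext_relations[OF V f tensor_nf_props(2)[OF V]])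
    then show ?thesis using c nffin[OF c] by (simp add: lin_ext_diff)
  qed
  show "lin_ext f (tensor_nf V n c) = lin_ext f c"
    if "multilinear V n f" "c \<in> carrier (free_module (vectors V n))"
    using lin[OF that(1)] that(2) by simp
  show "lin_ext f (tensor_vec V xs) = f xs" if "multilinear V n f" "xs \<in> vectors V n"
    using lin[OF that(1), of "free_gen xs"] by (simp add: tensor_vec_nf[OF V that(2)])
  have sub: "cfun.subspace {c :: 'a list \<Rightarrow> complex. fin_supp c}"
    by (rule cfun.subspaceI) (auto simp: fin_supp_def[of 0])
  have "tensor_vec V ` vectors V n \<subseteq> {c. fin_supp c}"
    using nffin tensor_vec_nf[OF V] by auto
  then show "t \<in> tensor_coords V n \<Longrightarrow> fin_supp t"
    using cfun.span_minimal[OF _ sub, of "tensor_vec V ` vectors V n"]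
    unfolding tensor_coords_def by blast
  show "tensor_coord V n ` carrier (tensor_power V n) = tensor_coords V n"
  proof
    show "tensor_coord V n ` carrier (tensor_power V n) \<subseteq> tensor_coords V n"
    proof
      fix t assume "t \<in> tensor_coord V n ` carrier (tensor_power V n)"
      then obtain c where c: "c \<in> carrier ?F" "t = tensor_nf V n c"
        unfolding tensor_power_facts(1)[OF V] using tensor_coord_coset[OF V, of _ n] by (elim imageE) blast
      have "t = (\<Sum>x | c x \<noteq> 0. c x *\<^sub>c tensor_nf V n (free_gen x))"
        unfolding c(2) using c(1) by (subst lin_ext_sum_gen[of c]) (simp_all add: nf.sum nf.scale)
      also have "\<dots> = (\<Sum>x | c x \<noteq> 0. c x *\<^sub>c tensor_vec V x)"
        by (rule sum.cong) (use c(1) in \<open>auto simp: tensor_vec_nf[OF V]\<close>)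
      also have "\<dots> \<in> tensor_coords V n"
        unfolding tensor_coords_def
        by (intro cfun.span_sum cfun.span_scale cfun.span_base) (use c(1) in auto)
      finally show "t \<in> tensor_coords V n" .
    qed
    have s: "tensor V ` vectors V n \<subseteq> carrier (tensor_power V n)"
      using tensor_carrier[OF V] by auto
    have "tensor_coords V n = cfun.span (tensor_coord V n ` tensor V ` vectors V n)"
      unfolding tensor_coords_def image_image
      by (rule arg_cong[of _ _ cfun.span], rule image_cong) (auto simp: tensor_coord_tensor[OF V])
    also have "\<dots> = tensor_coord V n ` linear_span (tensor_power V n) (tensor V ` vectors V n)"
      by (rule lin_embedding_span[OF tensor_coord_embedding[OF V] s, symmetric])
    also have "\<dots> \<subseteq> tensor_coord V n ` carrier (tensor_power V n)"
      using complex_submoduleD(1)[OF E(1) linear_span_submodule[OF E(1) s]] by (rule image_mono)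
    finally show "tensor_coords V n \<subseteq> tensor_coord V n ` carrier (tensor_power V n)" .
  qed
qed

lemma lin_on_tensor_coords:
  assumes "module complex_ring V"
  shows "lin_on (tensor_coords V n) (lin_ext f)"
  by (rule lin_on_subset[OF lin_on_lin_ext]) (use tensor_coord_facts(2)[OF assms] in auto)

text \<open>
  The value of \<open>tensor_lift\<close> is computed from an arbitrary representative, in particular from the
  normal form; in coordinates it is therefore the linear extension of \<open>f\<close>.
\<close>

lemma tensor_lift_facts:
  assumes V: "module complex_ring V" and E: "lin_embedding W \<theta>"
    and F: "\<And>xs. xs \<in> vectors V n \<Longrightarrow> F xs \<in> carrier W"
    and f: "\<And>xs. xs \<in> vectors V n \<Longrightarrow> \<theta> (F xs) = f xs"
    and mult: "multilinear V n f"
  shows "T \<in> carrier (tensor_power V n) \<Longrightarrow> tensor_lift W F T \<in> carrier W"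
    and "T \<in> carrier (tensor_power V n) \<Longrightarrow> \<theta> (tensor_lift W F T) = lin_ext f (tensor_coord V n T)"
    and "tensor_lift W F \<in> linear_maps (tensor_power V n) W"
    and "xs \<in> vectors V n \<Longrightarrow> tensor_lift W F (tensor V xs) = F xs"
proof -
  let ?F = "free_module (vectors V n)" and ?N = "tensor_relations V n"
  note D = lin_embeddingD[OF E]
  note P = lin_embeddingD[OF tensor_coord_embedding[OF V, of n]]
  interpret W: module complex_ring W by (rule D(1))
  interpret TP: module complex_ring "tensor_power V n" by (rule P(1))
  define val where "val c = (\<Oplus>\<^bsub>W\<^esub>xs\<in>{xs. c xs \<noteq> 0}. c xs \<odot>\<^bsub>W\<^esub> F xs)" for c
  have val: "val c \<in> carrier W \<and> \<theta> (val c) = lin_ext f c" if c: "c \<in> carrier ?F" for c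
  proof
    have fin: "finite {xs. c xs \<noteq> 0}" and sub: "{xs. c xs \<noteq> 0} \<subseteq> vectors V n"
      using c by (auto simp: fin_supp_def)
    have cl: "c xs \<odot>\<^bsub>W\<^esub> F xs \<in> carrier W" if "xs \<in> {xs. c xs \<noteq> 0}" for xs
      using F sub that by auto
    show "val c \<in> carrier W" unfolding val_def by (rule W.finsum_closed) (use cl in auto)
    have "\<theta> (val c) = (\<Sum>xs\<in>{xs. c xs \<noteq> 0}. \<theta> (c xs \<odot>\<^bsub>W\<^esub> F xs))"
      unfolding val_def by (rule lin_embedding_finsum[OF E fin cl])
    also have "\<dots> = (\<Sum>xs\<in>{xs. c xs \<noteq> 0}. c xs *\<^sub>c f xs)"
      by (rule sum.cong[OF refl]) (use F f sub in \<open>auto simp: D(4)\<close>)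
    finally show "\<theta> (val c) = lin_ext f c" by (simp add: lin_ext_def)
  qed
  have lift: "tensor_lift W F (?N +>\<^bsub>?F\<^esub> c) = val c" if c: "c \<in> carrier ?F" for c
  proof -
    have "val d = val c" if d: "d \<in> ?N +>\<^bsub>?F\<^esub> c" for d
    proof -
      have dc: "d \<in> carrier ?F" "?N +>\<^bsub>?F\<^esub> d = ?N +>\<^bsub>?F\<^esub> c"
        using tensor_power_facts(7)[OF V c d] by auto
      have "tensor_nf V n d = tensor_nf V n c"
        using tensor_coord_coset[OF V dc(1)] tensor_coord_coset[OF V c] dc(2) by simp
      then have "lin_ext f d = lin_ext f c"
        using tensor_coord_facts(4)[OF V mult dc(1)] tensor_coord_facts(4)[OF V mult c] by simp
      then show ?thesis using D(5)[of "val d" "val c"] val[OF dc(1)] val[OF c] by simp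
    qed
    then have "val ` (?N +>\<^bsub>?F\<^esub> c) = {val c}"
      using tensor_power_facts(6)[OF V c] by blast
    moreover have "tensor_lift W F (?N +>\<^bsub>?F\<^esub> c) = the_elem (val ` (?N +>\<^bsub>?F\<^esub> c))"
      unfolding tensor_lift_def val_def[abs_def] ..
    ultimately show ?thesis by (simp only: the_elem_eq)
  qed
  show car: "tensor_lift W F T \<in> carrier W" if T: "T \<in> carrier (tensor_power V n)" for T
  proof -
    obtain c where c: "c \<in> carrier ?F" "T = ?N +>\<^bsub>?F\<^esub> c"
      using T unfolding tensor_power_facts(1)[OF V] by (rule imageE)
    show ?thesis using val[OF c(1)] lift[OF c(1)] c(2) by simp
  qed
  show coord: "\<theta> (tensor_lift W F T) = lin_ext f (tensor_coord V n T)" if T: "T \<in> carrier (tensor_power V n)" for T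
  proof -
    obtain c where c: "c \<in> carrier ?F" "T = ?N +>\<^bsub>?F\<^esub> c"
      using T unfolding tensor_power_facts(1)[OF V] by (rule imageE)
    show ?thesis using val[OF c(1)] lift[OF c(1)] c(2) tensor_coord_coset[OF V c(1)]
        tensor_coord_facts(4)[OF V mult c(1)] by simp
  qed
  have tc: "tensor_coord V n T \<in> tensor_coords V n" if "T \<in> carrier (tensor_power V n)" for T
    using tensor_coord_facts(1)[OF V, of n] that by auto
  note L = lin_onD[OF lin_on_tensor_coords[OF V, of n f]]
  show "tensor_lift W F \<in> linear_maps (tensor_power V n) W"
    unfolding linear_maps_def
  proof (intro CollectI conjI ballI allI)
    show "tensor_lift W F \<in> carrier (tensor_power V n) \<rightarrow> carrier W" using car by auto
    fix S assume S: "S \<in> carrier (tensor_power V n)"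
    show "tensor_lift W F (S \<oplus>\<^bsub>tensor_power V n\<^esub> T) = tensor_lift W F S \<oplus>\<^bsub>W\<^esub> tensor_lift W F T"
      if T: "T \<in> carrier (tensor_power V n)" for T
    proof (rule D(5))
      show "\<theta> (tensor_lift W F (S \<oplus>\<^bsub>tensor_power V n\<^esub> T)) = \<theta> (tensor_lift W F S \<oplus>\<^bsub>W\<^esub> tensor_lift W F T)"
        using coord[OF TP.a_closed[OF S T]] coord[OF S] coord[OF T] D(3)[OF car[OF S] car[OF T]]
          P(3)[OF S T] L(1)[OF tc[OF S] tc[OF T]] by simp
    qed (use car S T in auto)
    show "tensor_lift W F (c \<odot>\<^bsub>tensor_power V n\<^esub> S) = c \<odot>\<^bsub>W\<^esub> tensor_lift W F S" for c
    proof (rule D(5))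
      have cS: "c \<odot>\<^bsub>tensor_power V n\<^esub> S \<in> carrier (tensor_power V n)" using S by simp
      show "\<theta> (tensor_lift W F (c \<odot>\<^bsub>tensor_power V n\<^esub> S)) = \<theta> (c \<odot>\<^bsub>W\<^esub> tensor_lift W F S)"
        using coord[OF cS] coord[OF S] D(4)[OF car[OF S]] P(4)[OF S] L(2)[OF tc[OF S]] by simp
    qed (use car S in auto)
  qed
  show "tensor_lift W F (tensor V xs) = F xs" if xs: "xs \<in> vectors V n"
  proof (rule D(5))
    show "\<theta> (tensor_lift W F (tensor V xs)) = \<theta> (F xs)"
      using coord[OF tensor_carrier[OF V xs]] tensor_coord_tensor[OF V xs]
        tensor_coord_facts(3)[OF V mult xs] f[OF xs] by simp
  qed (use car tensor_carrier[OF V xs] F xs in auto)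
qed

section \<open>Quasi-isomorphisms\<close>

lemma linear_maps_facts:
  assumes "f \<in> linear_maps M N" "module complex_ring M" "module complex_ring N"
  shows "x \<in> carrier M \<Longrightarrow> f x \<in> carrier N"
    "x \<in> carrier M \<Longrightarrow> y \<in> carrier M \<Longrightarrow> f (x \<oplus>\<^bsub>M\<^esub> y) = f x \<oplus>\<^bsub>N\<^esub> f y"
    "x \<in> carrier M \<Longrightarrow> f (c \<odot>\<^bsub>M\<^esub> x) = c \<odot>\<^bsub>N\<^esub> f x"
    "f \<zero>\<^bsub>M\<^esub> = \<zero>\<^bsub>N\<^esub>"
    "x \<in> carrier M \<Longrightarrow> y \<in> carrier M \<Longrightarrow> f (x \<ominus>\<^bsub>M\<^esub> y) = f x \<ominus>\<^bsub>N\<^esub> f y"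
proof -
  interpret M: module complex_ring M by fact
  interpret N: module complex_ring N by fact
  show cl: "f x \<in> carrier N" if "x \<in> carrier M" for x
    using assms(1) that by (auto simp: linear_maps_def)
  show add: "f (x \<oplus>\<^bsub>M\<^esub> y) = f x \<oplus>\<^bsub>N\<^esub> f y" if "x \<in> carrier M" "y \<in> carrier M" for x y
    using assms(1) that by (auto simp: linear_maps_def)
  show "f (c \<odot>\<^bsub>M\<^esub> x) = c \<odot>\<^bsub>N\<^esub> f x" if "x \<in> carrier M" for c x
    using assms(1) that by (auto simp: linear_maps_def)
  show z: "f \<zero>\<^bsub>M\<^esub> = \<zero>\<^bsub>N\<^esub>"
    using add[of "\<zero>\<^bsub>M\<^esub>" "\<zero>\<^bsub>M\<^esub>"] cl[of "\<zero>\<^bsub>M\<^esub>"] by simp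
  show "f (x \<ominus>\<^bsub>M\<^esub> y) = f x \<ominus>\<^bsub>N\<^esub> f y" if x: "x \<in> carrier M" and y: "y \<in> carrier M" for x y
  proof -
    have "f (\<ominus>\<^bsub>M\<^esub> y) = \<ominus>\<^bsub>N\<^esub> f y"
      using add[of "\<ominus>\<^bsub>M\<^esub> y" y] y cl z by (intro N.minus_equality[symmetric]) (simp_all add: M.l_neg)
    then show ?thesis using add[of x "\<ominus>\<^bsub>M\<^esub> y"] x y by (simp add: a_minus_def)
  qed
qed

lemma homology_coset [simp]: "N +>\<^bsub>M\<lparr>carrier := Z\<rparr>\<^esub> x = N +>\<^bsub>M\<^esub> x"
  by (simp add: a_r_coset_def r_coset_def)

lemma cycles_boundaries:
  assumes "chain_complex C d"
  shows "module complex_ring (C n\<lparr>carrier := cycles C d n\<rparr>)"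
    and "submodule (boundaries C d n) complex_ring (C n\<lparr>carrier := cycles C d n\<rparr>)"
    and "cycles C d n \<subseteq> carrier (C n)"
proof -
  have M: "module complex_ring (C k)" and d: "d k \<in> linear_maps (C (Suc k)) (C k)"
    and dd: "x \<in> carrier (C (Suc (Suc k))) \<Longrightarrow> d k (d (Suc k) x) = \<zero>\<^bsub>C k\<^esub>" for k x
    using assms by (auto simp: chain_complex_def)
  note L = linear_maps_facts[OF d M M]
  interpret n: module complex_ring "C n" by (rule M)
  interpret Sn: module complex_ring "C (Suc n)" by (rule M)
  have sub: "submodule (cycles C d n) complex_ring (C n)"
  proof (cases n)
    case 0
    then show ?thesis using n.carrier_is_submodule by (simp add: cycles_def)
  next
    case (Suc k)
    interpret k: module complex_ring "C k" by (rule M)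
    interpret Sk: module complex_ring "C (Suc k)" by (rule M)
    show ?thesis unfolding Suc
      by (rule complex_submoduleI[OF M]) (auto simp: cycles_def L Sk.smult_closed)
  qed
  show Z: "module complex_ring (C n\<lparr>carrier := cycles C d n\<rparr>)"
    by (rule submodule.submodule_is_module[OF sub M])
  show cyc: "cycles C d n \<subseteq> carrier (C n)"
    using complex_submoduleD(1)[OF M sub] .
  have img: "boundaries C d n \<subseteq> cycles C d n"
    using dd L(1) by (cases n) (auto simp: boundaries_def cycles_def)
  show "submodule (boundaries C d n) complex_ring (C n\<lparr>carrier := cycles C d n\<rparr>)"
  proof (rule complex_submoduleI[OF Z])
    show "boundaries C d n \<subseteq> carrier (C n\<lparr>carrier := cycles C d n\<rparr>)" using img by simp
    show "\<zero>\<^bsub>C n\<lparr>carrier := cycles C d n\<rparr>\<^esub> \<in> boundaries C d n"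
      using L(4)[of n] Sn.zero_closed by (auto simp: boundaries_def image_iff intro!: bexI[of _ "\<zero>\<^bsub>C (Suc n)\<^esub>"])
    show "a \<oplus>\<^bsub>C n\<lparr>carrier := cycles C d n\<rparr>\<^esub> b \<in> boundaries C d n"
      if ab: "a \<in> boundaries C d n" "b \<in> boundaries C d n" for a b
    proof -
      obtain a' b' where *: "a' \<in> carrier (C (Suc n))" "b' \<in> carrier (C (Suc n))" "a = d n a'" "b = d n b'"
        using ab by (auto simp: boundaries_def)
      have "a \<oplus>\<^bsub>C n\<^esub> b = d n (a' \<oplus>\<^bsub>C (Suc n)\<^esub> b')" using * L(2) by simp
      then show ?thesis using * by (simp add: boundaries_def)
    qed
    show "c \<odot>\<^bsub>C n\<lparr>carrier := cycles C d n\<rparr>\<^esub> a \<in> boundaries C d n" if a: "a \<in> boundaries C d n" for c a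
    proof -
      obtain a' where *: "a' \<in> carrier (C (Suc n))" "a = d n a'"
        using a by (auto simp: boundaries_def)
      have "c \<odot>\<^bsub>C n\<^esub> a = d n (c \<odot>\<^bsub>C (Suc n)\<^esub> a')" using * L(3) by simp
      then show ?thesis using * Sn.smult_closed[of c a'] by (auto simp: boundaries_def)
    qed
  qed
qed

text \<open>
  Surjectivity on homology follows if cycles lift to cycles, and injectivity if only boundaries are
  mapped to boundaries.
\<close>

lemma quasi_isomorphismI:
  assumes f: "chain_map C d D e f"
    and surj: "\<And>n y. y \<in> cycles D e n \<Longrightarrow> \<exists>x\<in>cycles C d n. f n x = y"
    and inj: "\<And>n x. x \<in> cycles C d n \<Longrightarrow> f n x \<in> boundaries D e n \<Longrightarrow> x \<in> boundaries C d n"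
  shows "quasi_isomorphism C d D e f"
  unfolding quasi_isomorphism_def
proof (intro conjI allI f)
  have C: "chain_complex C d" and D: "chain_complex D e"
    and fl: "f n \<in> linear_maps (C n) (D n)"
    and fd: "x \<in> carrier (C (Suc n)) \<Longrightarrow> f n (d n x) = e n (f (Suc n) x)" for n x
    using f by (auto simp: chain_map_def)
  fix n
  let ?Z = "C n\<lparr>carrier := cycles C d n\<rparr>" and ?Y = "D n\<lparr>carrier := cycles D e n\<rparr>"
  let ?B = "boundaries C d n" and ?A = "boundaries D e n"
  note ZC = cycles_boundaries[OF C, of n] and ZD = cycles_boundaries[OF D, of n]
  note QC = quotient_module_facts[OF ZC(1,2), folded homology_def, simplified]
  note QD = quotient_module_facts[OF ZD(1,2), folded homology_def, simplified]
  have M: "module complex_ring (C k)" "module complex_ring (D k)" for k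
    using C D by (auto simp: chain_complex_def)
  note fL = linear_maps_facts[OF fl M]
  have fcyc: "f n x \<in> cycles D e n" if x: "x \<in> cycles C d n" for x
  proof (cases n)
    case 0
    then show ?thesis using x fL(1) by (simp add: cycles_def)
  next
    case (Suc k)
    then show ?thesis using x fL(1,4) fd[of x k] by (auto simp: cycles_def)
  qed
  have fz: "f n \<in> linear_maps ?Z ?Y"
    using fcyc fL(2,3) ZC(3) by (auto simp: linear_maps_def subset_iff)
  note F = linear_maps_facts[OF fz ZC(1) ZD(1)]
  have fb: "f n b \<in> ?A" if "b \<in> ?B" for b
    using that fd fL(1) by (auto simp: boundaries_def)
  have hm: "homology_map D e f n (?B +>\<^bsub>C n\<^esub> x) = ?A +>\<^bsub>D n\<^esub> f n x" if x: "x \<in> cycles C d n" for x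
  proof -
    have "?A +>\<^bsub>D n\<^esub> f n y = ?A +>\<^bsub>D n\<^esub> f n x" if y: "y \<in> ?B +>\<^bsub>C n\<^esub> x" for y
    proof -
      have yc: "y \<in> cycles C d n" "?B +>\<^bsub>C n\<^esub> y = ?B +>\<^bsub>C n\<^esub> x" using QC(7)[OF x y] by auto
      then have "y \<ominus>\<^bsub>?Z\<^esub> x \<in> ?B" using QC(2)[OF yc(1) x] by blast
      then have "f n y \<ominus>\<^bsub>?Y\<^esub> f n x \<in> ?A" using fb[of "y \<ominus>\<^bsub>?Z\<^esub> x"] F(5)[of y x] x yc(1) by simp
      then show ?thesis using QD(2)[OF fcyc[OF yc(1)] fcyc[OF x]] by blast
    qed
    then have "homology_map D e f n (?B +>\<^bsub>C n\<^esub> x) = (\<Union>y\<in>?B +>\<^bsub>C n\<^esub> x. ?A +>\<^bsub>D n\<^esub> f n x)"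
      unfolding homology_map_def by (intro SUP_cong refl)
    also have "\<dots> = ?A +>\<^bsub>D n\<^esub> f n x" using QC(6)[OF x] by (intro SUP_const) auto
    finally show ?thesis .
  qed
  interpret Z: module complex_ring ?Z by (rule ZC(1))
  have Zadd: "x \<oplus>\<^bsub>C n\<^esub> y \<in> cycles C d n" if "x \<in> cycles C d n" "y \<in> cycles C d n" for x y
    using Z.a_closed[of x y] that by simp
  have Zscale: "c \<odot>\<^bsub>C n\<^esub> x \<in> cycles C d n" if "x \<in> cycles C d n" for c x
    using Z.smult_closed[of c x] that by simp
  show "homology_map D e f n \<in> linear_maps (homology C d n) (homology D e n)"
    unfolding linear_maps_def
  proof (intro CollectI conjI ballI allI)
    show "homology_map D e f n \<in> carrier (homology C d n) \<rightarrow> carrier (homology D e n)"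
      unfolding QC(1) QD(1) using hm fcyc by auto
    fix S assume "S \<in> carrier (homology C d n)"
    then obtain x where x: "x \<in> cycles C d n" "S = ?B +>\<^bsub>C n\<^esub> x" unfolding QC(1) by (rule imageE)
    show "homology_map D e f n (S \<oplus>\<^bsub>homology C d n\<^esub> T) =
        homology_map D e f n S \<oplus>\<^bsub>homology D e n\<^esub> homology_map D e f n T"
      if T: "T \<in> carrier (homology C d n)" for T
    proof -
      obtain y where y: "y \<in> cycles C d n" "T = ?B +>\<^bsub>C n\<^esub> y" using T unfolding QC(1) by (rule imageE)
      have "f n (x \<oplus>\<^bsub>C n\<^esub> y) = f n x \<oplus>\<^bsub>D n\<^esub> f n y" using F(2)[of x y] x(1) y(1) by simp
      then show ?thesis unfolding x(2) y(2)
        using QC(3)[OF x(1) y(1)] QD(3)[OF fcyc[OF x(1)] fcyc[OF y(1)]]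
          hm[OF x(1)] hm[OF y(1)] hm[OF Zadd[OF x(1) y(1)]] by simp
    qed
    show "homology_map D e f n (c \<odot>\<^bsub>homology C d n\<^esub> S) =
        c \<odot>\<^bsub>homology D e n\<^esub> homology_map D e f n S" for c
    proof -
      have "f n (c \<odot>\<^bsub>C n\<^esub> x) = c \<odot>\<^bsub>D n\<^esub> f n x" using F(3)[of x c] x(1) by simp
      then show ?thesis unfolding x(2)
        using QC(4)[OF x(1)] QD(4)[OF fcyc[OF x(1)]] hm[OF x(1)] hm[OF Zscale[OF x(1)]] by simp
    qed
  qed
  show "bij_betw (homology_map D e f n) (carrier (homology C d n)) (carrier (homology D e n))"
    unfolding bij_betw_def
  proof
    show "inj_on (homology_map D e f n) (carrier (homology C d n))"
    proof (rule inj_onI)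
      fix S T assume S: "S \<in> carrier (homology C d n)" and T: "T \<in> carrier (homology C d n)"
        and eq: "homology_map D e f n S = homology_map D e f n T"
      obtain x where x: "x \<in> cycles C d n" "S = ?B +>\<^bsub>C n\<^esub> x" using S unfolding QC(1) by (rule imageE)
      obtain y where y: "y \<in> cycles C d n" "T = ?B +>\<^bsub>C n\<^esub> y" using T unfolding QC(1) by (rule imageE)
      have "?A +>\<^bsub>D n\<^esub> f n x = ?A +>\<^bsub>D n\<^esub> f n y" using eq unfolding x(2) y(2) hm[OF x(1)] hm[OF y(1)] .
      then have "f n x \<ominus>\<^bsub>?Y\<^esub> f n y \<in> ?A" using QD(2)[OF fcyc[OF x(1)] fcyc[OF y(1)]] by blast
      then have "f n (x \<ominus>\<^bsub>?Z\<^esub> y) \<in> ?A" using F(5)[of x y] x(1) y(1) by simp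
      moreover have "x \<ominus>\<^bsub>?Z\<^esub> y \<in> cycles C d n" using Z.minus_closed[of x y] x(1) y(1) by simp
      ultimately have "x \<ominus>\<^bsub>?Z\<^esub> y \<in> ?B" by (intro inj)
      then show "S = T" unfolding x(2) y(2) using QC(2)[OF x(1) y(1)] by blast
    qed
    show "homology_map D e f n ` carrier (homology C d n) = carrier (homology D e n)"
    proof
      show "homology_map D e f n ` carrier (homology C d n) \<subseteq> carrier (homology D e n)"
        unfolding QC(1) QD(1) using hm fcyc by auto
      show "carrier (homology D e n) \<subseteq> homology_map D e f n ` carrier (homology C d n)"
      proof
        fix T assume "T \<in> carrier (homology D e n)"
        then obtain y where y: "y \<in> cycles D e n" "T = ?A +>\<^bsub>D n\<^esub> y" unfolding QD(1) by (rule imageE)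
        obtain x where x: "x \<in> cycles C d n" "f n x = y" using surj[OF y(1)] by blast
        have "T = homology_map D e f n (?B +>\<^bsub>C n\<^esub> x)" using hm[OF x(1)] x(2) y(2) by simp
        then show "T \<in> homology_map D e f n ` carrier (homology C d n)"
          unfolding QC(1) using x(1) by blast
      qed
    qed
  qed
qed

section \<open>Alternating sums\<close>

text \<open>
  The double sum in \<open>d \<circ> d\<close>, where \<open>P j i\<close> is the composite of first the \<open>j\<close>-th and then the \<open>i\<close>-th face:
  the simplicial identity pairs the terms with \<open>i < j\<close> with those with \<open>j \<le> i\<close>, with opposite signs.
\<close>

lemma simplicial_cancellation:
  fixes P :: "nat \<Rightarrow> nat \<Rightarrow> complex"
  assumes "\<And>i j. i < j \<Longrightarrow> j \<le> Suc n \<Longrightarrow> P j i = P i (j - 1)"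
  shows "(\<Sum>j\<le>Suc n. \<Sum>i\<le>n. (- 1) ^ j * ((- 1) ^ i * P j i)) = 0"
proof -
  let ?f = "\<lambda>(j, i). (- 1) ^ j * ((- 1) ^ i * P j i)"
  let ?S = "{..Suc n} \<times> {..n}"
  let ?L = "{(j, i) \<in> ?S. i < j}" and ?U = "{(j, i) \<in> ?S. j \<le> i}"
  have "(\<Sum>j\<le>Suc n. \<Sum>i\<le>n. (- 1) ^ j * ((- 1) ^ i * P j i)) = sum ?f ?S"
    by (rule sum.cartesian_product)
  also have "?S = ?L \<union> ?U" by auto
  also have "sum ?f (?L \<union> ?U) = sum ?f ?L + sum ?f ?U"
    by (rule sum.union_disjoint) (auto intro: finite_subset[of _ ?S])
  also have "sum ?f ?L = sum (\<lambda>p. - ?f p) ?U"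
  proof (rule sum.reindex_bij_witness[of _ "\<lambda>(j, i). (Suc i, j)" "\<lambda>(j, i). (i, j - 1)"])
    fix p assume p: "p \<in> ?L"
    then obtain j i where ji: "p = (Suc j, i)" "i \<le> j" "j \<le> n"
      by (cases p; case_tac "fst p") auto
    show "- ?f (case p of (j, i) \<Rightarrow> (i, j - 1)) = ?f p"
      using assms[of i "Suc j"] ji by simp
  qed auto
  finally show ?thesis by (simp add: sum_negf)
qed

text \<open>
  The combinatorics of a simplicial homotopy.  Here \<open>P i j\<close> is the \<open>j\<close>-th face of the \<open>i\<close>-th prism
  and \<open>Y i j\<close> is the \<open>i\<close>-th prism on the \<open>j\<close>-th face.  The two faces of the \<open>i\<close>-th prism that touch the
  diagonal are \<open>Z i\<close> and \<open>Z (i + 1)\<close>; they telescope.  All other faces cancel against the prisms on the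
  boundary.
\<close>

lemma prism_cancellation:
  fixes P Y :: "nat \<Rightarrow> nat \<Rightarrow> complex" and Z :: "nat \<Rightarrow> complex"
  assumes low: "\<And>i j. j < i \<Longrightarrow> i \<le> n \<Longrightarrow> P i j = Y (i - 1) j"
    and high: "\<And>i j. Suc i < j \<Longrightarrow> j \<le> Suc n \<Longrightarrow> P i j = Y i (j - 1)"
    and diag: "\<And>i. i \<le> n \<Longrightarrow> P i i = Z i" "\<And>i. i \<le> n \<Longrightarrow> P i (Suc i) = Z (Suc i)"
  shows "(\<Sum>i\<le>n. \<Sum>j\<le>Suc n. (- 1) ^ i * ((- 1) ^ j * P i j)) +
         (\<Sum>j\<le>n. \<Sum>i<n. (- 1) ^ j * ((- 1) ^ i * Y i j)) = Z 0 - Z (Suc n)"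
proof -
  let ?f = "\<lambda>(i, j). (- 1) ^ i * ((- 1) ^ j * P i j)"
  let ?g = "\<lambda>(i, j). (- 1) ^ i * ((- 1) ^ j * Y i j)"
  let ?S = "{..n} \<times> {..Suc n}" and ?T = "{..<n} \<times> {..n}"
  let ?D = "{(i, j) \<in> ?S. j = i}" and ?D' = "{(i, j) \<in> ?S. j = Suc i}"
  let ?L = "{(i, j) \<in> ?S. j < i}" and ?U = "{(i, j) \<in> ?S. Suc i < j}"
  let ?L' = "{(i, j) \<in> ?T. j \<le> i}" and ?U' = "{(i, j) \<in> ?T. i < j}"
  have signs: "(- 1) ^ i * ((- 1) ^ i * z) = z" for i and z :: complex
    by (cases "even i") auto
  have fin: "finite ?S" "finite ?T" by auto
  have sub: "finite ?D" "finite ?D'" "finite ?L" "finite ?U" "finite ?L'" "finite ?U'"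
    by (rule finite_subset[OF _ fin(1)] finite_subset[OF _ fin(2)], blast)+
  have "(\<Sum>i\<le>n. \<Sum>j\<le>Suc n. (- 1) ^ i * ((- 1) ^ j * P i j)) = sum ?f ?S"
    by (rule sum.cartesian_product)
  also have "?S = (?D \<union> ?D') \<union> (?L \<union> ?U)" by auto
  also have "sum ?f \<dots> = sum ?f (?D \<union> ?D') + sum ?f (?L \<union> ?U)"
    by (intro sum.union_disjoint finite_UnI sub) auto
  also have "sum ?f (?D \<union> ?D') = sum ?f ?D + sum ?f ?D'"
    by (intro sum.union_disjoint finite_UnI sub) auto
  also have "sum ?f (?L \<union> ?U) = sum ?f ?L + sum ?f ?U"
    by (intro sum.union_disjoint finite_UnI sub) auto
  also have "sum ?f ?D = (\<Sum>i\<le>n. Z i)"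
    by (rule sum.reindex_bij_witness[of _ "\<lambda>i. (i, i)" fst])
      (auto simp: diag signs)
  also have "sum ?f ?D' = (\<Sum>i\<le>n. - Z (Suc i))"
    by (rule sum.reindex_bij_witness[of _ "\<lambda>i. (i, Suc i)" fst])
      (auto simp: diag signs)
  also have "sum ?f ?L = sum (\<lambda>p. - ?g p) ?L'"
  proof (rule sum.reindex_bij_witness[of _ "\<lambda>(i, j). (Suc i, j)" "\<lambda>(i, j). (i - 1, j)"])
    fix p assume p: "p \<in> ?L"
    then obtain i j where ij: "p = (Suc i, j)" "j \<le> i" "i < n"
      by (cases p; case_tac "fst p") auto
    show "- ?g (case p of (i, j) \<Rightarrow> (i - 1, j)) = ?f p"
      using low[of j "Suc i"] ij by simp
  qed auto
  also have "sum ?f ?U = sum (\<lambda>p. - ?g p) ?U'"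
  proof (rule sum.reindex_bij_witness[of _ "\<lambda>(i, j). (i, Suc j)" "\<lambda>(i, j). (i, j - 1)"])
    fix p assume p: "p \<in> ?U"
    then obtain i j where ij: "p = (i, Suc j)" "i < j" "j \<le> n"
      by (cases p; case_tac "snd p") auto
    show "- ?g (case p of (i, j) \<Rightarrow> (i, j - 1)) = ?f p"
      using high[of i "Suc j"] ij by simp
  qed auto
  also have "sum (\<lambda>p. - ?g p) ?L' + sum (\<lambda>p. - ?g p) ?U' = - sum ?g ?T"
  proof -
    have "sum ?g ?T = sum ?g (?L' \<union> ?U')" by (rule arg_cong[of _ _ "sum ?g"]) auto
    also have "\<dots> = sum ?g ?L' + sum ?g ?U'"
      by (intro sum.union_disjoint finite_UnI sub) auto
    finally show ?thesis by (simp add: sum_negf)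
  qed
  also have "(\<Sum>i\<le>n. Z i) + (\<Sum>i\<le>n. - Z (Suc i)) = Z 0 - Z (Suc n)"
    by (induction n) (auto simp: algebra_simps)
  also have "sum ?g ?T = (\<Sum>j\<le>n. \<Sum>i<n. (- 1) ^ j * ((- 1) ^ i * Y i j))"
    by (subst sum.swap) (simp add: sum.cartesian_product mult.left_commute)
  finally show ?thesis by simp
qed

section \<open>Slotwise maps\<close>

text \<open>
  Changing one entry of the argument changes one entry of the result, and that entry depends
  linearly on it.  Composition with such a map preserves multilinearity; every list operation below
  (faces, insertion of a unit, the action, rolling and unrolling) is of this kind.
\<close>

definition slotwise ::
    "(complex, 'v, 'm) module_scheme \<Rightarrow> nat \<Rightarrow> (complex, 'w, 'n) module_scheme \<Rightarrow> nat
      \<Rightarrow> ('v list \<Rightarrow> 'w list) \<Rightarrow> bool" where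
  "slotwise V n W m op \<longleftrightarrow> (\<forall>xs\<in>vectors V n. op xs \<in> vectors W m \<and>
     (\<forall>i<n. \<exists>j<m. \<exists>L\<in>linear_maps V W. \<forall>x\<in>carrier V. op (xs[i := x]) = (op xs)[j := L x]))"

lemma multilinear_slotwise:
  assumes V: "module complex_ring V" and f: "multilinear W m f" and s: "slotwise V n W m op"
  shows "multilinear V n (\<lambda>xs. f (op xs))"
  unfolding multilinear_def
proof (intro ballI allI impI conjI)
  interpret module complex_ring V by (rule V)
  fix xs i x assume xs: "xs \<in> vectors V n" and i: "i < n" and x: "x \<in> carrier V"
  obtain j L where j: "j < m" and L: "L \<in> linear_maps V W"
    and op: "\<And>x. x \<in> carrier V \<Longrightarrow> op (xs[i := x]) = (op xs)[j := L x]"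
    using s xs i unfolding slotwise_def by blast
  have ys: "op xs \<in> vectors W m" using s xs unfolding slotwise_def by blast
  have Lc: "L x \<in> carrier W" if "x \<in> carrier V" for x
    using L that by (auto simp: linear_maps_def)
  note M = multilinearD[OF f ys j Lc]
  show "f (op (xs[i := x \<oplus>\<^bsub>V\<^esub> y])) = f (op (xs[i := x])) + f (op (xs[i := y]))"
    if y: "y \<in> carrier V" for y
  proof -
    have "L (x \<oplus>\<^bsub>V\<^esub> y) = L x \<oplus>\<^bsub>W\<^esub> L y" using L x y by (simp add: linear_maps_def)
    then show ?thesis
      unfolding op[OF x] op[OF y] op[OF a_closed[OF x y]] using M(1)[OF x Lc[OF y]] by simp
  qed
  show "f (op (xs[i := c \<odot>\<^bsub>V\<^esub> x])) = c *\<^sub>c f (op (xs[i := x]))" for c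
  proof -
    have "L (c \<odot>\<^bsub>V\<^esub> x) = c \<odot>\<^bsub>W\<^esub> L x" using L x by (simp add: linear_maps_def)
    moreover have "c \<odot>\<^bsub>V\<^esub> x \<in> carrier V" using x by simp
    ultimately show ?thesis
      unfolding op[OF x] using op[of "c \<odot>\<^bsub>V\<^esub> x"] M(2)[OF x] by simp
  qed
qed

lemma vectorsI: "length xs = n \<Longrightarrow> (\<And>i. i < n \<Longrightarrow> xs ! i \<in> carrier V) \<Longrightarrow> xs \<in> vectors V n"
  by (auto simp: vectors_def in_set_conv_nth)

lemma vectorsD: "xs \<in> vectors V n \<Longrightarrow> length xs = n" "xs \<in> vectors V n \<Longrightarrow> i < n \<Longrightarrow> xs ! i \<in> carrier V"
  by (auto simp: vectors_def)

section \<open>Faces and the Hochschild differential\<close>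

definition bilinear_product :: "(complex, 'v, 'm) module_scheme \<Rightarrow> bool" where
  "bilinear_product B \<longleftrightarrow> module complex_ring B \<and>
     (\<forall>x\<in>carrier B. (\<lambda>y. x \<otimes>\<^bsub>B\<^esub> y) \<in> linear_maps B B \<and> (\<lambda>y. y \<otimes>\<^bsub>B\<^esub> x) \<in> linear_maps B B)"

lemma length_hochschild_face:
  "length xs = Suc (Suc n) \<Longrightarrow> i \<le> Suc n \<Longrightarrow> length (hochschild_face B \<sigma> (Suc n) i xs) = Suc n"
  by (auto simp: hochschild_face_def)

lemma nth_hochschild_face:
  assumes "length xs = Suc (Suc n)" "i \<le> Suc n" "j < Suc n"
  shows "hochschild_face B \<sigma> (Suc n) i xs ! j =
    (if i = 0 then (if j = 0 then xs ! 0 \<otimes>\<^bsub>B\<^esub> \<sigma> (xs ! 1) else xs ! Suc j)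
     else if i < Suc n then
       (if j < i then xs ! j else if j = i then xs ! i \<otimes>\<^bsub>B\<^esub> xs ! Suc i else xs ! Suc j)
     else if j = 0 then xs ! Suc n \<otimes>\<^bsub>B\<^esub> xs ! 0 else xs ! j)"
  using assms
  by (auto simp: hochschild_face_def nth_append nth_Cons split: nat.splits)
    (rule arg_cong[of _ _ "(!) xs"], linarith)

lemma linear_maps_id: "(\<lambda>x. x) \<in> linear_maps V V"
  by (auto simp: linear_maps_def)

lemma linear_maps_comp:
  "f \<in> linear_maps V W \<Longrightarrow> g \<in> linear_maps W U \<Longrightarrow> (\<lambda>x. g (f x)) \<in> linear_maps V U"
  by (auto simp: linear_maps_def Pi_iff)

text \<open>
  The position of the affected entry and the linear map depend on the positions \<open>k\<close> of the changed
  entry and \<open>i\<close> of the merged pair, which is the reason for the ten cases.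
\<close>

lemma slotwise_hochschild_face:
  assumes B: "bilinear_product B" and \<sigma>: "\<sigma> \<in> linear_maps B B" and i: "i \<le> Suc n"
  shows "slotwise B (Suc (Suc n)) B (Suc n) (hochschild_face B \<sigma> (Suc n) i)"
  unfolding slotwise_def
proof (intro ballI conjI allI impI)
  fix xs assume xs: "xs \<in> vectors B (Suc (Suc n))"
  note len = vectorsD(1)[OF xs] and mem = vectorsD(2)[OF xs]
  note nth = nth_hochschild_face
  have \<sigma>c: "x \<in> carrier B \<Longrightarrow> \<sigma> x \<in> carrier B" for x using \<sigma> by (auto simp: linear_maps_def)
  have l: "(\<lambda>y. x \<otimes>\<^bsub>B\<^esub> y) \<in> linear_maps B B" and r: "(\<lambda>y. y \<otimes>\<^bsub>B\<^esub> x) \<in> linear_maps B B"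
    if "x \<in> carrier B" for x
    using B that by (auto simp: bilinear_product_def)
  have m: "x \<otimes>\<^bsub>B\<^esub> y \<in> carrier B" if "x \<in> carrier B" "y \<in> carrier B" for x y
    using l[OF that(1)] that(2) by (auto simp: linear_maps_def)
  show face: "hochschild_face B \<sigma> (Suc n) i xs \<in> vectors B (Suc n)"
    by (rule vectorsI) (use len i mem in \<open>auto simp: length_hochschild_face nth intro!: m \<sigma>c\<close>)
  have l\<sigma>: "(\<lambda>y. x \<otimes>\<^bsub>B\<^esub> \<sigma> y) \<in> linear_maps B B" if "x \<in> carrier B" for x
    by (rule linear_maps_comp[OF \<sigma> l[OF that]])
  fix k assume k: "k < Suc (Suc n)"
  let ?P = "\<lambda>j L. j < Suc n \<and> L \<in> linear_maps B B \<and>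
     (\<forall>x\<in>carrier B. hochschild_face B \<sigma> (Suc n) i (xs[k := x]) = (hochschild_face B \<sigma> (Suc n) i xs)[j := L x])"
  have P: "?P j L" if "j < Suc n" "L \<in> linear_maps B B"
    "\<And>x q. x \<in> carrier B \<Longrightarrow> q < Suc n \<Longrightarrow> hochschild_face B \<sigma> (Suc n) i (xs[k := x]) ! q =
      (if q = j then L x else hochschild_face B \<sigma> (Suc n) i xs ! q)" for j L
  proof (intro conjI ballI that(1,2))
    fix x assume "x \<in> carrier B"
    then show "hochschild_face B \<sigma> (Suc n) i (xs[k := x]) = (hochschild_face B \<sigma> (Suc n) i xs)[j := L x]"
      using that(1,3) len i by (intro nth_equalityI) (simp_all add: length_hochschild_face nth_list_update)
  qed
  have "\<exists>j L. ?P j L"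
  proof -
    have "i = 0 \<or> i = Suc n \<or> 0 < i \<and> i < Suc n" "k = 0 \<or> k = 1 \<or> k > 1"
      "k < i \<or> k = i \<or> k = Suc i \<or> k > Suc i" "k = 0 \<or> k = Suc n \<or> 0 < k \<and> k < Suc n"
      using i k by linarith+
    then consider "i = 0" "k = 0" | "i = 0" "k = 1" | "i = 0" "k > 1"
      | "0 < i" "i < Suc n" "k < i" | "0 < i" "i < Suc n" "k = i"
      | "0 < i" "i < Suc n" "k = Suc i" | "0 < i" "i < Suc n" "k > Suc i"
      | "i = Suc n" "k = 0" | "i = Suc n" "k = Suc n" | "i = Suc n" "0 < k" "k < Suc n"
      by blast
    then show ?thesis
    proof cases
      case 1
      have "?P 0 (\<lambda>y. y \<otimes>\<^bsub>B\<^esub> \<sigma> (xs ! 1))"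
        by (rule P) (use 1 len mem r \<sigma>c in \<open>auto simp: nth nth_list_update\<close>)
      then show ?thesis by blast
    next
      case 2
      have "?P 0 (\<lambda>y. xs ! 0 \<otimes>\<^bsub>B\<^esub> \<sigma> y)"
        by (rule P) (use 2 len mem l\<sigma> in \<open>auto simp: nth nth_list_update\<close>)
      then show ?thesis by blast
    next
      case 3
      have "?P (k - 1) (\<lambda>y. y)"
        by (rule P) (use 3 k len linear_maps_id in \<open>auto simp: nth nth_list_update\<close>)
      then show ?thesis by blast
    next
      case 4
      have "?P k (\<lambda>y. y)"
        by (rule P) (use 4 k len linear_maps_id in \<open>auto simp: nth nth_list_update\<close>)
      then show ?thesis by blast
    next
      case 5
      have "?P i (\<lambda>y. y \<otimes>\<^bsub>B\<^esub> xs ! Suc i)"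
        by (rule P) (use 5 len mem r in \<open>auto simp: nth nth_list_update\<close>)
      then show ?thesis by blast
    next
      case 6
      have "?P i (\<lambda>y. xs ! i \<otimes>\<^bsub>B\<^esub> y)"
        by (rule P) (use 6 len mem l in \<open>auto simp: nth nth_list_update\<close>)
      then show ?thesis by blast
    next
      case 7
      have "?P (k - 1) (\<lambda>y. y)"
        by (rule P) (use 7 k len linear_maps_id in \<open>auto simp: nth nth_list_update\<close>)
      then show ?thesis by blast
    next
      case 8
      have "?P 0 (\<lambda>y. xs ! Suc n \<otimes>\<^bsub>B\<^esub> y)"
        by (rule P) (use 8 len mem l in \<open>auto simp: nth nth_list_update\<close>)
      then show ?thesis by blast
    next
      case 9
      have "?P 0 (\<lambda>y. y \<otimes>\<^bsub>B\<^esub> xs ! 0)"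
        by (rule P) (use 9 len mem r in \<open>auto simp: nth nth_list_update\<close>)
      then show ?thesis by blast
    next
      case 10
      have "?P k (\<lambda>y. y)"
        by (rule P) (use 10 k len linear_maps_id in \<open>auto simp: nth nth_list_update\<close>)
      then show ?thesis by blast
    qed
  qed
  then show "\<exists>j<Suc n. \<exists>L\<in>linear_maps B B. \<forall>x\<in>carrier B.
      hochschild_face B \<sigma> (Suc n) i (xs[k := x]) = (hochschild_face B \<sigma> (Suc n) i xs)[j := L x]"
    by blast
qed

definition face_sum ::
    "(complex, 'v, 'm) module_scheme \<Rightarrow> ('v \<Rightarrow> 'v) \<Rightarrow> nat \<Rightarrow> 'v list \<Rightarrow> 'v list \<Rightarrow> complex" where
  "face_sum B \<sigma> n xs = (\<Sum>i\<le>Suc n. (- 1) ^ i *\<^sub>c tensor_vec B (hochschild_face B \<sigma> (Suc n) i xs))"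

lemma multilinear_face_sum:
  assumes B: "bilinear_product B" and \<sigma>: "\<sigma> \<in> linear_maps B B"
  shows "multilinear B (Suc (Suc n)) (face_sum B \<sigma> n)"
  unfolding face_sum_def[abs_def]
proof (intro multilinear_sum multilinear_scale)
  have M: "module complex_ring B" using B by (simp add: bilinear_product_def)
  fix i assume "i \<in> {..Suc n}"
  then show "multilinear B (Suc (Suc n)) (\<lambda>xs. tensor_vec B (hochschild_face B \<sigma> (Suc n) i xs))"
    using slotwise_hochschild_face[OF B \<sigma>, of i n]
    by (intro multilinear_slotwise[OF M tensor_vec_multilinear[OF M]]) auto
qed

text \<open>
  The signed sum of the faces is multilinear, so the Hochschild differential is its linear extension in
  coordinates.
\<close>

lemma hochschild_diff_facts:
  assumes B: "bilinear_product B" and \<sigma>: "\<sigma> \<in> linear_maps B B"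
  shows "hochschild_diff B \<sigma> n \<in> linear_maps (hochschild_chains B (Suc n)) (hochschild_chains B n)"
    and "T \<in> carrier (hochschild_chains B (Suc n)) \<Longrightarrow>
      tensor_coord B (Suc n) (hochschild_diff B \<sigma> n T) = lin_ext (face_sum B \<sigma> n) (tensor_coord B (Suc (Suc n)) T)"
    and "xs \<in> vectors B (Suc (Suc n)) \<Longrightarrow> lin_ext (face_sum B \<sigma> n) (tensor_vec B xs) = face_sum B \<sigma> n xs"
proof -
  have M: "module complex_ring B" using B by (simp add: bilinear_product_def)
  let ?W = "tensor_power B (Suc n)"
  let ?F = "\<lambda>xs. \<Oplus>\<^bsub>?W\<^esub>i\<in>{..Suc n}. (- 1) ^ i \<odot>\<^bsub>?W\<^esub> tensor B (hochschild_face B \<sigma> (Suc n) i xs)"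
  note E = tensor_coord_embedding[OF M, of "Suc n"]
  note D = lin_embeddingD[OF E]
  interpret W: module complex_ring ?W by (rule D(1))
  have fc: "hochschild_face B \<sigma> (Suc n) i xs \<in> vectors B (Suc n)"
    if "xs \<in> vectors B (Suc (Suc n))" "i \<le> Suc n" for xs i
    using slotwise_hochschild_face[OF B \<sigma> that(2)] that(1) unfolding slotwise_def by blast
  have cl: "(- 1) ^ i \<odot>\<^bsub>?W\<^esub> tensor B (hochschild_face B \<sigma> (Suc n) i xs) \<in> carrier ?W"
    if "xs \<in> vectors B (Suc (Suc n))" "i \<in> {..Suc n}" for xs i
    using tensor_carrier[OF M fc] that by simp
  have 1: "?F xs \<in> carrier ?W" if "xs \<in> vectors B (Suc (Suc n))" for xs
    by (rule W.finsum_closed) (use cl[OF that] in auto)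
  have 2: "tensor_coord B (Suc n) (?F xs) = face_sum B \<sigma> n xs" if xs: "xs \<in> vectors B (Suc (Suc n))" for xs
  proof -
    have "tensor_coord B (Suc n) (?F xs) =
        (\<Sum>i\<in>{..Suc n}. tensor_coord B (Suc n) ((- 1) ^ i \<odot>\<^bsub>?W\<^esub> tensor B (hochschild_face B \<sigma> (Suc n) i xs)))"
      by (rule lin_embedding_finsum[OF E _ cl[OF xs]]) auto
    also have "\<dots> = face_sum B \<sigma> n xs"
      unfolding face_sum_def
      by (rule sum.cong[OF refl]) (use fc[OF xs] in \<open>simp add: D(4) tensor_carrier[OF M] tensor_coord_tensor[OF M]\<close>)
    finally show ?thesis .
  qed
  note L = tensor_lift_facts[OF M E 1 2 multilinear_face_sum[OF B \<sigma>], folded hochschild_diff_def hochschild_chains_def]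
  show "hochschild_diff B \<sigma> n \<in> linear_maps (hochschild_chains B (Suc n)) (hochschild_chains B n)"
    by (rule L(3))
  show "T \<in> carrier (hochschild_chains B (Suc n)) \<Longrightarrow>
      tensor_coord B (Suc n) (hochschild_diff B \<sigma> n T) = lin_ext (face_sum B \<sigma> n) (tensor_coord B (Suc (Suc n)) T)"
    by (rule L(2))
  show "xs \<in> vectors B (Suc (Suc n)) \<Longrightarrow> lin_ext (face_sum B \<sigma> n) (tensor_vec B xs) = face_sum B \<sigma> n xs"
    by (rule tensor_coord_facts(3)[OF M multilinear_face_sum[OF B \<sigma>]])
qed

section \<open>The crossed product\<close>

text \<open>
  The standing assumptions of the theorem, without the choice of a conjugacy class.
\<close>

locale group_algebra_action =
  fixes \<Gamma> :: "('g, 'k) monoid_scheme" (structure)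
    and A :: "(complex, 'a, 'm) module_scheme"
    and \<phi> :: "'g \<Rightarrow> 'a \<Rightarrow> 'a"
  assumes algebra_A: "algebra complex_ring A"
    and group_\<Gamma>: "group \<Gamma>" and finite_\<Gamma>: "finite (carrier \<Gamma>)"
    and action: "algebra_action \<Gamma> A \<phi>"
begin

sublocale \<Gamma>: group \<Gamma> by (rule group_\<Gamma>)
sublocale A: algebra complex_ring A by (rule algebra_A)

lemma module_A: "module complex_ring A"
  by (rule A.module)

lemma act_linear: "g \<in> carrier \<Gamma> \<Longrightarrow> \<phi> g \<in> linear_maps A A"
  using action by (auto simp: algebra_action_def)

lemma act_simps:
  assumes "g \<in> carrier \<Gamma>"
  shows "a \<in> carrier A \<Longrightarrow> \<phi> g a \<in> carrier A"
    "a \<in> carrier A \<Longrightarrow> b \<in> carrier A \<Longrightarrow> \<phi> g (a \<otimes>\<^bsub>A\<^esub> b) = \<phi> g a \<otimes>\<^bsub>A\<^esub> \<phi> g b"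
    "a \<in> carrier A \<Longrightarrow> b \<in> carrier A \<Longrightarrow> \<phi> g (a \<oplus>\<^bsub>A\<^esub> b) = \<phi> g a \<oplus>\<^bsub>A\<^esub> \<phi> g b"
    "a \<in> carrier A \<Longrightarrow> \<phi> g (c \<odot>\<^bsub>A\<^esub> a) = c \<odot>\<^bsub>A\<^esub> \<phi> g a"
    "\<phi> g \<one>\<^bsub>A\<^esub> = \<one>\<^bsub>A\<^esub>" "\<phi> g \<zero>\<^bsub>A\<^esub> = \<zero>\<^bsub>A\<^esub>"
proof -
  have h: "\<phi> g \<in> ring_hom A A" using action assms by (auto simp: algebra_action_def)
  note L = linear_maps_facts[OF act_linear[OF assms] module_A module_A]
  show "a \<in> carrier A \<Longrightarrow> \<phi> g a \<in> carrier A"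
    "a \<in> carrier A \<Longrightarrow> b \<in> carrier A \<Longrightarrow> \<phi> g (a \<oplus>\<^bsub>A\<^esub> b) = \<phi> g a \<oplus>\<^bsub>A\<^esub> \<phi> g b"
    "a \<in> carrier A \<Longrightarrow> \<phi> g (c \<odot>\<^bsub>A\<^esub> a) = c \<odot>\<^bsub>A\<^esub> \<phi> g a" "\<phi> g \<zero>\<^bsub>A\<^esub> = \<zero>\<^bsub>A\<^esub>"
    by (fact L)+
  show "a \<in> carrier A \<Longrightarrow> b \<in> carrier A \<Longrightarrow> \<phi> g (a \<otimes>\<^bsub>A\<^esub> b) = \<phi> g a \<otimes>\<^bsub>A\<^esub> \<phi> g b"
    "\<phi> g \<one>\<^bsub>A\<^esub> = \<one>\<^bsub>A\<^esub>"
    using ring_hom_mult[OF h] ring_hom_one[OF h] by auto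
qed

lemma act_comp:
  assumes "g \<in> carrier \<Gamma>" "k \<in> carrier \<Gamma>" "a \<in> carrier A"
  shows "\<phi> g (\<phi> k a) = \<phi> (g \<otimes> k) a"
proof -
  have "group_action \<Gamma> (carrier A) \<phi>" using action by (simp add: algebra_action_def)
  from group_action.composition_rule[OF this assms(3,1,2)] show ?thesis by simp
qed

lemma act_one:
  assumes "a \<in> carrier A" shows "\<phi> \<one> a = a"
proof -
  have "group_action \<Gamma> (carrier A) \<phi>" using action by (simp add: algebra_action_def)
  from fun_cong[OF group_action.id_eq_one[OF this], of a] show ?thesis using assms by simp
qed

abbreviation "B \<equiv> crossed_product \<Gamma> A \<phi>"
abbreviation "cmonom \<equiv> crossed_monom \<Gamma> A"

lemma crossed_product_simps:
  "carrier B = carrier \<Gamma> \<rightarrow>\<^sub>E carrier A"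
  "u \<oplus>\<^bsub>B\<^esub> v = (\<lambda>x\<in>carrier \<Gamma>. u x \<oplus>\<^bsub>A\<^esub> v x)"
  "c \<odot>\<^bsub>B\<^esub> u = (\<lambda>x\<in>carrier \<Gamma>. c \<odot>\<^bsub>A\<^esub> u x)"
  "\<zero>\<^bsub>B\<^esub> = (\<lambda>x\<in>carrier \<Gamma>. \<zero>\<^bsub>A\<^esub>)"
  "u \<otimes>\<^bsub>B\<^esub> v = (\<lambda>x\<in>carrier \<Gamma>. \<Oplus>\<^bsub>A\<^esub>g\<in>carrier \<Gamma>. u g \<otimes>\<^bsub>A\<^esub> \<phi> g (v (inv g \<otimes> x)))"
  by (simp_all add: crossed_product_def)

lemma crossed_eqI:
  assumes "u \<in> carrier B" "v \<in> carrier B" "\<And>x. x \<in> carrier \<Gamma> \<Longrightarrow> u x = v x"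
  shows "u = v"
  using assms unfolding crossed_product_simps by (blast intro: PiE_ext)

lemma crossed_val: "u \<in> carrier B \<Longrightarrow> x \<in> carrier \<Gamma> \<Longrightarrow> u x \<in> carrier A"
  by (auto simp: crossed_product_simps)

lemma crossed_closed:
  "u \<in> carrier B \<Longrightarrow> v \<in> carrier B \<Longrightarrow> u \<oplus>\<^bsub>B\<^esub> v \<in> carrier B"
  "u \<in> carrier B \<Longrightarrow> c \<odot>\<^bsub>B\<^esub> u \<in> carrier B" "\<zero>\<^bsub>B\<^esub> \<in> carrier B"
  by (auto simp: crossed_product_simps)

lemma crossed_mult_summand:
  assumes "u \<in> carrier B" "v \<in> carrier B" "g \<in> carrier \<Gamma>" "x \<in> carrier \<Gamma>"
  shows "u g \<otimes>\<^bsub>A\<^esub> \<phi> g (v (inv g \<otimes> x)) \<in> carrier A"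
  using assms crossed_val by (auto intro!: act_simps)

lemma crossed_mult_closed:
  assumes "u \<in> carrier B" "v \<in> carrier B" shows "u \<otimes>\<^bsub>B\<^esub> v \<in> carrier B"
proof -
  have "(\<Oplus>\<^bsub>A\<^esub>g\<in>carrier \<Gamma>. u g \<otimes>\<^bsub>A\<^esub> \<phi> g (v (inv g \<otimes> x))) \<in> carrier A" if "x \<in> carrier \<Gamma>" for x
    by (rule A.finsum_closed) (use crossed_mult_summand[OF assms _ that] in auto)
  then show ?thesis unfolding crossed_product_simps by auto
qed

lemma module_crossed: "module complex_ring B"
proof (rule complex_moduleI)
  show "abelian_group B"
  proof (rule abelian_groupI)
    fix u assume u: "u \<in> carrier B"
    show "\<exists>v\<in>carrier B. v \<oplus>\<^bsub>B\<^esub> u = \<zero>\<^bsub>B\<^esub>"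
    proof (rule bexI)
      show m: "(\<lambda>x\<in>carrier \<Gamma>. \<ominus>\<^bsub>A\<^esub> u x) \<in> carrier B" using u by (auto simp: crossed_product_simps)
      show "(\<lambda>x\<in>carrier \<Gamma>. \<ominus>\<^bsub>A\<^esub> u x) \<oplus>\<^bsub>B\<^esub> u = \<zero>\<^bsub>B\<^esub>"
        by (rule crossed_eqI[OF crossed_closed(1)[OF m u] crossed_closed(3)])
          (use crossed_val[OF u] in \<open>auto simp: crossed_product_simps(2,4) A.l_neg\<close>)
    qed
  next
    fix u v w assume *: "u \<in> carrier B" "v \<in> carrier B" "w \<in> carrier B"
    show "u \<oplus>\<^bsub>B\<^esub> v \<oplus>\<^bsub>B\<^esub> w = u \<oplus>\<^bsub>B\<^esub> (v \<oplus>\<^bsub>B\<^esub> w)"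
      by (rule crossed_eqI, (simp_all only: crossed_closed *)[2]) (use crossed_val[OF *(1)] crossed_val[OF *(2)] crossed_val[OF *(3)] in
          \<open>auto simp: crossed_product_simps(2) A.a_assoc\<close>)
  next
    fix u v assume *: "u \<in> carrier B" "v \<in> carrier B"
    show "u \<oplus>\<^bsub>B\<^esub> v = v \<oplus>\<^bsub>B\<^esub> u"
      by (rule crossed_eqI, (simp_all only: crossed_closed *)[2]) (use crossed_val[OF *(1)] crossed_val[OF *(2)] in
          \<open>auto simp: crossed_product_simps(2) A.a_comm\<close>)
  next
    fix u assume *: "u \<in> carrier B"
    show "\<zero>\<^bsub>B\<^esub> \<oplus>\<^bsub>B\<^esub> u = u"
      by (rule crossed_eqI, (simp_all only: crossed_closed *)[2]) (use crossed_val[OF *] in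
          \<open>auto simp: crossed_product_simps(2,4)\<close>)
  qed (auto intro: crossed_closed)
next
  fix c d u v assume u: "u \<in> carrier B"
  note uv = crossed_val[OF u]
  show "c \<odot>\<^bsub>B\<^esub> u \<in> carrier B" using u by (rule crossed_closed)
  show "(c + d) \<odot>\<^bsub>B\<^esub> u = c \<odot>\<^bsub>B\<^esub> u \<oplus>\<^bsub>B\<^esub> d \<odot>\<^bsub>B\<^esub> u"
    by (rule crossed_eqI, (simp_all only: crossed_closed u)[2])
      (use uv A.smult_l_distr[of c d] in \<open>auto simp: crossed_product_simps(2,3)\<close>)
  show "(c * d) \<odot>\<^bsub>B\<^esub> u = c \<odot>\<^bsub>B\<^esub> (d \<odot>\<^bsub>B\<^esub> u)"
    by (rule crossed_eqI, (simp_all only: crossed_closed u)[2])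
      (use uv A.smult_assoc1[of c d] in \<open>auto simp: crossed_product_simps(3)\<close>)
  show "1 \<odot>\<^bsub>B\<^esub> u = u"
    by (rule crossed_eqI, (simp_all only: crossed_closed u)[2])
      (use uv A.smult_one in \<open>auto simp: crossed_product_simps(3)\<close>)
  show "c \<odot>\<^bsub>B\<^esub> (u \<oplus>\<^bsub>B\<^esub> v) = c \<odot>\<^bsub>B\<^esub> u \<oplus>\<^bsub>B\<^esub> c \<odot>\<^bsub>B\<^esub> v" if v: "v \<in> carrier B"
    by (rule crossed_eqI, (simp_all only: crossed_closed u v)[2])
      (use uv crossed_val[OF v] A.smult_r_distr[of c] in \<open>auto simp: crossed_product_simps(2,3)\<close>)
qed

lemma smult_right_A:
  assumes "a \<in> carrier A" "b \<in> carrier A" shows "a \<otimes>\<^bsub>A\<^esub> (c \<odot>\<^bsub>A\<^esub> b) = c \<odot>\<^bsub>A\<^esub> (a \<otimes>\<^bsub>A\<^esub> b)"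
  using A.smult_assoc2[of c b a] assms A.m_comm[of a "c \<odot>\<^bsub>A\<^esub> b"] A.m_comm[of a b] by simp

lemma bilinear_A: "bilinear_product A"
  unfolding bilinear_product_def linear_maps_def
  using module_A smult_right_A A.smult_assoc2 by (auto simp: A.r_distr A.l_distr)

text \<open>
  The faces of the Hochschild complex of the crossed product are slotwise maps because of this; on the
  class component they are evaluated by \<open>monom_mult\<close>.
\<close>

lemma bilinear_crossed: "bilinear_product B"
  unfolding bilinear_product_def
proof (intro conjI ballI)
  show "module complex_ring B" by (rule module_crossed)
  interpret MB: module complex_ring B by (rule module_crossed)
  fix u assume u: "u \<in> carrier B"
  show "(\<lambda>v. u \<otimes>\<^bsub>B\<^esub> v) \<in> linear_maps B B"
    unfolding linear_maps_def
  proof (intro CollectI conjI ballI allI)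
    show "(\<otimes>\<^bsub>B\<^esub>) u \<in> carrier B \<rightarrow> carrier B" using crossed_mult_closed[OF u] by auto
    fix v assume v: "v \<in> carrier B"
    show "u \<otimes>\<^bsub>B\<^esub> (v \<oplus>\<^bsub>B\<^esub> w) = u \<otimes>\<^bsub>B\<^esub> v \<oplus>\<^bsub>B\<^esub> u \<otimes>\<^bsub>B\<^esub> w" if w: "w \<in> carrier B" for w
    proof (rule crossed_eqI)
      fix x assume x: "x \<in> carrier \<Gamma>"
      have "(u \<otimes>\<^bsub>B\<^esub> (v \<oplus>\<^bsub>B\<^esub> w)) x =
          (\<Oplus>\<^bsub>A\<^esub>g\<in>carrier \<Gamma>. u g \<otimes>\<^bsub>A\<^esub> \<phi> g (v (inv g \<otimes> x)) \<oplus>\<^bsub>A\<^esub> u g \<otimes>\<^bsub>A\<^esub> \<phi> g (w (inv g \<otimes> x)))"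
        using x unfolding crossed_product_simps
        by (simp, intro A.finsum_cong') (use u v w crossed_val x in
            \<open>auto simp: act_simps A.r_distr intro!: A.a_closed A.m_closed act_simps\<close>)
      also have "\<dots> = (u \<otimes>\<^bsub>B\<^esub> v \<oplus>\<^bsub>B\<^esub> u \<otimes>\<^bsub>B\<^esub> w) x"
        using x crossed_mult_summand[OF u v _ x] crossed_mult_summand[OF u w _ x]
        by (subst A.finsum_addf) (auto simp: crossed_product_simps(2,5))
      finally show "(u \<otimes>\<^bsub>B\<^esub> (v \<oplus>\<^bsub>B\<^esub> w)) x = (u \<otimes>\<^bsub>B\<^esub> v \<oplus>\<^bsub>B\<^esub> u \<otimes>\<^bsub>B\<^esub> w) x" .
    qed (use u v w crossed_mult_closed crossed_closed in auto)
    show "u \<otimes>\<^bsub>B\<^esub> (c \<odot>\<^bsub>B\<^esub> v) = c \<odot>\<^bsub>B\<^esub> (u \<otimes>\<^bsub>B\<^esub> v)" for c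
    proof (rule crossed_eqI)
      fix x assume x: "x \<in> carrier \<Gamma>"
      have "(u \<otimes>\<^bsub>B\<^esub> (c \<odot>\<^bsub>B\<^esub> v)) x =
          (\<Oplus>\<^bsub>A\<^esub>g\<in>carrier \<Gamma>. c \<odot>\<^bsub>A\<^esub> (u g \<otimes>\<^bsub>A\<^esub> \<phi> g (v (inv g \<otimes> x))))"
        using x unfolding crossed_product_simps
        by (simp, intro A.finsum_cong') (use u v crossed_val x in
            \<open>auto simp: act_simps smult_right_A intro!: A.smult_closed A.m_closed act_simps\<close>)
      also have "\<dots> = (c \<odot>\<^bsub>B\<^esub> (u \<otimes>\<^bsub>B\<^esub> v)) x"
        using x crossed_mult_summand[OF u v _ x] finite_\<Gamma>
        by (subst A.finsum_smult_ldistr[symmetric]) (auto simp: crossed_product_simps(3,5))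
      finally show "(u \<otimes>\<^bsub>B\<^esub> (c \<odot>\<^bsub>B\<^esub> v)) x = (c \<odot>\<^bsub>B\<^esub> (u \<otimes>\<^bsub>B\<^esub> v)) x" .
    qed (use u v crossed_mult_closed crossed_closed in auto)
  qed
  show "(\<lambda>v. v \<otimes>\<^bsub>B\<^esub> u) \<in> linear_maps B B"
    unfolding linear_maps_def
  proof (intro CollectI conjI ballI allI)
    show "(\<lambda>v. v \<otimes>\<^bsub>B\<^esub> u) \<in> carrier B \<rightarrow> carrier B" using crossed_mult_closed[OF _ u] by auto
    fix v assume v: "v \<in> carrier B"
    show "(v \<oplus>\<^bsub>B\<^esub> w) \<otimes>\<^bsub>B\<^esub> u = v \<otimes>\<^bsub>B\<^esub> u \<oplus>\<^bsub>B\<^esub> w \<otimes>\<^bsub>B\<^esub> u" if w: "w \<in> carrier B" for w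
    proof (rule crossed_eqI)
      fix x assume x: "x \<in> carrier \<Gamma>"
      have "((v \<oplus>\<^bsub>B\<^esub> w) \<otimes>\<^bsub>B\<^esub> u) x =
          (\<Oplus>\<^bsub>A\<^esub>g\<in>carrier \<Gamma>. v g \<otimes>\<^bsub>A\<^esub> \<phi> g (u (inv g \<otimes> x)) \<oplus>\<^bsub>A\<^esub> w g \<otimes>\<^bsub>A\<^esub> \<phi> g (u (inv g \<otimes> x)))"
        using x unfolding crossed_product_simps
        by (simp, intro A.finsum_cong') (use u v w crossed_val x in
            \<open>auto simp: act_simps A.l_distr intro!: A.a_closed A.m_closed act_simps\<close>)
      also have "\<dots> = (v \<otimes>\<^bsub>B\<^esub> u \<oplus>\<^bsub>B\<^esub> w \<otimes>\<^bsub>B\<^esub> u) x"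
        using x crossed_mult_summand[OF v u _ x] crossed_mult_summand[OF w u _ x]
        by (subst A.finsum_addf) (auto simp: crossed_product_simps(2,5))
      finally show "((v \<oplus>\<^bsub>B\<^esub> w) \<otimes>\<^bsub>B\<^esub> u) x = (v \<otimes>\<^bsub>B\<^esub> u \<oplus>\<^bsub>B\<^esub> w \<otimes>\<^bsub>B\<^esub> u) x" .
    qed (use u v w crossed_mult_closed crossed_closed in auto)
    show "(c \<odot>\<^bsub>B\<^esub> v) \<otimes>\<^bsub>B\<^esub> u = c \<odot>\<^bsub>B\<^esub> (v \<otimes>\<^bsub>B\<^esub> u)" for c
    proof (rule crossed_eqI)
      fix x assume x: "x \<in> carrier \<Gamma>"
      have "((c \<odot>\<^bsub>B\<^esub> v) \<otimes>\<^bsub>B\<^esub> u) x =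
          (\<Oplus>\<^bsub>A\<^esub>g\<in>carrier \<Gamma>. c \<odot>\<^bsub>A\<^esub> (v g \<otimes>\<^bsub>A\<^esub> \<phi> g (u (inv g \<otimes> x))))"
        using x unfolding crossed_product_simps
        by (simp, intro A.finsum_cong') (use u v crossed_val x in
            \<open>auto simp: act_simps A.smult_assoc2 intro!: A.smult_closed A.m_closed act_simps\<close>)
      also have "\<dots> = (c \<odot>\<^bsub>B\<^esub> (v \<otimes>\<^bsub>B\<^esub> u)) x"
        using x crossed_mult_summand[OF v u _ x] finite_\<Gamma>
        by (subst A.finsum_smult_ldistr[symmetric]) (auto simp: crossed_product_simps(3,5))
      finally show "((c \<odot>\<^bsub>B\<^esub> v) \<otimes>\<^bsub>B\<^esub> u) x = (c \<odot>\<^bsub>B\<^esub> (v \<otimes>\<^bsub>B\<^esub> u)) x" .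
    qed (use u v crossed_mult_closed crossed_closed in auto)
  qed
qed

lemma monom_closed: "a \<in> carrier A \<Longrightarrow> cmonom a g \<in> carrier B"
  by (auto simp: crossed_monom_def crossed_product_simps)

lemma monom_val: "x \<in> carrier \<Gamma> \<Longrightarrow> cmonom a g x = (if x = g then a else \<zero>\<^bsub>A\<^esub>)"
  by (simp add: crossed_monom_def)

lemma monom_linear: "(\<lambda>a. cmonom a g) \<in> linear_maps A B"
  unfolding linear_maps_def
proof (intro CollectI conjI ballI allI)
  show "(\<lambda>a. cmonom a g) \<in> carrier A \<rightarrow> carrier B" by (auto intro: monom_closed)
  fix a assume a: "a \<in> carrier A"
  show "cmonom (a \<oplus>\<^bsub>A\<^esub> b) g = cmonom a g \<oplus>\<^bsub>B\<^esub> cmonom b g" if "b \<in> carrier A" for b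
    using a that by (intro crossed_eqI crossed_closed monom_closed) (auto simp: crossed_product_simps(2) monom_val)
  show "cmonom (c \<odot>\<^bsub>A\<^esub> a) g = c \<odot>\<^bsub>B\<^esub> cmonom a g" for c
    using a by (intro crossed_eqI crossed_closed monom_closed) (auto simp: crossed_product_simps(3) monom_val)
qed

lemma monom_mult:
  assumes a: "a \<in> carrier A" and b: "b \<in> carrier A" and g: "g \<in> carrier \<Gamma>" and k: "k \<in> carrier \<Gamma>"
  shows "cmonom a g \<otimes>\<^bsub>B\<^esub> cmonom b k = cmonom (a \<otimes>\<^bsub>A\<^esub> \<phi> g b) (g \<otimes> k)"
proof (rule crossed_eqI)
  fix x assume x: "x \<in> carrier \<Gamma>"
  have iff: "inv g \<otimes> x = k \<longleftrightarrow> x = g \<otimes> k" using g k x by (metis \<Gamma>.inv_solve_left)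
  have "(cmonom a g \<otimes>\<^bsub>B\<^esub> cmonom b k) x = (\<Oplus>\<^bsub>A\<^esub>j\<in>carrier \<Gamma>. cmonom a g j \<otimes>\<^bsub>A\<^esub> \<phi> j (cmonom b k (inv j \<otimes> x)))"
    using x by (simp add: crossed_product_simps(5))
  also have "\<dots> = (\<Oplus>\<^bsub>A\<^esub>j\<in>carrier \<Gamma>. if g = j then a \<otimes>\<^bsub>A\<^esub> \<phi> j (cmonom b k (inv j \<otimes> x)) else \<zero>\<^bsub>A\<^esub>)"
  proof (rule A.finsum_cong')
    fix j assume j: "j \<in> carrier \<Gamma>"
    have "\<phi> j (cmonom b k (inv j \<otimes> x)) \<in> carrier A"
      using crossed_val[OF monom_closed[OF b], of "inv j \<otimes> x" k] j x by (intro act_simps) auto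
    then show "cmonom a g j \<otimes>\<^bsub>A\<^esub> \<phi> j (cmonom b k (inv j \<otimes> x)) =
        (if g = j then a \<otimes>\<^bsub>A\<^esub> \<phi> j (cmonom b k (inv j \<otimes> x)) else \<zero>\<^bsub>A\<^esub>)"
      using j by (auto simp: monom_val)
  next
    show "(\<lambda>j. if g = j then a \<otimes>\<^bsub>A\<^esub> \<phi> j (cmonom b k (inv j \<otimes> x)) else \<zero>\<^bsub>A\<^esub>) \<in> carrier \<Gamma> \<rightarrow> carrier A"
      using a x crossed_val[OF monom_closed[OF b]] by (auto intro!: A.m_closed act_simps)
  qed simp
  also have "\<dots> = a \<otimes>\<^bsub>A\<^esub> \<phi> g (cmonom b k (inv g \<otimes> x))"
    by (rule A.finsum_singleton[OF g finite_\<Gamma>])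
      (use a x crossed_val[OF monom_closed[OF b]] in \<open>auto intro!: A.m_closed act_simps\<close>)
  also have "\<dots> = cmonom (a \<otimes>\<^bsub>A\<^esub> \<phi> g b) (g \<otimes> k) x"
    using x a b g k iff by (auto simp: monom_val act_simps)
  finally show "(cmonom a g \<otimes>\<^bsub>B\<^esub> cmonom b k) x = cmonom (a \<otimes>\<^bsub>A\<^esub> \<phi> g b) (g \<otimes> k) x" .
qed (use assms in \<open>auto intro!: monom_closed crossed_mult_closed act_simps A.m_closed\<close>)

lemma crossed_eval_linear: "x \<in> carrier \<Gamma> \<Longrightarrow> (\<lambda>u. u x) \<in> linear_maps B A"
  unfolding linear_maps_def using crossed_val by (auto simp: crossed_product_simps(2,3))

end

section \<open>Unrolled tensors\<close>

definition delete_nth :: "nat \<Rightarrow> 'x list \<Rightarrow> 'x list" where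
  "delete_nth i xs = take i xs @ drop (Suc i) xs"

lemma length_delete_nth [simp]: "length xs = Suc n \<Longrightarrow> i \<le> n \<Longrightarrow> length (delete_nth i xs) = n"
  by (simp add: delete_nth_def)

lemma nth_delete_nth:
  "length xs = Suc n \<Longrightarrow> i \<le> n \<Longrightarrow> j < n \<Longrightarrow> delete_nth i xs ! j = (if j < i then xs ! j else xs ! Suc j)"
  by (auto simp: delete_nth_def nth_append min_def)

text \<open>
  The simplex whose vertices from position \<open>i\<close> on are moved to the cone point \<open>k\<close>, with \<open>m\<close> vertices.
\<close>

definition cone :: "nat \<Rightarrow> nat \<Rightarrow> 'x \<Rightarrow> 'x list \<Rightarrow> 'x list" where
  "cone m i k xs = take i xs @ replicate (m - i) k"

lemma length_cone [simp]: "i \<le> m \<Longrightarrow> i \<le> length xs \<Longrightarrow> length (cone m i k xs) = m"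
  by (simp add: cone_def)

lemma nth_cone:
  "i \<le> m \<Longrightarrow> i \<le> length xs \<Longrightarrow> j < m \<Longrightarrow> cone m i k xs ! j = (if j < i then xs ! j else k)"
  by (auto simp: cone_def nth_append min_def)

text \<open>
  For the prism \<open>(g\<^sub>0, \<dots>, g\<^sub>i, k, \<dots>, k)\<close> the deletions at \<open>i\<close> and at \<open>i + 1\<close> are the two diagonal faces of
  the prism operator.
\<close>

lemma delete_cone:
  assumes "length xs = Suc n" "i \<le> n" "j \<le> Suc n"
  shows "j < i \<Longrightarrow> delete_nth j (cone (Suc (Suc n)) (Suc i) k xs) = cone (Suc n) (Suc (i - 1)) k (delete_nth j xs)"
    and "j = i \<Longrightarrow> delete_nth j (cone (Suc (Suc n)) (Suc i) k xs) = cone (Suc n) i k xs"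
    and "j = Suc i \<Longrightarrow> delete_nth j (cone (Suc (Suc n)) (Suc i) k xs) = cone (Suc n) (Suc i) k xs"
    and "j > Suc i \<Longrightarrow> delete_nth j (cone (Suc (Suc n)) (Suc i) k xs) = cone (Suc n) (Suc i) k (delete_nth (j - 1) xs)"
  using assms
  by (auto intro!: nth_equalityI simp: nth_delete_nth[where n = "Suc n"] nth_delete_nth[where n = n] nth_cone)

locale twisted_group_algebra_action = group_algebra_action \<Gamma> A \<phi>
  for \<Gamma> :: "('g, 'k) monoid_scheme" (structure)
    and A :: "(complex, 'a, 'm) module_scheme"
    and \<phi> :: "'g \<Rightarrow> 'a \<Rightarrow> 'a" +
  fixes h :: 'g
  assumes h: "h \<in> carrier \<Gamma>"
begin

abbreviation "twisted_face \<equiv> hochschild_face A (\<phi> h)"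

definition group_lists :: "nat \<Rightarrow> 'g list set" where
  "group_lists n = {gs. length gs = n \<and> set gs \<subseteq> carrier \<Gamma>}"

lemma group_listsI: "length gs = n \<Longrightarrow> (\<And>i. i < n \<Longrightarrow> gs ! i \<in> carrier \<Gamma>) \<Longrightarrow> gs \<in> group_lists n"
  by (auto simp: group_lists_def in_set_conv_nth)

lemma group_listsD: "gs \<in> group_lists n \<Longrightarrow> length gs = n" "gs \<in> group_lists n \<Longrightarrow> i < n \<Longrightarrow> gs ! i \<in> carrier \<Gamma>"
  by (auto simp: group_lists_def)

lemma finite_group_lists: "finite (group_lists n)"
  using finite_lists_length_eq[OF finite_\<Gamma>, of n] by (simp add: group_lists_def conj_commute)

text \<open>
  The group element that precedes \<open>g\<^sub>i\<close> in cyclic order, and (\<open>target\<close>) the one that ends the \<open>i\<close>-th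
  step.  The step from \<open>g\<^sub>n\<close> to \<open>g\<^sub>0\<close> ends at \<open>h g\<^sub>0\<close>, not at \<open>g\<^sub>0\<close>: going around
  the cycle multiplies by the twist.
\<close>

definition source :: "'g list \<Rightarrow> nat \<Rightarrow> 'g" where
  "source gs i = (if i = 0 then gs ! (length gs - 1) else gs ! (i - 1))"

definition target :: "'g list \<Rightarrow> nat \<Rightarrow> 'g" where
  "target gs i = (if i = 0 then h \<otimes> gs ! 0 else gs ! i)"

lemma source_target_closed [simp]:
  assumes "gs \<in> group_lists n" "i < n"
  shows "source gs i \<in> carrier \<Gamma>" "target gs i \<in> carrier \<Gamma>"
  using assms h group_listsD[OF assms(1)] by (auto simp: source_def target_def)

text \<open>
  The tensor with entries \<open>b\<^sub>i h\<^sub>i\<close>, where \<open>h\<^sub>i\<close> is the quotient of two consecutive vertices.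
\<close>

definition roll :: "'a list \<Rightarrow> 'g list \<Rightarrow> ('g \<Rightarrow> 'a) list" where
  "roll as gs = map (\<lambda>i. cmonom (\<phi> (inv (source gs i)) (as ! i)) (inv (source gs i) \<otimes> target gs i)) [0..<length gs]"

text \<open>
  A left inverse of \<open>roll\<close> in its first argument that is defined on all tensors of the crossed product:
  from the \<open>i\<close>-th entry it reads off the coefficient at the quotient of two consecutive vertices of
  \<open>gs\<close>.  The entry is zero if the tensor has a monomial at another group element there.
\<close>

definition unroll :: "'g list \<Rightarrow> ('g \<Rightarrow> 'a) list \<Rightarrow> 'a list" where
  "unroll gs us = map (\<lambda>i. \<phi> (source gs i) ((us ! i) (inv (source gs i) \<otimes> target gs i))) [0..<length gs]"

lemma roll_vectors:
  assumes "as \<in> vectors A n" "gs \<in> group_lists n"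
  shows "roll as gs \<in> vectors B n"
  by (rule vectorsI) (use vectorsD[OF assms(1)] group_listsD[OF assms(2)] source_target_closed[OF assms(2)] in
      \<open>auto simp: roll_def intro!: monom_closed act_simps\<close>)

lemma slotwise_roll:
  assumes gs: "gs \<in> group_lists n"
  shows "slotwise A n B n (\<lambda>as. roll as gs)"
  unfolding slotwise_def
proof (intro ballI conjI allI impI)
  fix as assume as: "as \<in> vectors A n"
  show "roll as gs \<in> vectors B n" by (rule roll_vectors[OF as gs])
  fix i assume i: "i < n"
  let ?L = "\<lambda>x. cmonom (\<phi> (inv (source gs i)) x) (inv (source gs i) \<otimes> target gs i)"
  have "?L \<in> linear_maps A B"
    by (rule linear_maps_comp[OF act_linear monom_linear]) (use source_target_closed[OF gs i] in simp)
  moreover have "roll (as[i := x]) gs = (roll as gs)[i := ?L x]" for x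
    using vectorsD(1)[OF as] group_listsD(1)[OF gs] i
    by (intro nth_equalityI) (auto simp: roll_def nth_list_update)
  ultimately show "\<exists>j<n. \<exists>L\<in>linear_maps A B. \<forall>x\<in>carrier A. roll (as[i := x]) gs = (roll as gs)[j := L x]"
    using i by (intro exI[of _ i] conjI bexI[of _ ?L]) auto
qed

lemma slotwise_unroll:
  assumes gs: "gs \<in> group_lists n"
  shows "slotwise B n A n (unroll gs)"
  unfolding slotwise_def
proof (intro ballI conjI allI impI)
  fix us assume us: "us \<in> vectors B n"
  show "unroll gs us \<in> vectors A n"
  proof (rule vectorsI)
    fix i assume i: "i < n"
    note st = source_target_closed[OF gs i]
    show "unroll gs us ! i \<in> carrier A"
      using i group_listsD(1)[OF gs] st crossed_val[OF vectorsD(2)[OF us i]]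
      by (simp add: unroll_def act_simps)
  qed (simp add: unroll_def group_listsD(1)[OF gs])
  fix i assume i: "i < n"
  let ?L = "\<lambda>u. \<phi> (source gs i) (u (inv (source gs i) \<otimes> target gs i))"
  have "?L \<in> linear_maps B A"
    by (rule linear_maps_comp[OF crossed_eval_linear act_linear]) (use source_target_closed[OF gs i] in auto)
  moreover have "unroll gs (us[i := u]) = (unroll gs us)[i := ?L u]" for u
    using vectorsD(1)[OF us] group_listsD(1)[OF gs] i
    by (intro nth_equalityI) (auto simp: unroll_def nth_list_update)
  ultimately show "\<exists>j<n. \<exists>L\<in>linear_maps B A. \<forall>x\<in>carrier B. unroll gs (us[i := x]) = (unroll gs us)[j := L x]"
    using i by (intro exI[of _ i] conjI bexI[of _ ?L]) auto
qed

lemma slotwise_act: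
  assumes g: "g \<in> carrier \<Gamma>"
  shows "slotwise A n A n (map (\<phi> g))"
  unfolding slotwise_def
proof (intro ballI conjI allI impI)
  fix as assume as: "as \<in> vectors A n"
  show "map (\<phi> g) as \<in> vectors A n"
    by (rule vectorsI) (use vectorsD[OF as] g in \<open>auto intro!: act_simps\<close>)
  fix i assume "i < n"
  then show "\<exists>j<n. \<exists>L\<in>linear_maps A A. \<forall>x\<in>carrier A. map (\<phi> g) (as[i := x]) = (map (\<phi> g) as)[j := L x]"
    using act_linear[OF g] by (intro exI[of _ i] conjI bexI[of _ "\<phi> g"]) (auto simp: map_update)
qed

lemma map_act_vectors: "g \<in> carrier \<Gamma> \<Longrightarrow> as \<in> vectors A n \<Longrightarrow> map (\<phi> g) as \<in> vectors A n"
  using slotwise_act by (auto simp: slotwise_def)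

lemma delete_group_lists: "gs \<in> group_lists (Suc n) \<Longrightarrow> i \<le> n \<Longrightarrow> delete_nth i gs \<in> group_lists n"
  by (rule group_listsI) (auto simp: nth_delete_nth group_listsD)

lemma face_vectors:
  "as \<in> vectors A (Suc (Suc n)) \<Longrightarrow> i \<le> Suc n \<Longrightarrow> twisted_face (Suc n) i as \<in> vectors A (Suc n)"
  using slotwise_hochschild_face[OF bilinear_A act_linear[OF h], of i n] by (auto simp: slotwise_def)

text \<open>
  Two consecutive steps compose because the second one starts where the first one ends.  If a step
  around the cycle comes first, its end \<open>h r\<close> and the start \<open>r\<close> of the next step differ by \<open>h\<close>, which
  then acts on the second factor.
\<close>

lemma monom_merge:
  assumes "a \<in> carrier A" "b \<in> carrier A" "p \<in> carrier \<Gamma>" "r \<in> carrier \<Gamma>" "s \<in> carrier \<Gamma>"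
  shows "cmonom (\<phi> (inv p) a) (inv p \<otimes> r) \<otimes>\<^bsub>B\<^esub> cmonom (\<phi> (inv r) b) (inv r \<otimes> s) =
      cmonom (\<phi> (inv p) (a \<otimes>\<^bsub>A\<^esub> b)) (inv p \<otimes> s)"
    and "cmonom (\<phi> (inv p) a) (inv p \<otimes> (h \<otimes> r)) \<otimes>\<^bsub>B\<^esub> cmonom (\<phi> (inv r) b) (inv r \<otimes> s) =
      cmonom (\<phi> (inv p) (a \<otimes>\<^bsub>A\<^esub> \<phi> h b)) (inv p \<otimes> (h \<otimes> s))"
proof -
  have 1: "inv p \<otimes> r \<otimes> inv r = inv p" "inv p \<otimes> r \<otimes> (inv r \<otimes> s) = inv p \<otimes> s"
    using assms(3-5) by (simp_all add: \<Gamma>.m_assoc \<Gamma>.inv_solve_left \<Gamma>.inv_solve_left')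
      (simp add: \<Gamma>.m_assoc[symmetric])
  have 2: "inv p \<otimes> (h \<otimes> r) \<otimes> inv r = inv p \<otimes> h" "inv p \<otimes> (h \<otimes> r) \<otimes> (inv r \<otimes> s) = inv p \<otimes> (h \<otimes> s)"
    using assms(3-5) h by (simp_all add: \<Gamma>.m_assoc) (simp add: \<Gamma>.m_assoc[symmetric])
  show "cmonom (\<phi> (inv p) a) (inv p \<otimes> r) \<otimes>\<^bsub>B\<^esub> cmonom (\<phi> (inv r) b) (inv r \<otimes> s) =
      cmonom (\<phi> (inv p) (a \<otimes>\<^bsub>A\<^esub> b)) (inv p \<otimes> s)"
    using assms 1 by (subst monom_mult) (auto simp: act_comp act_simps)
  show "cmonom (\<phi> (inv p) a) (inv p \<otimes> (h \<otimes> r)) \<otimes>\<^bsub>B\<^esub> cmonom (\<phi> (inv r) b) (inv r \<otimes> s) =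
      cmonom (\<phi> (inv p) (a \<otimes>\<^bsub>A\<^esub> \<phi> h b)) (inv p \<otimes> (h \<otimes> s))"
    using assms h 2 by (subst monom_mult) (auto simp: act_comp act_simps)
qed

lemma length_roll [simp]: "length (roll as gs) = length gs"
  by (simp add: roll_def)

lemma nth_roll: "i < length gs \<Longrightarrow> roll as gs ! i = cmonom (\<phi> (inv (source gs i)) (as ! i)) (inv (source gs i) \<otimes> target gs i)"
  by (simp add: roll_def)

text \<open>
  In unrolled form the faces of the crossed product are the twisted faces on the entries together with
  the deletion of a vertex: \<open>monom_merge\<close> applies to the merged pair, and the other entries keep
  their predecessors.
\<close>

lemma face_roll:
  assumes as: "as \<in> vectors A (Suc (Suc n))" and gs: "gs \<in> group_lists (Suc (Suc n))" and i: "i \<le> Suc n"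
  shows "hochschild_face B (\<lambda>u. u) (Suc n) i (roll as gs) =
    roll (twisted_face (Suc n) i as) (delete_nth i gs)"
proof (rule nth_equalityI)
  note len = vectorsD(1)[OF as] group_listsD(1)[OF gs]
  note mem = vectorsD(2)[OF as] group_listsD(2)[OF gs]
  have lenr: "length (roll as gs) = Suc (Suc n)" using len by simp
  show "length (hochschild_face B (\<lambda>u. u) (Suc n) i (roll as gs)) =
      length (roll (twisted_face (Suc n) i as) (delete_nth i gs))"
    using len i by (simp add: length_hochschild_face[OF lenr i])
  fix j assume "j < length (hochschild_face B (\<lambda>u. u) (Suc n) i (roll as gs))"
  then have j: "j < Suc n" by (simp add: length_hochschild_face[OF lenr i])
  note nf = nth_hochschild_face[OF lenr i j] nth_hochschild_face[OF len(1) i j]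
  have ld: "length (delete_nth i gs) = Suc n" using len i by simp
  note nd = nth_delete_nth[OF len(2) i]
  have nr: "roll (twisted_face (Suc n) i as) (delete_nth i gs) ! j =
      cmonom (\<phi> (inv (source (delete_nth i gs) j)) (twisted_face (Suc n) i as ! j))
        (inv (source (delete_nth i gs) j) \<otimes> target (delete_nth i gs) j)"
    using ld j by (simp add: nth_roll)
  have sd: "source (delete_nth i gs) j =
      (if j = 0 then (if i = Suc n then gs ! n else gs ! Suc n) else if j \<le> i then gs ! (j - 1) else gs ! j)"
    using ld j i len by (auto simp: source_def nd)
  have td: "target (delete_nth i gs) j =
      (if j = 0 then h \<otimes> (if i = 0 then gs ! 1 else gs ! 0) else if j < i then gs ! j else gs ! Suc j)"
    using ld j i len by (auto simp: target_def nd)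
  note nrr = nth_roll[of _ gs as, unfolded len]
  show "hochschild_face B (\<lambda>u. u) (Suc n) i (roll as gs) ! j =
      roll (twisted_face (Suc n) i as) (delete_nth i gs) ! j"
  proof -
    consider "i = 0" "j = 0" | "i = 0" "j > 0" | "0 < i" "i < Suc n" "j < i" | "0 < i" "i < Suc n" "j = i"
      | "0 < i" "i < Suc n" "j > i" | "i = Suc n" "j = 0" | "i = Suc n" "j > 0"
      using i by (cases "i = 0"; cases "i = Suc n"; cases "j = 0"; cases "j < i"; cases "j = i"; simp)
    then show ?thesis
    proof cases
      case 1
      then show ?thesis unfolding nr sd td nf
        using monom_merge(2)[of "as ! 0" "as ! 1" "gs ! Suc n" "gs ! 0" "gs ! 1"] mem
        by (simp add: nrr source_def target_def len)
    next
      case 2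
      then show ?thesis unfolding nr sd td nf using j
        by (simp add: nrr source_def target_def len)
    next
      case 3
      then show ?thesis unfolding nr sd td nf using j
        by (auto simp add: nrr source_def target_def len)
    next
      case 4
      then show ?thesis unfolding nr sd td nf
        using monom_merge(1)[of "as ! i" "as ! Suc i" "gs ! (i - 1)" "gs ! i" "gs ! Suc i"] mem
        by (simp add: nrr source_def target_def len)
    next
      case 5
      then show ?thesis unfolding nr sd td nf using j
        by (simp add: nrr source_def target_def len)
    next
      case 6
      then show ?thesis unfolding nr sd td nf
        using monom_merge(1)[of "as ! Suc n" "as ! 0" "gs ! n" "gs ! Suc n" "h \<otimes> gs ! 0"] mem h
        by (simp add: nrr source_def target_def len)
    next
      case 7
      then show ?thesis unfolding nr sd td nf using j
        by (simp add: nrr source_def target_def len)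
    qed
  qed
qed

abbreviation "Z \<equiv> centralizer \<Gamma> h"

lemma centralizerD: "z \<in> Z \<Longrightarrow> z \<in> carrier \<Gamma>" "z \<in> Z \<Longrightarrow> z \<otimes> h = h \<otimes> z"
  by (auto simp: centralizer_def)

lemma source_target_translate:
  assumes "gs \<in> group_lists n" "i < n" "z \<in> Z"
  shows "source (map ((\<otimes>) z) gs) i = z \<otimes> source gs i" "target (map ((\<otimes>) z) gs) i = z \<otimes> target gs i"
proof -
  note g = group_listsD[OF assms(1)] and z = centralizerD[OF assms(3)]
  show "source (map ((\<otimes>) z) gs) i = z \<otimes> source gs i"
    using g assms(2) by (auto simp: source_def)
  have "h \<otimes> (z \<otimes> gs ! 0) = z \<otimes> (h \<otimes> gs ! 0)"
    using z h g(2)[of 0] assms(2) by (simp add: \<Gamma>.m_assoc[symmetric])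
  then show "target (map ((\<otimes>) z) gs) i = z \<otimes> target gs i"
    using g assms(2) by (auto simp: target_def)
qed

lemma translate_group_lists: "gs \<in> group_lists n \<Longrightarrow> z \<in> carrier \<Gamma> \<Longrightarrow> map ((\<otimes>) z) gs \<in> group_lists n"
  by (rule group_listsI) (auto simp: group_listsD)

lemma inv_translate:
  assumes "z \<in> carrier \<Gamma>" "p \<in> carrier \<Gamma>" "q \<in> carrier \<Gamma>"
  shows "inv (z \<otimes> p) \<otimes> (z \<otimes> q) = inv p \<otimes> q"
  using assms by (simp add: \<Gamma>.inv_mult_group \<Gamma>.m_assoc) (simp add: \<Gamma>.m_assoc[symmetric])

text \<open>
  Only quotients of consecutive vertices enter, and elements of the centralizer commute with the
  twist in the step from \<open>g\<^sub>n\<close> to \<open>h g\<^sub>0\<close>.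
\<close>

lemma roll_translate:
  assumes as: "as \<in> vectors A n" and gs: "gs \<in> group_lists n" and z: "z \<in> Z"
  shows "roll (map (\<phi> z) as) (map ((\<otimes>) z) gs) = roll as gs"
proof (rule nth_equalityI)
  note zc = centralizerD(1)[OF z] and len = group_listsD(1)[OF gs]
  show "length (roll (map (\<phi> z) as) (map ((\<otimes>) z) gs)) = length (roll as gs)" by simp
  fix i assume "i < length (roll (map (\<phi> z) as) (map ((\<otimes>) z) gs))"
  then have i: "i < n" using len by simp
  note st = source_target_closed[OF gs i] and a = vectorsD[OF as]
  have "inv (z \<otimes> source gs i) \<otimes> z = inv (source gs i)"
    using zc st(1) by (simp add: \<Gamma>.inv_mult_group \<Gamma>.m_assoc)
  then have "\<phi> (inv (z \<otimes> source gs i)) (\<phi> z (as ! i)) = \<phi> (inv (source gs i)) (as ! i)"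
    using zc st a(2)[OF i] by (simp add: act_comp)
  then show "roll (map (\<phi> z) as) (map ((\<otimes>) z) gs) ! i = roll as gs ! i"
    using i len a by (simp add: nth_roll source_target_translate[OF gs i z] inv_translate[OF zc st])
qed

lemma unroll_roll_translate:
  assumes as: "as \<in> vectors A n" and gs: "gs \<in> group_lists n" and z: "z \<in> Z"
  shows "unroll (map ((\<otimes>) z) gs) (roll as gs) = map (\<phi> z) as"
proof (rule nth_equalityI)
  note zc = centralizerD(1)[OF z] and len = group_listsD(1)[OF gs] and a = vectorsD[OF as]
  show "length (unroll (map ((\<otimes>) z) gs) (roll as gs)) = length (map (\<phi> z) as)"
    using len a by (simp add: unroll_def)
  fix i assume "i < length (unroll (map ((\<otimes>) z) gs) (roll as gs))"
  then have i: "i < n" using len by (simp add: unroll_def)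
  note st = source_target_closed[OF gs i]
  have "z \<otimes> source gs i \<otimes> inv (source gs i) = z"
    using zc st(1) by (simp add: \<Gamma>.m_assoc)
  then have "\<phi> (z \<otimes> source gs i) (\<phi> (inv (source gs i)) (as ! i)) = \<phi> z (as ! i)"
    using zc st a(2)[OF i] by (simp add: act_comp)
  then show "unroll (map ((\<otimes>) z) gs) (roll as gs) ! i = map (\<phi> z) as ! i"
    using i len a st by (simp add: unroll_def nth_roll source_target_translate[OF gs i z] inv_translate[OF zc st] monom_val)
qed

text \<open>
  If no entry vanishes, all consecutive quotients of \<open>gs\<close> and \<open>gs'\<close> agree.  Then \<open>gs'\<close> is the translate
  of \<open>gs\<close> by \<open>z = g'\<^sub>0 g\<^sub>0\<inverse>\<close>, and the step from \<open>g\<^sub>n\<close> to \<open>h g\<^sub>0\<close> shows that \<open>z\<close> commutes with \<open>h\<close>.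
\<close>

lemma unroll_roll_zero:
  assumes as: "as \<in> vectors A (Suc n)" and gs: "gs \<in> group_lists (Suc n)" and gs': "gs' \<in> group_lists (Suc n)"
    and nt: "\<And>z. z \<in> Z \<Longrightarrow> gs' \<noteq> map ((\<otimes>) z) gs"
  shows "\<exists>i<Suc n. unroll gs' (roll as gs) ! i = \<zero>\<^bsub>A\<^esub>"
proof (rule ccontr)
  assume nz: "\<not> (\<exists>i<Suc n. unroll gs' (roll as gs) ! i = \<zero>\<^bsub>A\<^esub>)"
  note g = group_listsD[OF gs] and g' = group_listsD[OF gs']
  have step: "inv (source gs' i) \<otimes> target gs' i = inv (source gs i) \<otimes> target gs i" if i: "i < Suc n" for i
  proof (rule ccontr)
    assume "\<not> ?thesis"
    then have "unroll gs' (roll as gs) ! i = \<zero>\<^bsub>A\<^esub>"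
      using i g(1) g'(1) source_target_closed[OF gs' i]
      by (simp add: unroll_def nth_roll monom_val act_simps del: upt_Suc)
    then show False using nz i by blast
  qed
  define z where "z = gs' ! 0 \<otimes> inv (gs ! 0)"
  have zc: "z \<in> carrier \<Gamma>" using g(2)[of 0] g'(2)[of 0] by (simp add: z_def)
  have all: "gs' ! i = z \<otimes> gs ! i" if "i < Suc n" for i
    using that
  proof (induction i)
    case 0
    then show ?case using g(2)[of 0] g'(2)[of 0] by (simp add: z_def \<Gamma>.m_assoc)
  next
    case (Suc i)
    then have IH: "gs' ! i = z \<otimes> gs ! i" by simp
    have c: "gs ! i \<in> carrier \<Gamma>" "gs ! Suc i \<in> carrier \<Gamma>" "gs' ! Suc i \<in> carrier \<Gamma>" "gs' ! i \<in> carrier \<Gamma>"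
      using g(2) g'(2) Suc.prems by auto
    have "inv (gs' ! i) \<otimes> gs' ! Suc i = inv (gs ! i) \<otimes> gs ! Suc i"
      using step[OF Suc.prems] by (simp add: source_def target_def)
    then have "gs' ! Suc i = gs' ! i \<otimes> (inv (gs ! i) \<otimes> gs ! Suc i)"
      using c by (simp add: \<Gamma>.inv_solve_left')
    also have "\<dots> = z \<otimes> gs ! Suc i"
      unfolding IH using c zc by (simp add: \<Gamma>.m_assoc) (simp add: \<Gamma>.m_assoc[symmetric])
    finally show ?case .
  qed
  have "z \<otimes> h = h \<otimes> z"
  proof -
    have c: "gs ! 0 \<in> carrier \<Gamma>" "gs ! n \<in> carrier \<Gamma>" using g(2) by auto
    have "inv (z \<otimes> gs ! n) \<otimes> (h \<otimes> (z \<otimes> gs ! 0)) = inv (gs ! n) \<otimes> (h \<otimes> gs ! 0)"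
      using step[of 0] all[of 0] all[of n] g(1) g'(1) by (simp add: source_def target_def)
    also have "\<dots> = inv (z \<otimes> gs ! n) \<otimes> (z \<otimes> (h \<otimes> gs ! 0))"
      using c zc h by (intro inv_translate[symmetric]) auto
    finally have "h \<otimes> (z \<otimes> gs ! 0) = z \<otimes> (h \<otimes> gs ! 0)"
      using c zc h by simp
    then have "(h \<otimes> z) \<otimes> gs ! 0 = (z \<otimes> h) \<otimes> gs ! 0" using c zc h by (simp add: \<Gamma>.m_assoc)
    then show ?thesis using c zc h by simp
  qed
  then have "z \<in> Z" using zc by (simp add: centralizer_def)
  moreover have "gs' = map ((\<otimes>) z) gs"
    using all g(1) g'(1) by (intro nth_equalityI) auto
  ultimately show False using nt by blast
qed

section \<open>Inserting the unit\<close>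

definition insert_one :: "nat \<Rightarrow> 'a list \<Rightarrow> 'a list" where
  "insert_one i as = take (Suc i) as @ \<one>\<^bsub>A\<^esub> # drop (Suc i) as"

lemma length_insert_one [simp]: "length (insert_one i as) = Suc (length as)"
  by (simp add: insert_one_def)

lemma nth_insert_one:
  "i < length as \<Longrightarrow> j \<le> length as \<Longrightarrow>
    insert_one i as ! j = (if j \<le> i then as ! j else if j = Suc i then \<one>\<^bsub>A\<^esub> else as ! (j - 1))"
  by (auto simp: insert_one_def nth_append nth_Cons min_def split: nat.splits)
    (rule arg_cong[of _ _ "(!) as"], linarith)+

lemma slotwise_insert_one:
  assumes i: "i < n"
  shows "slotwise A n A (Suc n) (insert_one i)"
  unfolding slotwise_def
proof (intro ballI conjI allI impI)
  fix as assume as: "as \<in> vectors A n"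
  note a = vectorsD[OF as]
  show "insert_one i as \<in> vectors A (Suc n)"
    by (rule vectorsI) (use a i in \<open>auto simp: nth_insert_one\<close>)
  fix k assume k: "k < n"
  have "insert_one i (as[k := x]) = (insert_one i as)[(if k \<le> i then k else Suc k) := x]" for x
    using a(1) i k by (intro nth_equalityI) (auto simp: nth_insert_one nth_list_update)
  then show "\<exists>j<Suc n. \<exists>L\<in>linear_maps A A. \<forall>x\<in>carrier A. insert_one i (as[k := x]) = (insert_one i as)[j := L x]"
    using k linear_maps_id[of A] by (intro exI[of _ "if k \<le> i then k else Suc k"] conjI bexI[of _ "\<lambda>x. x"]) auto
qed

lemma insert_one_vectors: "as \<in> vectors A n \<Longrightarrow> i < n \<Longrightarrow> insert_one i as \<in> vectors A (Suc n)"
  using slotwise_insert_one by (auto simp: slotwise_def)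

text \<open>
  These are the identities between faces and the degeneracy \<open>insert_one i\<close>; the unit inserted behind
  \<open>a\<^sub>i\<close> is absorbed by the faces \<open>i\<close> and \<open>i + 1\<close>.
\<close>

lemma face_insert_one:
  assumes as: "as \<in> vectors A (Suc n)" and i: "i \<le> n" and j: "j \<le> Suc n"
  shows "j < i \<Longrightarrow> twisted_face (Suc n) j (insert_one i as) = insert_one (i - 1) (twisted_face n j as)"
    and "j = i \<Longrightarrow> twisted_face (Suc n) j (insert_one i as) = as"
    and "j = Suc i \<Longrightarrow> twisted_face (Suc n) j (insert_one i as) = as"
    and "j > Suc i \<Longrightarrow> twisted_face (Suc n) j (insert_one i as) = insert_one i (twisted_face n (j - 1) as)"
proof -
  note a = vectorsD[OF as]
  have li: "length (insert_one i as) = Suc (Suc n)" using a by simp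
  note lf = length_hochschild_face[OF li j] and nf = nth_hochschild_face[OF li j]
  note h1 = act_simps(5)[OF h]
  show "twisted_face (Suc n) j (insert_one i as) = as" if "j = i"
  proof (rule nth_equalityI)
    fix q assume "q < length (twisted_face (Suc n) j (insert_one i as))"
    then have q: "q < Suc n" by (simp add: lf)
    show "twisted_face (Suc n) j (insert_one i as) ! q = as ! q"
      using q that i a(2) unfolding nf[OF q] by (auto simp: nth_insert_one a(1) h1)
  qed (simp add: lf a)
  show "twisted_face (Suc n) j (insert_one i as) = as" if "j = Suc i"
  proof (rule nth_equalityI)
    fix q assume "q < length (twisted_face (Suc n) j (insert_one i as))"
    then have q: "q < Suc n" by (simp add: lf)
    show "twisted_face (Suc n) j (insert_one i as) ! q = as ! q"
      using q that i a(2) unfolding nf[OF q] by (auto simp: nth_insert_one a(1))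
  qed (simp add: lf a)
  show "twisted_face (Suc n) j (insert_one i as) = insert_one (i - 1) (twisted_face n j as)" if ji: "j < i"
  proof -
    obtain m where m: "n = Suc m" using ji i by (cases n) auto
    have lm: "length as = Suc (Suc m)" and jm: "j \<le> Suc m" using a m ji i by auto
    note lf' = length_hochschild_face[OF lm jm, of A "\<phi> h"] and nf' = nth_hochschild_face[OF lm jm, of _ A "\<phi> h"]
    show ?thesis
    proof (rule nth_equalityI)
      fix q assume "q < length (twisted_face (Suc n) j (insert_one i as))"
      then have q: "q < Suc n" by (simp add: lf)
      have n': "insert_one (i - 1) (twisted_face n j as) ! q =
          (if q \<le> i - 1 then twisted_face n j as ! q else if q = i then \<one>\<^bsub>A\<^esub>
           else twisted_face n j as ! (q - 1))"
        using nth_insert_one[of "i - 1" "twisted_face n j as" q] m q ji i by (simp add: lf')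
      show "twisted_face (Suc n) j (insert_one i as) ! q = insert_one (i - 1) (twisted_face n j as) ! q"
        using q ji i m unfolding nf[OF q] n' unfolding m by (auto simp: nth_insert_one lm nth_hochschild_face[OF lm])
    qed (simp only: lf length_insert_one lf'[folded m])
  qed
  show "twisted_face (Suc n) j (insert_one i as) = insert_one i (twisted_face n (j - 1) as)" if ji: "j > Suc i"
  proof -
    obtain m where m: "n = Suc m" using ji j by (cases n) auto
    have lm: "length as = Suc (Suc m)" and jm: "j - 1 \<le> Suc m" using a m j by auto
    note lf' = length_hochschild_face[OF lm jm, of A "\<phi> h"] and nf' = nth_hochschild_face[OF lm jm, of _ A "\<phi> h"]
    show ?thesis
    proof (rule nth_equalityI)
      fix q assume "q < length (twisted_face (Suc n) j (insert_one i as))"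
      then have q: "q < Suc n" by (simp add: lf)
      have n': "insert_one i (twisted_face n (j - 1) as) ! q =
          (if q \<le> i then twisted_face n (j - 1) as ! q else if q = Suc i then \<one>\<^bsub>A\<^esub>
           else twisted_face n (j - 1) as ! (q - 1))"
        using nth_insert_one[of i "twisted_face n (j - 1) as" q, unfolded lf'[folded m]] q ji j m by simp
      show "twisted_face (Suc n) j (insert_one i as) ! q = insert_one i (twisted_face n (j - 1) as) ! q"
        using q ji i j m unfolding nf[OF q] n' unfolding m by (auto simp: nth_insert_one lm nth_hochschild_face[OF lm])
    qed (simp only: lf length_insert_one lf'[folded m])
  qed
qed

end

section \<open>The class component in unrolled form\<close>

lemma lin_on_lincomb:
  assumes "lin_on S L" "cfun.subspace S" "\<And>i. i \<in> I \<Longrightarrow> F i \<in> S"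
  shows "L (\<Sum>i\<in>I. c i *\<^sub>c F i) = (\<Sum>i\<in>I. c i *\<^sub>c L (F i))"
proof -
  have "L (\<Sum>i\<in>I. c i *\<^sub>c F i) = (\<Sum>i\<in>I. L (c i *\<^sub>c F i))"
    by (rule lin_on_sum[OF assms(1,2)]) (use assms(3) cfun.subspace_scale[OF assms(2)] in auto)
  also have "\<dots> = (\<Sum>i\<in>I. c i *\<^sub>c L (F i))"
    by (rule sum.cong[OF refl]) (use assms(3) lin_onD(2)[OF assms(1)] in auto)
  finally show ?thesis .
qed

lemma lin_on_scaled_sum:
  assumes "lin_on S L" "cfun.subspace S" "\<And>i. i \<in> I \<Longrightarrow> F i \<in> S"
  shows "L (c *\<^sub>c (\<Sum>i\<in>I. F i)) = c *\<^sub>c (\<Sum>i\<in>I. L (F i))"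
proof -
  have "(\<Sum>i\<in>I. F i) \<in> S" by (rule cfun.subspace_sum[OF assms(2,3)])
  then have "L (c *\<^sub>c (\<Sum>i\<in>I. F i)) = c *\<^sub>c L (\<Sum>i\<in>I. F i)" by (rule lin_onD(2)[OF assms(1)])
  also have "L (\<Sum>i\<in>I. F i) = (\<Sum>i\<in>I. L (F i))" by (rule lin_on_sum[OF assms])
  finally show ?thesis .
qed

lemma sum_average:
  assumes "finite I" "I \<noteq> {}"
  shows "(1 / of_nat (card I)) *\<^sub>c (\<Sum>i\<in>I. x) = x"
  using assms by (simp add: fun_eq_iff sum_fun_apply)

lemma delete_delete:
  assumes "length xs = Suc (Suc n)" "i < j" "j \<le> Suc n"
  shows "delete_nth i (delete_nth j xs) = delete_nth (j - 1) (delete_nth i xs)"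
  using assms
  by (intro nth_equalityI) (auto simp: nth_delete_nth[where n = "Suc n"] nth_delete_nth[where n = n])

lemma delete_replicate: "i \<le> n \<Longrightarrow> delete_nth i (replicate (Suc n) k) = replicate n k"
  by (intro nth_equalityI) (auto simp: nth_delete_nth[where n = n] simp del: replicate_Suc)

context twisted_group_algebra_action
begin

lemma face_face:
  assumes as: "as \<in> vectors A (Suc (Suc (Suc n)))" and ij: "i < j" "j \<le> Suc (Suc n)"
  shows "twisted_face (Suc n) i (twisted_face (Suc (Suc n)) j as) =
    twisted_face (Suc n) (j - 1) (twisted_face (Suc (Suc n)) i as)"
proof -
  note a = vectorsD[OF as]
  have len: "length (twisted_face (Suc (Suc n)) k as) = Suc (Suc n)" if "k \<le> Suc (Suc n)" for k
    using length_hochschild_face[OF a(1) that] .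
  note nth = nth_hochschild_face
  show ?thesis
  proof (rule nth_equalityI)
    fix q assume "q < length (twisted_face (Suc n) i (twisted_face (Suc (Suc n)) j as))"
    then have q: "q < Suc n" using ij by (simp add: length_hochschild_face[OF len])
    have mult: "a \<otimes>\<^bsub>A\<^esub> b \<otimes>\<^bsub>A\<^esub> c = a \<otimes>\<^bsub>A\<^esub> (b \<otimes>\<^bsub>A\<^esub> c)" if "a \<in> carrier A" "b \<in> carrier A" "c \<in> carrier A" for a b c
      using that by (rule A.m_assoc)
    show "twisted_face (Suc n) i (twisted_face (Suc (Suc n)) j as) ! q =
        twisted_face (Suc n) (j - 1) (twisted_face (Suc (Suc n)) i as) ! q"
      using ij q a(2) act_simps(1,2)[OF h]
      by (auto simp: nth[OF len] nth[OF a(1)] mult) (auto simp: le_Suc_eq)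
  qed (use ij in \<open>simp add: length_hochschild_face[OF len]\<close>)
qed

lemma face_map:
  assumes as: "as \<in> vectors A (Suc (Suc n))" and i: "i \<le> Suc n" and z: "z \<in> Z"
  shows "twisted_face (Suc n) i (map (\<phi> z) as) = map (\<phi> z) (twisted_face (Suc n) i as)"
proof -
  note a = vectorsD[OF as] and zc = centralizerD[OF z]
  have lm: "length (map (\<phi> z) as) = Suc (Suc n)" using a by simp
  have hz: "\<phi> h (\<phi> z b) = \<phi> z (\<phi> h b)" if "b \<in> carrier A" for b
    using that h zc by (simp add: act_comp)
  show ?thesis
  proof (rule nth_equalityI)
    fix q assume "q < length (twisted_face (Suc n) i (map (\<phi> z) as))"
    then have q: "q < Suc n" by (simp add: length_hochschild_face[OF lm i])
    then have q': "q < length (twisted_face (Suc n) i as)"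
      by (simp add: length_hochschild_face[OF a(1) i])
    show "twisted_face (Suc n) i (map (\<phi> z) as) ! q = map (\<phi> z) (twisted_face (Suc n) i as) ! q"
      using i q a(2) act_simps(1)[OF h] unfolding nth_map[OF q']
        nth_hochschild_face[OF lm i q] nth_hochschild_face[OF a(1) i q]
      by (auto simp: a(1) act_simps(2)[OF zc(1)] hz)
  qed (simp add: length_hochschild_face[OF lm i] length_hochschild_face[OF a(1) i])
qed

lemma insert_one_map:
  assumes "as \<in> vectors A n" "i < n" "z \<in> Z"
  shows "insert_one i (map (\<phi> z) as) = map (\<phi> z) (insert_one i as)"
  using act_simps(5)[OF centralizerD(1)[OF assms(3)]]
  by (simp add: insert_one_def take_map drop_map)

lemma cone_map: "cone m i (f k) (map f xs) = map f (cone m i k xs)"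
  by (simp add: cone_def take_map)

lemma cone_group_lists:
  "gs \<in> group_lists n \<Longrightarrow> k \<in> carrier \<Gamma> \<Longrightarrow> i \<le> n \<Longrightarrow> i \<le> m \<Longrightarrow> cone m i k gs \<in> group_lists m"
  by (rule group_listsI) (auto simp: group_listsD nth_cone)

lemma replicate_group_lists: "k \<in> carrier \<Gamma> \<Longrightarrow> replicate n k \<in> group_lists n"
  by (auto simp: group_lists_def)

definition rolled_tensor :: "'a list \<Rightarrow> 'g list \<Rightarrow> ('g \<Rightarrow> 'a) list \<Rightarrow> complex" where
  "rolled_tensor as gs = tensor_vec B (roll as gs)"

lemma multilinear_rolled_tensor: "gs \<in> group_lists n \<Longrightarrow> multilinear A n (\<lambda>as. rolled_tensor as gs)"
  unfolding rolled_tensor_def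
  by (rule multilinear_slotwise[OF module_A tensor_vec_multilinear[OF module_crossed] slotwise_roll])

lemma rolled_tensor_translate:
  "as \<in> vectors A n \<Longrightarrow> gs \<in> group_lists n \<Longrightarrow> z \<in> Z \<Longrightarrow> rolled_tensor (map (\<phi> z) as) (map ((\<otimes>) z) gs) = rolled_tensor as gs"
  by (simp add: rolled_tensor_def roll_translate)

lemma one_centralizer: "\<one> \<in> Z"
  using h by (simp add: centralizer_def)

lemma finite_centralizer: "finite Z"
  using finite_\<Gamma> by (auto simp: centralizer_def intro: finite_subset)

lemma centralizer_subgroup: "subgroup Z \<Gamma>"
proof (rule \<Gamma>.subgroupI)
  show "Z \<subseteq> carrier \<Gamma>" by (auto simp: centralizer_def)
  show "Z \<noteq> {}" using one_centralizer by auto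
  fix a assume a: "a \<in> Z"
  note ac = centralizerD[OF a]
  have "inv a \<otimes> h = h \<otimes> inv a"
    using ac h by (metis \<Gamma>.inv_closed \<Gamma>.inv_solve_left \<Gamma>.inv_solve_right \<Gamma>.m_assoc \<Gamma>.m_closed)
  then show "inv a \<in> Z" using ac by (simp add: centralizer_def)
  fix b assume b: "b \<in> Z"
  note bc = centralizerD[OF b]
  have "a \<otimes> b \<otimes> h = h \<otimes> (a \<otimes> b)" using ac bc h by (metis \<Gamma>.m_assoc)
  then show "a \<otimes> b \<in> Z" using ac bc by (simp add: centralizer_def)
qed

lemma centralizer_translate:
  assumes "w \<in> Z"
  shows "(\<Sum>z\<in>Z. f (z \<otimes> w)) = (\<Sum>z\<in>Z. f z)" "(\<Sum>z\<in>Z. f (w \<otimes> z)) = (\<Sum>z\<in>Z. f z)"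
proof -
  note sub = subgroup.m_closed[OF centralizer_subgroup] subgroup.m_inv_closed[OF centralizer_subgroup]
  note w = centralizerD(1)[OF assms]
  show "(\<Sum>z\<in>Z. f (z \<otimes> w)) = (\<Sum>z\<in>Z. f z)"
    by (rule sum.reindex_bij_witness[of _ "\<lambda>z. z \<otimes> inv w" "\<lambda>z. z \<otimes> w"])
      (use assms w sub centralizerD(1) in \<open>auto simp: \<Gamma>.m_assoc\<close>)
  show "(\<Sum>z\<in>Z. f (w \<otimes> z)) = (\<Sum>z\<in>Z. f z)"
    by (rule sum.reindex_bij_witness[of _ "\<lambda>z. inv w \<otimes> z" "\<lambda>z. w \<otimes> z"])
      (use assms w sub centralizerD(1) in \<open>auto simp: \<Gamma>.m_assoc[symmetric]\<close>)
qed

lemma group_translate: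
  assumes "w \<in> carrier \<Gamma>" shows "(\<Sum>z\<in>carrier \<Gamma>. f (w \<otimes> z)) = (\<Sum>z\<in>carrier \<Gamma>. f z)"
  by (rule sum.reindex_bij_witness[of _ "\<lambda>z. inv w \<otimes> z" "\<lambda>z. w \<otimes> z"])
    (use assms in \<open>auto simp: \<Gamma>.m_assoc[symmetric]\<close>)

text \<open>
  The data of a linear map on the class component.
\<close>

definition equivariant :: "nat \<Rightarrow> ('a list \<Rightarrow> 'g list \<Rightarrow> 'x \<Rightarrow> complex) \<Rightarrow> bool" where
  "equivariant n E \<longleftrightarrow> (\<forall>gs\<in>group_lists n. multilinear A n (\<lambda>as. E as gs)) \<and>
    (\<forall>as\<in>vectors A n. \<forall>gs\<in>group_lists n. \<forall>z\<in>Z. E (map (\<phi> z) as) (map ((\<otimes>) z) gs) = E as gs)"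

text \<open>
  The sum over all lists \<open>gs\<close> makes a choice of a starting vertex superfluous: on a rolled tensor the
  surviving terms are those of its translates, which explains the denominator.
\<close>

definition descend :: "nat \<Rightarrow> ('a list \<Rightarrow> 'g list \<Rightarrow> 'x \<Rightarrow> complex) \<Rightarrow> ('g \<Rightarrow> 'a) list \<Rightarrow> 'x \<Rightarrow> complex" where
  "descend n E us = (1 / of_nat (card Z)) *\<^sub>c (\<Sum>gs\<in>group_lists n. E (unroll gs us) gs)"

lemma multilinear_descend:
  assumes "equivariant n E" shows "multilinear B n (descend n E)"
  unfolding descend_def[abs_def]
proof (intro multilinear_scale multilinear_sum)
  fix gs assume gs: "gs \<in> group_lists n"
  show "multilinear B n (\<lambda>us. E (unroll gs us) gs)"
    by (rule multilinear_slotwise[OF module_crossed _ slotwise_unroll[OF gs], of "\<lambda>as. E as gs"])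
      (use assms gs in \<open>auto simp: equivariant_def\<close>)
qed

text \<open>
  Only the translates of \<open>gs\<close> contribute, because for every other list an entry of the unrolled tensor
  vanishes; by invariance each translate contributes the same value.
\<close>

lemma descend_roll:
  assumes E: "equivariant (Suc n) E" and as: "as \<in> vectors A (Suc n)" and gs: "gs \<in> group_lists (Suc n)"
  shows "descend (Suc n) E (roll as gs) = E as gs"
proof -
  let ?T = "(\<lambda>z. map ((\<otimes>) z) gs) ` Z"
  have sub: "?T \<subseteq> group_lists (Suc n)"
    using translate_group_lists[OF gs] centralizerD(1) by auto
  have zero: "E (unroll gs' (roll as gs)) gs' = 0" if gs': "gs' \<in> group_lists (Suc n) - ?T" for gs'
  proof -
    have g: "gs' \<in> group_lists (Suc n)" "\<And>z. z \<in> Z \<Longrightarrow> gs' \<noteq> map ((\<otimes>) z) gs" using gs' by auto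
    obtain i where i: "i < Suc n" "unroll gs' (roll as gs) ! i = \<zero>\<^bsub>A\<^esub>"
      using unroll_roll_zero[OF as gs g] by blast
    have "unroll gs' (roll as gs) \<in> vectors A (Suc n)"
      using slotwise_unroll[OF g(1)] roll_vectors[OF as gs] by (auto simp: slotwise_def)
    moreover have "multilinear A (Suc n) (\<lambda>as. E as gs')" using E g(1) by (auto simp: equivariant_def)
    ultimately show ?thesis using multilinear_zero[OF module_A _ _ i] by blast
  qed
  have inj: "inj_on (\<lambda>z. map ((\<otimes>) z) gs) Z"
  proof (rule inj_onI)
    fix z w assume zw: "z \<in> Z" "w \<in> Z" and eq: "map ((\<otimes>) z) gs = map ((\<otimes>) w) gs"
    have "z \<otimes> gs ! 0 = w \<otimes> gs ! 0"
      using arg_cong[OF eq, of "\<lambda>l. l ! 0"] group_listsD(1)[OF gs] by simp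
    then show "z = w" using zw centralizerD(1) group_listsD(2)[OF gs, of 0] by simp
  qed
  have "(\<Sum>gs'\<in>group_lists (Suc n). E (unroll gs' (roll as gs)) gs') = (\<Sum>gs'\<in>?T. E (unroll gs' (roll as gs)) gs')"
    by (rule sum.mono_neutral_right[OF finite_group_lists sub]) (use zero in blast)
  also have "\<dots> = (\<Sum>z\<in>Z. E (unroll (map ((\<otimes>) z) gs) (roll as gs)) (map ((\<otimes>) z) gs))"
    by (rule sum.reindex_cong[OF inj refl refl])
  also have "\<dots> = (\<Sum>z\<in>Z. E as gs)"
    by (rule sum.cong[OF refl]) (use E as gs unroll_roll_translate[OF as gs] in \<open>auto simp: equivariant_def\<close>)
  finally show ?thesis
    unfolding descend_def using sum_average[OF finite_centralizer, of "E as gs"] one_centralizer by auto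
qed

definition descend_map :: "nat \<Rightarrow> ('a list \<Rightarrow> 'g list \<Rightarrow> 'x \<Rightarrow> complex) \<Rightarrow> (('g \<Rightarrow> 'a) list \<Rightarrow> complex) \<Rightarrow> 'x \<Rightarrow> complex" where
  "descend_map n E = lin_ext (descend n E)"

lemma lin_on_descend_map: "lin_on (tensor_coords B n) (descend_map m E)"
  unfolding descend_map_def by (rule lin_on_tensor_coords[OF module_crossed])

lemma descend_map_rolled_tensor:
  assumes "equivariant (Suc n) E" "as \<in> vectors A (Suc n)" "gs \<in> group_lists (Suc n)"
  shows "descend_map (Suc n) E (rolled_tensor as gs) = E as gs"
  unfolding descend_map_def rolled_tensor_def
  using tensor_coord_facts(3)[OF module_crossed multilinear_descend[OF assms(1)] roll_vectors[OF assms(2,3)]]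
    descend_roll[OF assms] by simp

abbreviation "rolled_tensors n \<equiv> {rolled_tensor as gs | as gs. as \<in> vectors A (Suc n) \<and> gs \<in> group_lists (Suc n)}"

text \<open>
  The normal forms of the chains of the component of \<open>h\<close>.
\<close>

definition class_coords :: "nat \<Rightarrow> (('g \<Rightarrow> 'a) list \<Rightarrow> complex) set" where
  "class_coords n = cfun.span (rolled_tensors n)"

lemma rolled_tensor_class_coords: "as \<in> vectors A (Suc n) \<Longrightarrow> gs \<in> group_lists (Suc n) \<Longrightarrow> rolled_tensor as gs \<in> class_coords n"
  unfolding class_coords_def by (rule cfun.span_base) blast

lemma rolled_tensor_coords: "as \<in> vectors A n \<Longrightarrow> gs \<in> group_lists n \<Longrightarrow> rolled_tensor as gs \<in> tensor_coords B n"
  unfolding tensor_coords_def rolled_tensor_def by (intro cfun.span_base imageI roll_vectors)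

lemma subspace_class_coords: "cfun.subspace (class_coords n)"
  unfolding class_coords_def by (rule cfun.subspace_span)

lemma subspace_coords: "cfun.subspace (tensor_coords V n)"
  unfolding tensor_coords_def by (rule cfun.subspace_span)

lemma class_coords_coords: "class_coords n \<subseteq> tensor_coords B (Suc n)"
  unfolding class_coords_def by (rule cfun.span_minimal[OF _ subspace_coords]) (auto intro: rolled_tensor_coords)

lemma lin_on_class_coords: "lin_on (tensor_coords B (Suc n)) L \<Longrightarrow> lin_on (class_coords n) L"
  by (rule lin_on_subset[OF _ class_coords_coords])

lemma tensor_vec_coords: "as \<in> vectors A n \<Longrightarrow> tensor_vec A as \<in> tensor_coords A n"
  unfolding tensor_coords_def by (intro cfun.span_base imageI)

definition crossed_diff :: "nat \<Rightarrow> (('g \<Rightarrow> 'a) list \<Rightarrow> complex) \<Rightarrow> ('g \<Rightarrow> 'a) list \<Rightarrow> complex" where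
  "crossed_diff n = lin_ext (face_sum B (\<lambda>u. u) n)"

definition twisted_diff :: "nat \<Rightarrow> ('a list \<Rightarrow> complex) \<Rightarrow> 'a list \<Rightarrow> complex" where
  "twisted_diff n = lin_ext (face_sum A (\<phi> h) n)"

lemma lin_crossed_diff: "lin_on (tensor_coords B m) (crossed_diff n)"
  unfolding crossed_diff_def by (rule lin_on_tensor_coords[OF module_crossed])

lemma lin_twisted_diff: "lin_on (tensor_coords A m) (twisted_diff n)"
  unfolding twisted_diff_def by (rule lin_on_tensor_coords[OF module_A])

lemma twisted_diff_tensor_vec:
  "as \<in> vectors A (Suc (Suc n)) \<Longrightarrow>
    twisted_diff n (tensor_vec A as) = (\<Sum>i\<le>Suc n. (- 1) ^ i *\<^sub>c tensor_vec A (twisted_face (Suc n) i as))"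
  unfolding twisted_diff_def using hochschild_diff_facts(3)[OF bilinear_A act_linear[OF h]] by (simp only: face_sum_def)

lemma crossed_diff_rolled_tensor:
  assumes "as \<in> vectors A (Suc (Suc n))" "gs \<in> group_lists (Suc (Suc n))"
  shows "crossed_diff n (rolled_tensor as gs) = (\<Sum>i\<le>Suc n. (- 1) ^ i *\<^sub>c rolled_tensor (twisted_face (Suc n) i as) (delete_nth i gs))"
proof -
  have "crossed_diff n (rolled_tensor as gs) = face_sum B (\<lambda>u. u) n (roll as gs)"
    unfolding crossed_diff_def rolled_tensor_def
    by (rule hochschild_diff_facts(3)[OF bilinear_crossed linear_maps_id roll_vectors[OF assms]])
  also have "\<dots> = (\<Sum>i\<le>Suc n. (- 1) ^ i *\<^sub>c rolled_tensor (twisted_face (Suc n) i as) (delete_nth i gs))"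
    unfolding face_sum_def rolled_tensor_def by (rule sum.cong[OF refl]) (simp add: face_roll[OF assms])
  finally show ?thesis .
qed

lemma crossed_diff_class_coords: "x \<in> class_coords (Suc n) \<Longrightarrow> crossed_diff n x \<in> class_coords n"
  unfolding class_coords_def[of "Suc n"]
proof (erule lin_on_span_image[rotated 3])
  show "lin_on (cfun.span (rolled_tensors (Suc n))) (crossed_diff n)"
    using lin_on_class_coords[OF lin_crossed_diff, of "Suc n" n] by (simp add: class_coords_def)
  fix b assume "b \<in> rolled_tensors (Suc n)"
  then obtain as gs where *: "b = rolled_tensor as gs" "as \<in> vectors A (Suc (Suc n))" "gs \<in> group_lists (Suc (Suc n))" by blast
  show "crossed_diff n b \<in> class_coords n"
    unfolding *(1) crossed_diff_rolled_tensor[OF *(2,3)]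
    by (intro cfun.subspace_sum cfun.subspace_scale subspace_class_coords rolled_tensor_class_coords face_vectors delete_group_lists *) auto
qed (rule subspace_class_coords)

lemma class_coords_eqI:
  assumes "lin_on (class_coords n) f" "lin_on (class_coords n) g"
    "\<And>as gs. as \<in> vectors A (Suc n) \<Longrightarrow> gs \<in> group_lists (Suc n) \<Longrightarrow> f (rolled_tensor as gs) = g (rolled_tensor as gs)"
    "x \<in> class_coords n"
  shows "f x = g x"
  using lin_on_span_eq[OF assms(1,2)[unfolded class_coords_def] _ assms(4)[unfolded class_coords_def]] assms(3) by blast

lemma class_coords_imageI:
  assumes "lin_on (class_coords n) f" "cfun.subspace T"
    "\<And>as gs. as \<in> vectors A (Suc n) \<Longrightarrow> gs \<in> group_lists (Suc n) \<Longrightarrow> f (rolled_tensor as gs) \<in> T"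
    "x \<in> class_coords n"
  shows "f x \<in> T"
  using lin_on_span_image[OF assms(1)[unfolded class_coords_def] assms(2) _ assms(4)[unfolded class_coords_def]] assms(3) by blast

lemma coords_eqI:
  assumes "lin_on (tensor_coords A n) f" "lin_on (tensor_coords A n) g"
    "\<And>as. as \<in> vectors A n \<Longrightarrow> f (tensor_vec A as) = g (tensor_vec A as)" "x \<in> tensor_coords A n"
  shows "f x = g x"
  using lin_on_span_eq[OF assms(1,2)[unfolded tensor_coords_def] _ assms(4)[unfolded tensor_coords_def]] assms(3) by blast

lemma coords_imageI:
  assumes "lin_on (tensor_coords A n) f" "cfun.subspace T"
    "\<And>as. as \<in> vectors A n \<Longrightarrow> f (tensor_vec A as) \<in> T" "x \<in> tensor_coords A n"
  shows "f x \<in> T"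
  using lin_on_span_image[OF assms(1)[unfolded tensor_coords_def] assms(2) _ assms(4)[unfolded tensor_coords_def]] assms(3) by blast

lemma twisted_diff_coords: "x \<in> tensor_coords A (Suc (Suc n)) \<Longrightarrow> twisted_diff n x \<in> tensor_coords A (Suc n)"
proof (rule coords_imageI[OF lin_twisted_diff subspace_coords])
  fix as assume as: "as \<in> vectors A (Suc (Suc n))"
  show "twisted_diff n (tensor_vec A as) \<in> tensor_coords A (Suc n)"
    unfolding twisted_diff_tensor_vec[OF as]
    by (intro cfun.subspace_sum cfun.subspace_scale subspace_coords tensor_vec_coords face_vectors as) auto
qed

lemma vector_cancellation:
  assumes "\<And>i j. i < j \<Longrightarrow> j \<le> Suc n \<Longrightarrow> F j i = F i (j - 1)"
  shows "(\<Sum>j\<le>Suc n. (- 1) ^ j *\<^sub>c (\<Sum>i\<le>n. (- 1) ^ i *\<^sub>c F j i)) = 0"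
proof
  fix y
  show "(\<Sum>j\<le>Suc n. (- 1) ^ j *\<^sub>c (\<Sum>i\<le>n. (- 1) ^ i *\<^sub>c F j i)) y = 0 y"
    using simplicial_cancellation[of n "\<lambda>j i. F j i y"] assms
    by (simp add: sum_fun_apply sum_distrib_left del: sum.atMost_Suc)
qed

lemma twisted_diff_twisted_diff: "x \<in> tensor_coords A (Suc (Suc (Suc n))) \<Longrightarrow> twisted_diff n (twisted_diff (Suc n) x) = 0"
proof (rule coords_eqI[of "Suc (Suc (Suc n))" "\<lambda>x. twisted_diff n (twisted_diff (Suc n) x)" "\<lambda>x. 0"])
  show "lin_on (tensor_coords A (Suc (Suc (Suc n)))) (\<lambda>x. twisted_diff n (twisted_diff (Suc n) x))"
    by (rule lin_on_comp[OF lin_twisted_diff _ lin_twisted_diff]) (use twisted_diff_coords in blast)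
  show "lin_on (tensor_coords A (Suc (Suc (Suc n)))) (\<lambda>x. 0)" by (simp add: lin_on_def)
  fix as assume as: "as \<in> vectors A (Suc (Suc (Suc n)))"
  let ?f = "\<lambda>j i. tensor_vec A (twisted_face (Suc n) i (twisted_face (Suc (Suc n)) j as))"
  have "twisted_diff n (twisted_diff (Suc n) (tensor_vec A as)) =
      (\<Sum>j\<le>Suc (Suc n). (- 1) ^ j *\<^sub>c twisted_diff n (tensor_vec A (twisted_face (Suc (Suc n)) j as)))"
    unfolding twisted_diff_tensor_vec[OF as]
    by (rule lin_on_lincomb[OF lin_twisted_diff subspace_coords]) (auto intro!: tensor_vec_coords face_vectors as)
  also have "\<dots> = (\<Sum>j\<le>Suc (Suc n). (- 1) ^ j *\<^sub>c (\<Sum>i\<le>Suc n. (- 1) ^ i *\<^sub>c ?f j i))"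
    by (rule sum.cong[OF refl]) (use face_vectors[OF as] in \<open>simp add: twisted_diff_tensor_vec del: sum.atMost_Suc\<close>)
  also have "\<dots> = 0"
    by (rule vector_cancellation) (simp add: face_face[OF as])
  finally show "twisted_diff n (twisted_diff (Suc n) (tensor_vec A as)) = 0" .
qed

lemma crossed_diff_crossed_diff: "x \<in> class_coords (Suc (Suc n)) \<Longrightarrow> crossed_diff n (crossed_diff (Suc n) x) = 0"
proof (rule class_coords_eqI[of "Suc (Suc n)" "\<lambda>x. crossed_diff n (crossed_diff (Suc n) x)" "\<lambda>x. 0"])
  show "lin_on (class_coords (Suc (Suc n))) (\<lambda>x. crossed_diff n (crossed_diff (Suc n) x))"
    by (rule lin_on_comp[OF lin_on_class_coords[OF lin_crossed_diff] _ lin_on_class_coords[OF lin_crossed_diff]]) (use crossed_diff_class_coords in blast)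
  show "lin_on (class_coords (Suc (Suc n))) (\<lambda>x. 0)" by (simp add: lin_on_def)
  fix as gs assume as: "as \<in> vectors A (Suc (Suc (Suc n)))" and gs: "gs \<in> group_lists (Suc (Suc (Suc n)))"
  let ?f = "\<lambda>j i. rolled_tensor (twisted_face (Suc n) i (twisted_face (Suc (Suc n)) j as))
     (delete_nth i (delete_nth j gs))"
  have "crossed_diff n (crossed_diff (Suc n) (rolled_tensor as gs)) =
      (\<Sum>j\<le>Suc (Suc n). (- 1) ^ j *\<^sub>c crossed_diff n (rolled_tensor (twisted_face (Suc (Suc n)) j as) (delete_nth j gs)))"
    unfolding crossed_diff_rolled_tensor[OF as gs]
    by (rule lin_on_lincomb[OF lin_crossed_diff subspace_coords])
      (auto intro!: rolled_tensor_coords face_vectors delete_group_lists as gs)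
  also have "\<dots> = (\<Sum>j\<le>Suc (Suc n). (- 1) ^ j *\<^sub>c (\<Sum>i\<le>Suc n. (- 1) ^ i *\<^sub>c ?f j i))"
    by (rule sum.cong[OF refl])
      (use face_vectors[OF as] delete_group_lists[OF gs] in \<open>simp add: crossed_diff_rolled_tensor del: sum.atMost_Suc\<close>)
  also have "\<dots> = 0"
    by (rule vector_cancellation)
      (simp add: face_face[OF as] delete_delete[OF group_listsD(1)[OF gs]])
  finally show "crossed_diff n (crossed_diff (Suc n) (rolled_tensor as gs)) = 0" .
qed

end

section \<open>Averages, cone points and prisms\<close>

lemma vector_prism:
  fixes P Y :: "nat \<Rightarrow> nat \<Rightarrow> 'x \<Rightarrow> complex"
  assumes "\<And>i j. j < i \<Longrightarrow> i \<le> n \<Longrightarrow> P i j = Y (i - 1) j"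
    and "\<And>i j. Suc i < j \<Longrightarrow> j \<le> Suc n \<Longrightarrow> P i j = Y i (j - 1)"
    and "\<And>i. i \<le> n \<Longrightarrow> P i i = Z i" "\<And>i. i \<le> n \<Longrightarrow> P i (Suc i) = Z (Suc i)"
  shows "(\<Sum>i\<le>n. (- 1) ^ i *\<^sub>c (\<Sum>j\<le>Suc n. (- 1) ^ j *\<^sub>c P i j)) +
         (\<Sum>j\<le>n. (- 1) ^ j *\<^sub>c (\<Sum>i<n. (- 1) ^ i *\<^sub>c Y i j)) = Z 0 - Z (Suc n)"
proof
  fix y
  show "((\<Sum>i\<le>n. (- 1) ^ i *\<^sub>c (\<Sum>j\<le>Suc n. (- 1) ^ j *\<^sub>c P i j)) +
         (\<Sum>j\<le>n. (- 1) ^ j *\<^sub>c (\<Sum>i<n. (- 1) ^ i *\<^sub>c Y i j))) y = (Z 0 - Z (Suc n)) y"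
    using prism_cancellation[of n "\<lambda>i j. P i j y" "\<lambda>i j. Y i j y" "\<lambda>i. Z i y"] assms
    by (simp add: sum_fun_apply sum_distrib_left del: sum.atMost_Suc)
qed

context twisted_group_algebra_action
begin

text \<open>
  In coordinates, on generators: the quasi-isomorphism (\<open>average_chain\<close>), a chain map in the other
  direction (\<open>constant_chain\<close>) and the prism operator averaged over all cone points
  (\<open>prism_chain\<close>).
\<close>

definition average_chain :: "'a list \<Rightarrow> 'a list \<Rightarrow> complex" where
  "average_chain as = (1 / of_nat (card Z)) *\<^sub>c (\<Sum>z\<in>Z. tensor_vec A (map (\<phi> z) as))"

definition constant_chain :: "nat \<Rightarrow> 'a list \<Rightarrow> ('g \<Rightarrow> 'a) list \<Rightarrow> complex" where
  "constant_chain n as = (1 / of_nat (card (carrier \<Gamma>))) *\<^sub>c (\<Sum>k\<in>carrier \<Gamma>. rolled_tensor as (replicate (Suc n) k))"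

definition prism_chain :: "nat \<Rightarrow> 'a list \<Rightarrow> 'g list \<Rightarrow> ('g \<Rightarrow> 'a) list \<Rightarrow> complex" where
  "prism_chain n as gs = (1 / of_nat (card (carrier \<Gamma>))) *\<^sub>c (\<Sum>k\<in>carrier \<Gamma>.
     \<Sum>i\<le>n. (- 1) ^ i *\<^sub>c rolled_tensor (insert_one i as) (cone (Suc (Suc n)) (Suc i) k gs))"

lemma map_act_comp:
  assumes "z \<in> carrier \<Gamma>" "w \<in> carrier \<Gamma>" "as \<in> vectors A n"
  shows "map (\<phi> w) (map (\<phi> z) as) = map (\<phi> (w \<otimes> z)) as"
  using assms by (auto simp: vectors_def act_comp)

lemma average_chain_translate:
  assumes "as \<in> vectors A n" "w \<in> Z"
  shows "average_chain (map (\<phi> w) as) = average_chain as"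
proof -
  have "(\<Sum>z\<in>Z. tensor_vec A (map (\<phi> z) (map (\<phi> w) as))) = (\<Sum>z\<in>Z. tensor_vec A (map (\<phi> (z \<otimes> w)) as))"
    by (rule sum.cong[OF refl])
      (simp only: map_act_comp[OF centralizerD(1)[OF assms(2)] centralizerD(1) assms(1)])
  also have "\<dots> = (\<Sum>z\<in>Z. tensor_vec A (map (\<phi> z) as))"
    by (rule centralizer_translate(1)[OF assms(2)])
  finally show ?thesis by (simp only: average_chain_def)
qed

lemma equivariant_average: "equivariant n (\<lambda>as gs. average_chain as)"
  unfolding equivariant_def
proof (intro conjI ballI)
  show "multilinear A n (\<lambda>as. average_chain as)"
    unfolding average_chain_def
    by (intro multilinear_scale multilinear_sum
        multilinear_slotwise[OF module_A tensor_vec_multilinear[OF module_A] slotwise_act] centralizerD(1))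
qed (rule average_chain_translate)

text \<open>
  A translation of \<open>gs\<close> by \<open>z\<close> can be compensated by the translation of the cone point, over which the
  average is taken.
\<close>

lemma equivariant_prism: "equivariant (Suc n) (prism_chain n)"
  unfolding equivariant_def
proof (intro conjI ballI)
  fix gs assume gs: "gs \<in> group_lists (Suc n)"
  show "multilinear A (Suc n) (\<lambda>as. prism_chain n as gs)"
    unfolding prism_chain_def
  proof (intro multilinear_scale multilinear_sum)
    fix k i assume "k \<in> carrier \<Gamma>" "i \<in> {..n}"
    then show "multilinear A (Suc n) (\<lambda>as. rolled_tensor (insert_one i as) (cone (Suc (Suc n)) (Suc i) k gs))"
      by (intro multilinear_slotwise[OF module_A multilinear_rolled_tensor slotwise_insert_one] cone_group_lists[OF gs]) auto
  qed
  fix as z assume as: "as \<in> vectors A (Suc n)" and z: "z \<in> Z"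
  let ?f = "\<lambda>as gs k. \<Sum>i\<le>n. (- 1) ^ i *\<^sub>c rolled_tensor (insert_one i as) (cone (Suc (Suc n)) (Suc i) k gs)"
  have "(\<Sum>k\<in>carrier \<Gamma>. ?f (map (\<phi> z) as) (map ((\<otimes>) z) gs) k) =
      (\<Sum>k\<in>carrier \<Gamma>. ?f (map (\<phi> z) as) (map ((\<otimes>) z) gs) (z \<otimes> k))"
    by (rule group_translate[OF centralizerD(1)[OF z], symmetric])
  also have "\<dots> = (\<Sum>k\<in>carrier \<Gamma>. ?f as gs k)"
  proof (intro sum.cong refl)
    fix k i assume k: "k \<in> carrier \<Gamma>" and "i \<in> {..n}"
    then have i: "i < Suc n" by simp
    have "rolled_tensor (map (\<phi> z) (insert_one i as)) (map ((\<otimes>) z) (cone (Suc (Suc n)) (Suc i) k gs)) =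
        rolled_tensor (insert_one i as) (cone (Suc (Suc n)) (Suc i) k gs)"
      by (rule rolled_tensor_translate[OF insert_one_vectors[OF as i] cone_group_lists[OF gs k] z]) (use i in auto)
    then show "(- 1) ^ i *\<^sub>c rolled_tensor (insert_one i (map (\<phi> z) as)) (cone (Suc (Suc n)) (Suc i) (z \<otimes> k) (map ((\<otimes>) z) gs)) =
        (- 1) ^ i *\<^sub>c rolled_tensor (insert_one i as) (cone (Suc (Suc n)) (Suc i) k gs)"
      by (simp only: insert_one_map[OF as i z] cone_map)
  qed
  finally show "prism_chain n (map (\<phi> z) as) (map ((\<otimes>) z) gs) = prism_chain n as gs"
    by (simp only: prism_chain_def)
qed

lemma multilinear_constant: "multilinear A (Suc n) (constant_chain n)"
  unfolding constant_chain_def[abs_def]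
  by (intro multilinear_scale multilinear_sum multilinear_rolled_tensor replicate_group_lists)

definition to_twisted :: "nat \<Rightarrow> (('g \<Rightarrow> 'a) list \<Rightarrow> complex) \<Rightarrow> 'a list \<Rightarrow> complex" where
  "to_twisted n = descend_map (Suc n) (\<lambda>as gs. average_chain as)"

definition prism_map :: "nat \<Rightarrow> (('g \<Rightarrow> 'a) list \<Rightarrow> complex) \<Rightarrow> ('g \<Rightarrow> 'a) list \<Rightarrow> complex" where
  "prism_map n = descend_map (Suc n) (prism_chain n)"

definition from_twisted :: "nat \<Rightarrow> ('a list \<Rightarrow> complex) \<Rightarrow> ('g \<Rightarrow> 'a) list \<Rightarrow> complex" where
  "from_twisted n = lin_ext (constant_chain n)"

definition act_map :: "'g \<Rightarrow> ('a list \<Rightarrow> complex) \<Rightarrow> 'a list \<Rightarrow> complex" where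
  "act_map g = lin_ext (\<lambda>as. tensor_vec A (map (\<phi> g) as))"

lemma lin_to_twisted: "lin_on (tensor_coords B m) (to_twisted n)"
  unfolding to_twisted_def by (rule lin_on_descend_map)

lemma lin_prism_map: "lin_on (tensor_coords B m) (prism_map n)"
  unfolding prism_map_def by (rule lin_on_descend_map)

lemma lin_from_twisted: "lin_on (tensor_coords A m) (from_twisted n)"
  unfolding from_twisted_def by (rule lin_on_tensor_coords[OF module_A])

lemma lin_act_map: "lin_on (tensor_coords A m) (act_map g)"
  unfolding act_map_def by (rule lin_on_tensor_coords[OF module_A])

lemma multilinear_act: "g \<in> carrier \<Gamma> \<Longrightarrow> multilinear A n (\<lambda>as. tensor_vec A (map (\<phi> g) as))"
  by (rule multilinear_slotwise[OF module_A tensor_vec_multilinear[OF module_A] slotwise_act])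

lemma act_map_tensor_vec: "g \<in> carrier \<Gamma> \<Longrightarrow> as \<in> vectors A n \<Longrightarrow> act_map g (tensor_vec A as) = tensor_vec A (map (\<phi> g) as)"
  unfolding act_map_def using tensor_coord_facts(3)[OF module_A multilinear_act] by simp

lemma to_twisted_rolled_tensor: "as \<in> vectors A (Suc n) \<Longrightarrow> gs \<in> group_lists (Suc n) \<Longrightarrow> to_twisted n (rolled_tensor as gs) = average_chain as"
  unfolding to_twisted_def by (rule descend_map_rolled_tensor[OF equivariant_average])

lemma prism_map_rolled_tensor: "as \<in> vectors A (Suc n) \<Longrightarrow> gs \<in> group_lists (Suc n) \<Longrightarrow> prism_map n (rolled_tensor as gs) = prism_chain n as gs"
  unfolding prism_map_def by (rule descend_map_rolled_tensor[OF equivariant_prism])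

lemma from_twisted_tensor_vec: "as \<in> vectors A (Suc n) \<Longrightarrow> from_twisted n (tensor_vec A as) = constant_chain n as"
  unfolding from_twisted_def by (rule tensor_coord_facts(3)[OF module_A multilinear_constant])

lemma average_chain_coords: "as \<in> vectors A n \<Longrightarrow> average_chain as \<in> tensor_coords A n"
  unfolding average_chain_def
  by (intro cfun.subspace_scale cfun.subspace_sum subspace_coords tensor_vec_coords map_act_vectors centralizerD(1))

lemma constant_chain_class_coords: "as \<in> vectors A (Suc n) \<Longrightarrow> constant_chain n as \<in> class_coords n"
  unfolding constant_chain_def
  by (intro cfun.subspace_scale cfun.subspace_sum subspace_class_coords rolled_tensor_class_coords replicate_group_lists)

lemma prism_chain_class_coords:
  assumes "as \<in> vectors A (Suc n)" "gs \<in> group_lists (Suc n)"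
  shows "prism_chain n as gs \<in> class_coords (Suc n)"
  unfolding prism_chain_def
  by (intro cfun.subspace_scale cfun.subspace_sum subspace_class_coords rolled_tensor_class_coords insert_one_vectors
      cone_group_lists[OF assms(2)] assms(1)) auto

lemma to_twisted_coords: "x \<in> class_coords n \<Longrightarrow> to_twisted n x \<in> tensor_coords A (Suc n)"
  by (rule class_coords_imageI[OF lin_on_class_coords[OF lin_to_twisted] subspace_coords])
    (simp_all add: to_twisted_rolled_tensor average_chain_coords)

lemma prism_map_class_coords: "x \<in> class_coords n \<Longrightarrow> prism_map n x \<in> class_coords (Suc n)"
  by (rule class_coords_imageI[OF lin_on_class_coords[OF lin_prism_map] subspace_class_coords])
    (simp_all add: prism_map_rolled_tensor prism_chain_class_coords)

lemma from_twisted_class_coords: "y \<in> tensor_coords A (Suc n) \<Longrightarrow> from_twisted n y \<in> class_coords n"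
  by (rule coords_imageI[OF lin_from_twisted subspace_class_coords])
    (simp_all add: from_twisted_tensor_vec constant_chain_class_coords)

lemma act_map_coords: "g \<in> carrier \<Gamma> \<Longrightarrow> y \<in> tensor_coords A n \<Longrightarrow> act_map g y \<in> tensor_coords A n"
  by (rule coords_imageI[OF lin_act_map subspace_coords])
    (simp_all add: act_map_tensor_vec tensor_vec_coords map_act_vectors)

lemma act_map_to_twisted:
  assumes w: "w \<in> Z" and x: "x \<in> class_coords n" shows "act_map w (to_twisted n x) = to_twisted n x"
proof (rule class_coords_eqI[of n "\<lambda>x. act_map w (to_twisted n x)" "to_twisted n", OF _ _ _ x])
  note wc = centralizerD(1)[OF w]
  show "lin_on (class_coords n) (\<lambda>x. act_map w (to_twisted n x))"
    by (rule lin_on_comp[OF lin_on_class_coords[OF lin_to_twisted] _ lin_act_map]) (use to_twisted_coords in blast)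
  show "lin_on (class_coords n) (to_twisted n)" by (rule lin_on_class_coords[OF lin_to_twisted])
  fix as gs assume as: "as \<in> vectors A (Suc n)" and gs: "gs \<in> group_lists (Suc n)"
  have "act_map w (average_chain as) = (1 / of_nat (card Z)) *\<^sub>c (\<Sum>z\<in>Z. act_map w (tensor_vec A (map (\<phi> z) as)))"
    unfolding average_chain_def
    by (rule lin_on_scaled_sum[OF lin_act_map subspace_coords[of A "Suc n"]])
      (intro tensor_vec_coords map_act_vectors centralizerD(1) as)
  also have "(\<Sum>z\<in>Z. act_map w (tensor_vec A (map (\<phi> z) as))) = (\<Sum>z\<in>Z. tensor_vec A (map (\<phi> (w \<otimes> z)) as))"
    by (rule sum.cong[OF refl])
      (simp only: act_map_tensor_vec[OF wc map_act_vectors[OF centralizerD(1) as]] map_act_comp[OF centralizerD(1) wc as])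
  also have "\<dots> = (\<Sum>z\<in>Z. tensor_vec A (map (\<phi> z) as))"
    by (rule centralizer_translate(2)[OF w])
  finally show "act_map w (to_twisted n (rolled_tensor as gs)) = to_twisted n (rolled_tensor as gs)"
    by (simp only: to_twisted_rolled_tensor[OF as gs] average_chain_def)
qed

lemma to_twisted_crossed_diff:
  assumes x: "x \<in> class_coords (Suc n)" shows "to_twisted n (crossed_diff n x) = twisted_diff n (to_twisted (Suc n) x)"
proof (rule class_coords_eqI[of "Suc n" "\<lambda>x. to_twisted n (crossed_diff n x)" "\<lambda>x. twisted_diff n (to_twisted (Suc n) x)", OF _ _ _ x])
  show "lin_on (class_coords (Suc n)) (\<lambda>x. to_twisted n (crossed_diff n x))"
    by (rule lin_on_comp[OF lin_on_class_coords[OF lin_crossed_diff] _ lin_on_class_coords[OF lin_to_twisted]]) (use crossed_diff_class_coords in blast)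
  show "lin_on (class_coords (Suc n)) (\<lambda>x. twisted_diff n (to_twisted (Suc n) x))"
    by (rule lin_on_comp[OF lin_on_class_coords[OF lin_to_twisted] _ lin_twisted_diff]) (use to_twisted_coords in blast)
  fix as gs assume as: "as \<in> vectors A (Suc (Suc n))" and gs: "gs \<in> group_lists (Suc (Suc n))"
  let ?face = "twisted_face (Suc n)"
  have "to_twisted n (crossed_diff n (rolled_tensor as gs)) = (\<Sum>i\<le>Suc n. (- 1) ^ i *\<^sub>c to_twisted n (rolled_tensor (?face i as) (delete_nth i gs)))"
    unfolding crossed_diff_rolled_tensor[OF as gs]
    by (rule lin_on_lincomb[OF lin_to_twisted subspace_coords])
      (auto intro!: rolled_tensor_coords face_vectors delete_group_lists as gs)
  also have "\<dots> = (\<Sum>i\<le>Suc n. (- 1) ^ i *\<^sub>c average_chain (?face i as))"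
    by (rule sum.cong[OF refl])
      (use face_vectors[OF as] delete_group_lists[OF gs] in \<open>simp add: to_twisted_rolled_tensor\<close>)
  also have "\<dots> = (1 / of_nat (card Z)) *\<^sub>c (\<Sum>z\<in>Z. \<Sum>i\<le>Suc n. (- 1) ^ i *\<^sub>c tensor_vec A (map (\<phi> z) (?face i as)))"
    unfolding average_chain_def
    by (subst sum.swap) (simp only: fun_eq_iff sum_fun_apply fscale_apply sum_distrib_left mult.left_commute simp_thms)
  also have "\<dots> = (1 / of_nat (card Z)) *\<^sub>c (\<Sum>z\<in>Z. twisted_diff n (tensor_vec A (map (\<phi> z) as)))"
  proof -
    have "(\<Sum>i\<le>Suc n. (- 1) ^ i *\<^sub>c tensor_vec A (map (\<phi> z) (?face i as))) = twisted_diff n (tensor_vec A (map (\<phi> z) as))" if z: "z \<in> Z" for z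
      unfolding twisted_diff_tensor_vec[OF map_act_vectors[OF centralizerD(1)[OF z] as]]
      by (rule sum.cong[OF refl]) (simp add: face_map[OF as _ z])
    then show ?thesis by (metis (no_types, lifting) sum.cong)
  qed
  also have "\<dots> = twisted_diff n (average_chain as)"
    unfolding average_chain_def
    by (rule lin_on_scaled_sum[OF lin_twisted_diff subspace_coords[of A "Suc (Suc n)"], symmetric])
      (intro tensor_vec_coords map_act_vectors centralizerD(1) as)
  finally show "to_twisted n (crossed_diff n (rolled_tensor as gs)) = twisted_diff n (to_twisted (Suc n) (rolled_tensor as gs))"
    by (simp only: to_twisted_rolled_tensor[OF as gs])
qed

lemma crossed_diff_from_twisted:
  assumes y: "y \<in> tensor_coords A (Suc (Suc n))" shows "crossed_diff n (from_twisted (Suc n) y) = from_twisted n (twisted_diff n y)"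
proof (rule coords_eqI[of "Suc (Suc n)" "\<lambda>y. crossed_diff n (from_twisted (Suc n) y)" "\<lambda>y. from_twisted n (twisted_diff n y)", OF _ _ _ y])
  show "lin_on (tensor_coords A (Suc (Suc n))) (\<lambda>y. crossed_diff n (from_twisted (Suc n) y))"
    by (rule lin_on_comp[OF lin_from_twisted _ lin_on_class_coords[OF lin_crossed_diff]]) (use from_twisted_class_coords in blast)
  show "lin_on (tensor_coords A (Suc (Suc n))) (\<lambda>y. from_twisted n (twisted_diff n y))"
    by (rule lin_on_comp[OF lin_twisted_diff _ lin_from_twisted]) (use twisted_diff_coords in blast)
  fix as assume as: "as \<in> vectors A (Suc (Suc n))"
  let ?face = "twisted_face (Suc n)" and ?c = "1 / of_nat (card (carrier \<Gamma>))"
  have "crossed_diff n (from_twisted (Suc n) (tensor_vec A as)) = ?c *\<^sub>c (\<Sum>k\<in>carrier \<Gamma>. crossed_diff n (rolled_tensor as (replicate (Suc (Suc n)) k)))"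
    unfolding from_twisted_tensor_vec[OF as] constant_chain_def
    by (rule lin_on_scaled_sum[OF lin_crossed_diff subspace_coords[of B "Suc (Suc n)"]])
      (intro rolled_tensor_coords as replicate_group_lists)
  also have "(\<Sum>k\<in>carrier \<Gamma>. crossed_diff n (rolled_tensor as (replicate (Suc (Suc n)) k))) =
      (\<Sum>k\<in>carrier \<Gamma>. \<Sum>i\<le>Suc n. (- 1) ^ i *\<^sub>c rolled_tensor (?face i as) (replicate (Suc n) k))"
  proof (rule sum.cong[OF refl])
    fix k assume k: "k \<in> carrier \<Gamma>"
    show "crossed_diff n (rolled_tensor as (replicate (Suc (Suc n)) k)) = (\<Sum>i\<le>Suc n. (- 1) ^ i *\<^sub>c rolled_tensor (?face i as) (replicate (Suc n) k))"
      unfolding crossed_diff_rolled_tensor[OF as replicate_group_lists[OF k]]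
      by (rule sum.cong[OF refl]) (simp only: delete_replicate atMost_iff)
  qed
  also have "?c *\<^sub>c \<dots> = (\<Sum>i\<le>Suc n. (- 1) ^ i *\<^sub>c constant_chain n (?face i as))"
    unfolding constant_chain_def
    by (subst sum.swap) (simp only: fun_eq_iff sum_fun_apply fscale_apply sum_distrib_left mult.left_commute simp_thms)
  also have "\<dots> = (\<Sum>i\<le>Suc n. (- 1) ^ i *\<^sub>c from_twisted n (tensor_vec A (?face i as)))"
    by (rule sum.cong[OF refl]) (simp add: from_twisted_tensor_vec face_vectors[OF as])
  also have "\<dots> = from_twisted n (twisted_diff n (tensor_vec A as))"
    unfolding twisted_diff_tensor_vec[OF as]
    by (rule lin_on_lincomb[OF lin_from_twisted subspace_coords, symmetric])
      (auto intro!: tensor_vec_coords face_vectors as)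
  finally show "crossed_diff n (from_twisted (Suc n) (tensor_vec A as)) = from_twisted n (twisted_diff n (tensor_vec A as))" .
qed

lemma centralizer_nonempty: "Z \<noteq> {}"
  using one_centralizer by auto

lemma card_\<Gamma>: "finite (carrier \<Gamma>)" "carrier \<Gamma> \<noteq> {}"
  using finite_\<Gamma> by auto

lemma to_twisted_constant_chain:
  assumes as: "as \<in> vectors A (Suc n)" shows "to_twisted n (constant_chain n as) = average_chain as"
proof -
  have "to_twisted n (constant_chain n as) =
      (1 / of_nat (card (carrier \<Gamma>))) *\<^sub>c (\<Sum>k\<in>carrier \<Gamma>. to_twisted n (rolled_tensor as (replicate (Suc n) k)))"
    unfolding constant_chain_def
    by (rule lin_on_scaled_sum[OF lin_to_twisted subspace_coords[of B "Suc n"]]) (intro rolled_tensor_coords as replicate_group_lists)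
  also have "(\<Sum>k\<in>carrier \<Gamma>. to_twisted n (rolled_tensor as (replicate (Suc n) k))) = (\<Sum>k\<in>carrier \<Gamma>. average_chain as)"
    by (rule sum.cong[OF refl]) (simp only: to_twisted_rolled_tensor[OF as replicate_group_lists])
  finally show ?thesis by (simp only: sum_average[OF card_\<Gamma>])
qed

text \<open>
  A constant simplex is sent to the average of the translates, whatever its vertex is, so the composite
  is the average over the centralizer.
\<close>

lemma to_twisted_from_twisted:
  assumes y: "y \<in> tensor_coords A (Suc n)" and inv: "\<And>z. z \<in> Z \<Longrightarrow> act_map z y = y"
  shows "to_twisted n (from_twisted n y) = y"
proof -
  have "to_twisted n (from_twisted n y) = (1 / of_nat (card Z)) *\<^sub>c (\<Sum>z\<in>Z. act_map z y)"
  proof (rule coords_eqI[of "Suc n" "\<lambda>y. to_twisted n (from_twisted n y)" "\<lambda>y. (1 / of_nat (card Z)) *\<^sub>c (\<Sum>z\<in>Z. act_map z y)", OF _ _ _ y])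
    show "lin_on (tensor_coords A (Suc n)) (\<lambda>y. to_twisted n (from_twisted n y))"
      by (rule lin_on_comp[OF lin_from_twisted _ lin_on_class_coords[OF lin_to_twisted]]) (use from_twisted_class_coords in blast)
    show "lin_on (tensor_coords A (Suc n)) (\<lambda>y. (1 / of_nat (card Z)) *\<^sub>c (\<Sum>z\<in>Z. act_map z y))"
      using lin_onD[OF lin_act_map]
      by (simp add: lin_on_def sum.distrib cfun.scale_right_distrib cfun.scale_sum_right[symmetric] mult.commute)
    fix as assume as: "as \<in> vectors A (Suc n)"
    show "to_twisted n (from_twisted n (tensor_vec A as)) = (1 / of_nat (card Z)) *\<^sub>c (\<Sum>z\<in>Z. act_map z (tensor_vec A as))"
      unfolding from_twisted_tensor_vec[OF as] to_twisted_constant_chain[OF as] average_chain_def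
      by (rule arg_cong[of _ _ "\<lambda>x. _ *\<^sub>c x"], rule sum.cong[OF refl])
        (simp only: act_map_tensor_vec[OF centralizerD(1) as])
  qed
  also have "(\<Sum>z\<in>Z. act_map z y) = (\<Sum>z\<in>Z. y)" by (rule sum.cong[OF refl inv])
  finally show ?thesis by (simp only: sum_average[OF finite_centralizer centralizer_nonempty])
qed

lemma constant_chain_translate:
  assumes as: "as \<in> vectors A (Suc n)" and z: "z \<in> Z"
  shows "constant_chain n (map (\<phi> z) as) = constant_chain n as"
proof -
  have "(\<Sum>k\<in>carrier \<Gamma>. rolled_tensor (map (\<phi> z) as) (replicate (Suc n) k)) =
      (\<Sum>k\<in>carrier \<Gamma>. rolled_tensor (map (\<phi> z) as) (replicate (Suc n) (z \<otimes> k)))"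
    by (rule group_translate[OF centralizerD(1)[OF z], symmetric])
  also have "\<dots> = (\<Sum>k\<in>carrier \<Gamma>. rolled_tensor as (replicate (Suc n) k))"
    by (rule sum.cong[OF refl])
      (simp only: map_replicate[symmetric] rolled_tensor_translate[OF as replicate_group_lists z])
  finally show ?thesis by (simp only: constant_chain_def)
qed

lemma from_twisted_average_chain:
  assumes as: "as \<in> vectors A (Suc n)" shows "from_twisted n (average_chain as) = constant_chain n as"
proof -
  have "from_twisted n (average_chain as) = (1 / of_nat (card Z)) *\<^sub>c (\<Sum>z\<in>Z. from_twisted n (tensor_vec A (map (\<phi> z) as)))"
    unfolding average_chain_def
    by (rule lin_on_scaled_sum[OF lin_from_twisted subspace_coords[of A "Suc n"]])
      (intro tensor_vec_coords map_act_vectors centralizerD(1) as)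
  also have "(\<Sum>z\<in>Z. from_twisted n (tensor_vec A (map (\<phi> z) as))) = (\<Sum>z\<in>Z. constant_chain n as)"
    by (rule sum.cong[OF refl])
      (simp only: from_twisted_tensor_vec[OF map_act_vectors[OF centralizerD(1) as]] constant_chain_translate[OF as])
  finally show ?thesis by (simp only: sum_average[OF finite_centralizer centralizer_nonempty])
qed

text \<open>
  For a fixed cone point this is the prism identity, with the diagonal faces \<open>(g\<^sub>0, \<dots>, g\<^sub>i\<^sub>-\<^sub>1, k, \<dots>, k)\<close>.
  The first of them is \<open>(k, \<dots>, k)\<close> and the last one is the simplex itself.
\<close>

lemma homotopy:
  assumes as: "as \<in> vectors A (Suc n)" and gs: "gs \<in> group_lists (Suc n)"
  shows "crossed_diff n (prism_map n (rolled_tensor as gs)) + (case n of 0 \<Rightarrow> 0 | Suc m \<Rightarrow> prism_map m (crossed_diff m (rolled_tensor as gs))) =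
    constant_chain n as - rolled_tensor as gs"
proof -
  let ?c = "1 / of_nat (card (carrier \<Gamma>)) :: complex"
  let ?face = "\<lambda>m. twisted_face m"
  let ?F = "\<lambda>k i. rolled_tensor (insert_one i as) (cone (Suc (Suc n)) (Suc i) k gs)"
  let ?P = "\<lambda>k i j. rolled_tensor (?face (Suc n) j (insert_one i as)) (delete_nth j (cone (Suc (Suc n)) (Suc i) k gs))"
  let ?Y = "\<lambda>k i j. rolled_tensor (insert_one i (?face n j as)) (cone (Suc n) (Suc i) k (delete_nth j gs))"
  let ?A = "\<lambda>k. \<Sum>i\<le>n. (- 1) ^ i *\<^sub>c (\<Sum>j\<le>Suc n. (- 1) ^ j *\<^sub>c ?P k i j)"
  let ?B = "\<lambda>k. \<Sum>j\<le>n. (- 1) ^ j *\<^sub>c (\<Sum>i<n. (- 1) ^ i *\<^sub>c ?Y k i j)"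
  have Fv: "insert_one i as \<in> vectors A (Suc (Suc n))" "cone (Suc (Suc n)) (Suc i) k gs \<in> group_lists (Suc (Suc n))"
    if "k \<in> carrier \<Gamma>" "i \<le> n" for k i
    using that insert_one_vectors[OF as, of i] cone_group_lists[OF gs, of k "Suc i" "Suc (Suc n)"] by auto
  have 1: "crossed_diff n (prism_map n (rolled_tensor as gs)) = ?c *\<^sub>c (\<Sum>k\<in>carrier \<Gamma>. ?A k)"
  proof -
    have "crossed_diff n (prism_map n (rolled_tensor as gs)) = ?c *\<^sub>c (\<Sum>k\<in>carrier \<Gamma>. crossed_diff n (\<Sum>i\<le>n. (- 1) ^ i *\<^sub>c ?F k i))"
      unfolding prism_map_rolled_tensor[OF as gs] prism_chain_def
      by (rule lin_on_scaled_sum[OF lin_crossed_diff subspace_coords[of B "Suc (Suc n)"]],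
          intro cfun.subspace_sum cfun.subspace_scale subspace_coords rolled_tensor_coords Fv) auto
    also have "(\<Sum>k\<in>carrier \<Gamma>. crossed_diff n (\<Sum>i\<le>n. (- 1) ^ i *\<^sub>c ?F k i)) = (\<Sum>k\<in>carrier \<Gamma>. ?A k)"
    proof (rule sum.cong[OF refl])
      fix k assume k: "k \<in> carrier \<Gamma>"
      have "crossed_diff n (\<Sum>i\<le>n. (- 1) ^ i *\<^sub>c ?F k i) = (\<Sum>i\<le>n. (- 1) ^ i *\<^sub>c crossed_diff n (?F k i))"
        by (rule lin_on_lincomb[OF lin_crossed_diff subspace_coords[of B "Suc (Suc n)"]], intro rolled_tensor_coords Fv[OF k]) auto
      also have "\<dots> = ?A k"
        by (rule sum.cong[OF refl]) (simp only: crossed_diff_rolled_tensor[OF Fv[OF k]] atMost_iff)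
      finally show "crossed_diff n (\<Sum>i\<le>n. (- 1) ^ i *\<^sub>c ?F k i) = ?A k" .
    qed
    finally show ?thesis .
  qed
  \<comment> \<open>In degree 0 the sum over \<open>i < 0\<close> is empty, so that the degenerate face in \<open>?Y\<close> does not occur.\<close>
  have 2: "(case n of 0 \<Rightarrow> 0 | Suc m \<Rightarrow> prism_map m (crossed_diff m (rolled_tensor as gs))) = ?c *\<^sub>c (\<Sum>k\<in>carrier \<Gamma>. ?B k)"
  proof (cases n)
    case 0
    then show ?thesis by simp
  next
    case (Suc m)
    note as' = as[unfolded Suc] and gs' = gs[unfolded Suc]
    have v: "?face n j as \<in> vectors A (Suc m)" "delete_nth j gs \<in> group_lists (Suc m)" if "j \<le> n" for j
      using face_vectors[OF as', of j] delete_group_lists[OF gs', of j] that Suc by auto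
    have "prism_map m (crossed_diff m (rolled_tensor as gs)) = (\<Sum>j\<le>n. (- 1) ^ j *\<^sub>c prism_map m (rolled_tensor (?face n j as) (delete_nth j gs)))"
      unfolding crossed_diff_rolled_tensor[OF as' gs'] Suc[symmetric]
      by (rule lin_on_lincomb[OF lin_prism_map subspace_coords[of B "Suc m"]], intro rolled_tensor_coords v) auto
    also have "\<dots> = (\<Sum>j\<le>n. (- 1) ^ j *\<^sub>c prism_chain m (?face n j as) (delete_nth j gs))"
      by (rule sum.cong[OF refl]) (simp only: prism_map_rolled_tensor[OF v] atMost_iff)
    also have "\<dots> = ?c *\<^sub>c (\<Sum>k\<in>carrier \<Gamma>. ?B k)"
      unfolding prism_chain_def Suc[symmetric] lessThan_Suc_atMost[of m, symmetric]
      by (subst sum.swap) (simp only: fun_eq_iff sum_fun_apply fscale_apply sum_distrib_left mult.left_commute simp_thms)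
    finally show ?thesis using Suc by simp
  qed
  have "?A k + ?B k = rolled_tensor as (replicate (Suc n) k) - rolled_tensor as gs" if k: "k \<in> carrier \<Gamma>" for k
  proof -
    have len: "length gs = Suc n" using group_listsD(1)[OF gs] .
    have "?A k + ?B k = rolled_tensor as (cone (Suc n) 0 k gs) - rolled_tensor as (cone (Suc n) (Suc n) k gs)"
    proof (rule vector_prism[of n "?P k" "?Y k" "\<lambda>i. rolled_tensor as (cone (Suc n) i k gs)"])
      show "?P k i j = ?Y k (i - 1) j" if "j < i" "i \<le> n" for i j
        using face_insert_one(1)[OF as that(2), of j] delete_cone(1)[OF len that(2), of j k] that by simp
      show "?P k i j = ?Y k i (j - 1)" if "Suc i < j" "j \<le> Suc n" for i j
        using face_insert_one(4)[OF as _ that(2), of i] delete_cone(4)[OF len _ that(2), of i k] that by simp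
      show "?P k i i = rolled_tensor as (cone (Suc n) i k gs)" if "i \<le> n" for i
        using face_insert_one(2)[OF as that, of i] delete_cone(2)[OF len that, of i k] that by simp
      show "?P k i (Suc i) = rolled_tensor as (cone (Suc n) (Suc i) k gs)" if "i \<le> n" for i
        using face_insert_one(3)[OF as that, of "Suc i"] delete_cone(3)[OF len that, of "Suc i" k] that by simp
    qed
    then show ?thesis using len by (simp add: cone_def del: replicate_Suc sum.atMost_Suc)
  qed
  then have "(\<Sum>k\<in>carrier \<Gamma>. ?A k) + (\<Sum>k\<in>carrier \<Gamma>. ?B k) =
      (\<Sum>k\<in>carrier \<Gamma>. rolled_tensor as (replicate (Suc n) k)) - (\<Sum>k\<in>carrier \<Gamma>. rolled_tensor as gs)"
    unfolding sum.distrib[symmetric] sum_subtractf[symmetric] by (rule sum.cong[OF refl])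
  then have "?c *\<^sub>c (\<Sum>k\<in>carrier \<Gamma>. ?A k) + ?c *\<^sub>c (\<Sum>k\<in>carrier \<Gamma>. ?B k) =
      ?c *\<^sub>c (\<Sum>k\<in>carrier \<Gamma>. rolled_tensor as (replicate (Suc n) k)) - ?c *\<^sub>c (\<Sum>k\<in>carrier \<Gamma>. rolled_tensor as gs)"
    by (simp only: cfun.scale_right_distrib[symmetric] cfun.scale_right_diff_distrib[symmetric])
  then show ?thesis
    unfolding 1 2 sum_average[OF card_\<Gamma>] constant_chain_def .
qed

lemma cycle_homotopy:
  assumes x: "x \<in> class_coords n" and cyc: "\<And>m. n = Suc m \<Longrightarrow> crossed_diff m x = 0"
  shows "crossed_diff n (prism_map n x) = from_twisted n (to_twisted n x) - x"
proof -
  let ?R = "\<lambda>x. case n of 0 \<Rightarrow> 0 | Suc m \<Rightarrow> prism_map m (crossed_diff m x)"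
  have "crossed_diff n (prism_map n x) + ?R x = from_twisted n (to_twisted n x) + (- 1) *\<^sub>c x"
  proof (rule class_coords_eqI[of n "\<lambda>x. crossed_diff n (prism_map n x) + ?R x" "\<lambda>x. from_twisted n (to_twisted n x) + (- 1) *\<^sub>c x", OF _ _ _ x])
    have "lin_on (class_coords n) ?R"
    proof (cases n)
      case 0
      then show ?thesis by (simp add: lin_on_def)
    next
      case (Suc m)
      have "lin_on (class_coords (Suc m)) (\<lambda>x. prism_map m (crossed_diff m x))"
        by (rule lin_on_comp[OF lin_on_class_coords[OF lin_crossed_diff] _ lin_on_class_coords[OF lin_prism_map]]) (use crossed_diff_class_coords in blast)
      then show ?thesis using Suc by simp
    qed
    moreover have "lin_on (class_coords n) (\<lambda>x. crossed_diff n (prism_map n x))"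
      by (rule lin_on_comp[OF lin_on_class_coords[OF lin_prism_map] _ lin_on_class_coords[OF lin_crossed_diff]]) (use prism_map_class_coords in blast)
    ultimately show "lin_on (class_coords n) (\<lambda>x. crossed_diff n (prism_map n x) + ?R x)" by (intro lin_on_add)
    have "lin_on (class_coords n) (\<lambda>x. from_twisted n (to_twisted n x))"
      by (rule lin_on_comp[OF lin_on_class_coords[OF lin_to_twisted] _ lin_from_twisted]) (use to_twisted_coords in blast)
    moreover have "lin_on (class_coords n) (\<lambda>x. (- 1) *\<^sub>c x)" by (simp add: lin_on_def fun_eq_iff)
    ultimately show "lin_on (class_coords n) (\<lambda>x. from_twisted n (to_twisted n x) + (- 1) *\<^sub>c x)" by (intro lin_on_add)
    fix as gs assume as: "as \<in> vectors A (Suc n)" and gs: "gs \<in> group_lists (Suc n)"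
    show "crossed_diff n (prism_map n (rolled_tensor as gs)) + ?R (rolled_tensor as gs) = from_twisted n (to_twisted n (rolled_tensor as gs)) + (- 1) *\<^sub>c rolled_tensor as gs"
      unfolding homotopy[OF as gs] to_twisted_rolled_tensor[OF as gs] from_twisted_average_chain[OF as] by (simp add: fun_eq_iff)
  qed
  moreover have "?R x = 0"
  proof (cases n)
    case (Suc m)
    have "(0 :: ('g \<Rightarrow> 'a) list \<Rightarrow> complex) \<in> tensor_coords B (Suc n)" by (rule cfun.subspace_0[OF subspace_coords])
    then show ?thesis using cyc[OF Suc] lin_on_zero[OF lin_prism_map, of "Suc n" m] Suc by simp
  qed simp
  ultimately show ?thesis by (simp add: fun_eq_iff)
qed

text \<open>
  The homotopy expresses a cycle as \<open>x = S (G x) - d (H x)\<close>, where \<open>G\<close>, \<open>S\<close> and \<open>H\<close> are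
  \<open>to_twisted\<close>, \<open>from_twisted\<close> and \<open>prism_map\<close>, and \<open>S\<close> commutes with the differentials.
\<close>

lemma boundary_lift:
  assumes x: "x \<in> class_coords n" and cyc: "\<And>m. n = Suc m \<Longrightarrow> crossed_diff m x = 0"
    and y: "y \<in> tensor_coords A (Suc (Suc n))" and xy: "to_twisted n x = twisted_diff n y"
  obtains w where "w \<in> class_coords (Suc n)" "crossed_diff n w = x"
proof
  let ?w = "from_twisted (Suc n) y + (- 1) *\<^sub>c prism_map n x"
  note S = from_twisted_class_coords[OF y] and H = prism_map_class_coords[OF x]
  note H' = cfun.subspace_scale[OF subspace_class_coords H, of "- 1"]
  have hom: "crossed_diff n (prism_map n x) = from_twisted n (to_twisted n x) - x"
    by (rule cycle_homotopy[OF x]) (rule cyc)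
  show "?w \<in> class_coords (Suc n)" by (rule cfun.subspace_add[OF subspace_class_coords S H'])
  have "crossed_diff n ?w = crossed_diff n (from_twisted (Suc n) y) + crossed_diff n ((- 1) *\<^sub>c prism_map n x)"
    by (rule lin_onD(1)[OF lin_on_class_coords[OF lin_crossed_diff] S H'])
  also have "crossed_diff n ((- 1) *\<^sub>c prism_map n x) = (- 1) *\<^sub>c crossed_diff n (prism_map n x)"
    by (rule lin_onD(2)[OF lin_on_class_coords[OF lin_crossed_diff] H])
  also have "crossed_diff n (from_twisted (Suc n) y) + \<dots> = from_twisted n (twisted_diff n y) + (- 1) *\<^sub>c (from_twisted n (to_twisted n x) - x)"
    unfolding crossed_diff_from_twisted[OF y] hom ..
  also have "\<dots> = x" unfolding xy by (simp add: fun_eq_iff)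
  finally show "crossed_diff n ?w = x" .
qed

end

lemma lin_embedding_submodule:
  assumes E: "lin_embedding M \<theta>" and S: "submodule S complex_ring M"
  shows "lin_embedding (M\<lparr>carrier := S\<rparr>) \<theta>"
proof -
  note D = lin_embeddingD[OF E]
  have "S \<subseteq> carrier M" by (rule complex_submoduleD(1)[OF D(1) S])
  then show ?thesis
    unfolding lin_embedding_def using submodule.submodule_is_module[OF S D(1)] D(2-4)
    by (auto intro: inj_on_subset simp: subset_iff)
qed

text \<open>
  Transports a linear map between normal forms to the modules that they represent.
\<close>

lemma linear_map_from_coords:
  assumes E: "lin_embedding M \<theta>" and F: "lin_embedding N \<eta>"
    and L: "lin_on (\<theta> ` carrier M) L" and im: "L ` \<theta> ` carrier M \<subseteq> \<eta> ` carrier N"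
  defines "f \<equiv> \<lambda>T. inv_into (carrier N) \<eta> (L (\<theta> T))"
  shows "f \<in> linear_maps M N" "T \<in> carrier M \<Longrightarrow> \<eta> (f T) = L (\<theta> T)"
proof -
  note D = lin_embeddingD[OF E] and D' = lin_embeddingD[OF F]
  interpret M: module complex_ring M by (rule D(1))
  interpret N: module complex_ring N by (rule D'(1))
  have c: "f T \<in> carrier N" "\<eta> (f T) = L (\<theta> T)" if "T \<in> carrier M" for T
  proof -
    have "L (\<theta> T) \<in> \<eta> ` carrier N" using im that by auto
    then show "f T \<in> carrier N" "\<eta> (f T) = L (\<theta> T)"
      by (auto simp: f_def inv_into_into f_inv_into_f)
  qed
  show "T \<in> carrier M \<Longrightarrow> \<eta> (f T) = L (\<theta> T)" by (rule c(2))
  show "f \<in> linear_maps M N"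
    unfolding linear_maps_def
  proof (intro CollectI conjI ballI allI)
    show "f \<in> carrier M \<rightarrow> carrier N" using c by auto
    fix S assume S: "S \<in> carrier M"
    show "f (S \<oplus>\<^bsub>M\<^esub> T) = f S \<oplus>\<^bsub>N\<^esub> f T" if T: "T \<in> carrier M" for T
    proof (rule D'(5))
      have "\<eta> (f (S \<oplus>\<^bsub>M\<^esub> T)) = L (\<theta> S + \<theta> T)"
        unfolding c(2)[OF M.a_closed[OF S T]] D(3)[OF S T] ..
      also have "\<dots> = L (\<theta> S) + L (\<theta> T)" by (rule lin_onD(1)[OF L]) (use S T in auto)
      finally show "\<eta> (f (S \<oplus>\<^bsub>M\<^esub> T)) = \<eta> (f S \<oplus>\<^bsub>N\<^esub> f T)"
        unfolding D'(3)[OF c(1)[OF S] c(1)[OF T]] c(2)[OF S] c(2)[OF T] .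
    qed (use S T c in auto)
    show "f (r \<odot>\<^bsub>M\<^esub> S) = r \<odot>\<^bsub>N\<^esub> f S" for r
    proof (rule D'(5))
      have rS: "r \<odot>\<^bsub>M\<^esub> S \<in> carrier M" using S by simp
      have "\<eta> (f (r \<odot>\<^bsub>M\<^esub> S)) = L (r *\<^sub>c \<theta> S)"
        unfolding c(2)[OF rS] D(4)[OF S] ..
      also have "\<dots> = r *\<^sub>c L (\<theta> S)" by (rule lin_onD(2)[OF L]) (use S in auto)
      finally show "\<eta> (f (r \<odot>\<^bsub>M\<^esub> S)) = \<eta> (r \<odot>\<^bsub>N\<^esub> f S)"
        unfolding D'(4)[OF c(1)[OF S]] c(2)[OF S] .
    qed (use S c in auto)
  qed
qed

lemma cycles_iff:
  "x \<in> cycles C d n \<longleftrightarrow> x \<in> carrier (C n) \<and> (\<forall>m. n = Suc m \<longrightarrow> d m x = \<zero>\<^bsub>C m\<^esub>)"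
  by (cases n) (auto simp: cycles_def)

context twisted_group_algebra_action
begin

section \<open>Crossed tensors\<close>

text \<open>
  The vertices \<open>g, g h\<^sub>1, g h\<^sub>1 h\<^sub>2, \<dots>\<close> of a tensor with group entries \<open>hs\<close>.
\<close>

definition path :: "'g list \<Rightarrow> 'g \<Rightarrow> 'g list" where
  "path hs g = map (\<lambda>i. g \<otimes> list_product \<Gamma> (take i (tl hs))) [0..<length hs]"

lemma list_product_closed: "set hs \<subseteq> carrier \<Gamma> \<Longrightarrow> list_product \<Gamma> hs \<in> carrier \<Gamma>"
  by (induction hs) (auto simp: list_product_def)

lemma list_product_snoc:
  "set hs \<subseteq> carrier \<Gamma> \<Longrightarrow> g \<in> carrier \<Gamma> \<Longrightarrow> list_product \<Gamma> (hs @ [g]) = list_product \<Gamma> hs \<otimes> g"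
proof (induction hs)
  case (Cons k hs)
  then show ?case using list_product_closed[of hs] by (auto simp: list_product_def \<Gamma>.m_assoc)
qed (auto simp: list_product_def)

lemma list_product_tl_closed:
  assumes "hs \<in> group_lists (Suc n)"
  shows "list_product \<Gamma> (take i (tl hs)) \<in> carrier \<Gamma>"
proof (rule list_product_closed)
  have "set (take i (tl hs)) \<subseteq> set (tl hs)" by (rule set_take_subset)
  also have "set (tl hs) \<subseteq> set hs" by (cases hs) auto
  finally show "set (take i (tl hs)) \<subseteq> carrier \<Gamma>" using assms by (auto simp: group_lists_def)
qed

lemma list_product_take:
  assumes "hs \<in> group_lists (Suc n)" "i < n"
  shows "list_product \<Gamma> (take (Suc i) (tl hs)) = list_product \<Gamma> (take i (tl hs)) \<otimes> hs ! Suc i"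
proof -
  have set: "set (tl hs) \<subseteq> carrier \<Gamma>" and len: "length (tl hs) = n"
    using assms(1) by (cases hs; auto simp: group_lists_def)+
  then have set': "set (take i (tl hs)) \<subseteq> carrier \<Gamma>" by (meson order_trans set_take_subset)
  have "take (Suc i) (tl hs) = take i (tl hs) @ [hs ! Suc i]"
    using assms(2) len by (simp add: take_Suc_conv_app_nth nth_tl)
  then show ?thesis
    using list_product_snoc[OF set'] group_listsD(2)[OF assms(1), of "Suc i"] assms(2) by simp
qed

lemma path_group_lists:
  "hs \<in> group_lists (Suc n) \<Longrightarrow> g \<in> carrier \<Gamma> \<Longrightarrow> path hs g \<in> group_lists (Suc n)"
  by (rule group_listsI)
    (auto simp: path_def group_listsD(1) list_product_tl_closed simp del: upt_Suc)

lemma path_translate: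
  "hs \<in> group_lists (Suc n) \<Longrightarrow> g \<in> carrier \<Gamma> \<Longrightarrow> z \<in> carrier \<Gamma> \<Longrightarrow> path hs (z \<otimes> g) = map ((\<otimes>) z) (path hs g)"
  using list_product_tl_closed by (simp add: path_def \<Gamma>.m_assoc)

lemma transporterD:
  assumes "hs \<in> group_lists (Suc n)" "g \<in> conj_transporter \<Gamma> (cyclic_product \<Gamma> hs) h"
  shows "g \<in> carrier \<Gamma>" "h \<otimes> g = g \<otimes> list_product \<Gamma> (tl hs) \<otimes> hs ! 0"
proof -
  show g: "g \<in> carrier \<Gamma>" using assms(2) by (simp add: conj_transporter_def)
  have c: "list_product \<Gamma> (tl hs) \<in> carrier \<Gamma>" "hs ! 0 \<in> carrier \<Gamma>"
    using list_product_tl_closed[OF assms(1), of "length hs"] group_listsD(2)[OF assms(1), of 0] by auto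
  have hd: "hd hs = hs ! 0" using group_listsD(1)[OF assms(1)] by (cases hs) auto
  have "g \<otimes> (list_product \<Gamma> (tl hs) \<otimes> hs ! 0) \<otimes> inv g = h"
    using assms(2) hd by (simp add: conj_transporter_def cyclic_product_def)
  then have "h \<otimes> g = g \<otimes> (list_product \<Gamma> (tl hs) \<otimes> hs ! 0)"
    using g c h by (metis \<Gamma>.inv_solve_right \<Gamma>.m_closed)
  then show "h \<otimes> g = g \<otimes> list_product \<Gamma> (tl hs) \<otimes> hs ! 0" using g c by (simp add: \<Gamma>.m_assoc)
qed

lemma nth_path: "hs \<in> group_lists (Suc n) \<Longrightarrow> i < Suc n \<Longrightarrow> path hs g ! i = g \<otimes> list_product \<Gamma> (take i (tl hs))"
  by (simp add: path_def group_listsD(1) del: upt_Suc)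

text \<open>
  Behind the last vertex, the equation \<open>h g = g x\<close> closes the cycle up to the twist.
\<close>

lemma source_target_path:
  assumes hs: "hs \<in> group_lists (Suc n)" and g: "g \<in> conj_transporter \<Gamma> (cyclic_product \<Gamma> hs) h"
    and i: "i < Suc n"
  shows "target (path hs g) i = source (path hs g) i \<otimes> hs ! i"
proof (cases i)
  case 0
  have len: "length (path hs g) = Suc n" "length (tl hs) = n" using group_listsD(1)[OF hs] by (auto simp: path_def)
  note t = transporterD[OF hs g]
  have "path hs g ! n = g \<otimes> list_product \<Gamma> (tl hs)" using nth_path[OF hs, of n g] len(2) by simp
  moreover have "path hs g ! 0 = g" using nth_path[OF hs, of 0 g] t(1) by (simp add: list_product_def)
  ultimately show ?thesis using 0 len t by (simp add: source_def target_def)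
next
  case (Suc j)
  have j: "j < n" using i Suc by simp
  note t = transporterD(1)[OF hs g]
  have "path hs g ! Suc j = path hs g ! j \<otimes> hs ! Suc j"
    using nth_path[OF hs, of j g] nth_path[OF hs, of "Suc j" g] j list_product_take[OF hs j] list_product_tl_closed[OF hs, of j] t
      group_listsD(2)[OF hs, of "Suc j"] by (simp add: \<Gamma>.m_assoc)
  then show ?thesis using Suc by (simp add: source_def target_def)
qed

text \<open>
  The entries \<open>a\<^sub>i\<close> that belong to the vertices starting at \<open>g\<close>.
\<close>

definition unrolled_entries :: "'a list \<Rightarrow> 'g list \<Rightarrow> 'g \<Rightarrow> 'a list" where
  "unrolled_entries bs hs g = map (\<lambda>i. \<phi> (source (path hs g) i) (bs ! i)) [0..<length hs]"

lemma unrolled_entries_vectors: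
  assumes "bs \<in> vectors A (Suc n)" "hs \<in> group_lists (Suc n)" "g \<in> carrier \<Gamma>"
  shows "unrolled_entries bs hs g \<in> vectors A (Suc n)"
  by (rule vectorsI)
    (use assms source_target_closed(1)[OF path_group_lists[OF assms(2,3)]] vectorsD(2)[OF assms(1)] group_listsD(1)[OF assms(2)] in
      \<open>auto simp: unrolled_entries_def act_simps simp del: upt_Suc\<close>)

text \<open>
  Every crossed tensor of the component is a rolled one; \<open>class_generators_props\<close> adds the converse.
\<close>

lemma roll_unrolled_entries:
  assumes bs: "bs \<in> vectors A (Suc n)" and hs: "hs \<in> group_lists (Suc n)"
    and g: "g \<in> conj_transporter \<Gamma> (cyclic_product \<Gamma> hs) h"
  shows "roll (unrolled_entries bs hs g) (path hs g) = map2 cmonom bs hs"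
proof (rule nth_equalityI)
  note gc = transporterD(1)[OF hs g]
  have len: "length (path hs g) = Suc n" "length hs = Suc n" "length bs = Suc n"
    using group_listsD(1)[OF hs] vectorsD(1)[OF bs] by (auto simp: path_def)
  then show "length (roll (unrolled_entries bs hs g) (path hs g)) = length (map2 cmonom bs hs)" by simp
  fix i assume "i < length (roll (unrolled_entries bs hs g) (path hs g))"
  then have i: "i < Suc n" using len by simp
  note s = source_target_closed(1)[OF path_group_lists[OF hs gc] i]
  note k = group_listsD(2)[OF hs i] and b = vectorsD(2)[OF bs i]
  have "\<phi> (inv (source (path hs g) i)) (\<phi> (source (path hs g) i) (bs ! i)) = bs ! i"
    using s b by (simp add: act_comp act_one)
  moreover have "inv (source (path hs g) i) \<otimes> (source (path hs g) i \<otimes> hs ! i) = hs ! i"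
    using s k by (simp add: \<Gamma>.m_assoc[symmetric])
  ultimately show "roll (unrolled_entries bs hs g) (path hs g) ! i = map2 cmonom bs hs ! i"
    using i len by (simp add: nth_roll unrolled_entries_def source_target_path[OF hs g i] del: upt_Suc)
qed

lemma unrolled_entries_translate:
  assumes bs: "bs \<in> vectors A (Suc n)" and hs: "hs \<in> group_lists (Suc n)" and g: "g \<in> carrier \<Gamma>" and z: "z \<in> Z"
  shows "unrolled_entries bs hs (z \<otimes> g) = map (\<phi> z) (unrolled_entries bs hs g)"
proof -
  note zc = centralizerD(1)[OF z]
  have "\<phi> (source (path hs (z \<otimes> g)) i) (bs ! i) = \<phi> z (\<phi> (source (path hs g) i) (bs ! i))" if i: "i < length hs" for i
  proof -
    have i': "i < Suc n" using i group_listsD(1)[OF hs] by simp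
    show ?thesis
      unfolding path_translate[OF hs g zc] source_target_translate(1)[OF path_group_lists[OF hs g] i' z]
      using act_comp[OF zc source_target_closed(1)[OF path_group_lists[OF hs g] i'] vectorsD(2)[OF bs i']] by simp
  qed
  then show ?thesis by (simp add: unrolled_entries_def)
qed

text \<open>
  The product \<open>h\<^sub>1 \<cdots> h\<^sub>n\<close> telescopes to \<open>g\<^sub>0\<inverse> g\<^sub>n\<close>, and \<open>h\<^sub>0 = g\<^sub>n\<inverse> h g\<^sub>0\<close>.
\<close>

lemma cyclic_product_roll:
  assumes gs: "gs \<in> group_lists (Suc n)"
  shows "cyclic_product \<Gamma> (map (\<lambda>i. inv (source gs i) \<otimes> target gs i) [0..<Suc n]) = inv (gs ! 0) \<otimes> h \<otimes> gs ! 0"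
proof -
  let ?hs = "map (\<lambda>i. inv (source gs i) \<otimes> target gs i) [0..<Suc n]"
  note g = group_listsD[OF gs]
  have hs: "?hs \<in> group_lists (Suc n)"
    by (rule group_listsI) (use source_target_closed[OF gs] in \<open>auto simp del: upt_Suc\<close>)
  have "list_product \<Gamma> (take i (tl ?hs)) = inv (gs ! 0) \<otimes> gs ! i" if "i \<le> n" for i
    using that
  proof (induction i)
    case 0
    then show ?case using g(2)[of 0] by (simp add: list_product_def)
  next
    case (Suc i)
    have c: "gs ! 0 \<in> carrier \<Gamma>" "gs ! i \<in> carrier \<Gamma>" "gs ! Suc i \<in> carrier \<Gamma>" using g(2) Suc.prems by auto
    have "?hs ! Suc i = inv (gs ! i) \<otimes> gs ! Suc i"
      using Suc.prems by (simp add: source_def target_def del: upt_Suc)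
    then have "list_product \<Gamma> (take (Suc i) (tl ?hs)) = inv (gs ! 0) \<otimes> gs ! i \<otimes> (inv (gs ! i) \<otimes> gs ! Suc i)"
      using list_product_take[OF hs, of i] Suc by simp
    also have "\<dots> = inv (gs ! 0) \<otimes> gs ! Suc i"
      using c by (simp add: \<Gamma>.m_assoc) (simp add: \<Gamma>.m_assoc[symmetric])
    finally show ?case .
  qed
  from this[of n] have "list_product \<Gamma> (tl ?hs) = inv (gs ! 0) \<otimes> gs ! n" by simp
  moreover have "hd ?hs = inv (gs ! n) \<otimes> (h \<otimes> gs ! 0)"
    using g(1) by (simp add: upt_conv_Cons source_def target_def del: upt_Suc)
  moreover have c: "gs ! 0 \<in> carrier \<Gamma>" "gs ! n \<in> carrier \<Gamma>" using g(2) by auto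
  ultimately show ?thesis
    unfolding cyclic_product_def using h by (simp add: \<Gamma>.m_assoc del: upt_Suc) (simp add: \<Gamma>.m_assoc[symmetric])
qed

lemma transporter_nonempty:
  assumes "x \<in> conj_class \<Gamma> h" obtains t where "t \<in> conj_transporter \<Gamma> x h"
proof -
  obtain g where g: "g \<in> carrier \<Gamma>" "x = g \<otimes> h \<otimes> inv g" using assms by (auto simp: conj_class_def)
  have "inv g \<otimes> x \<otimes> inv (inv g) = h"
    unfolding g(2) using g(1) h by (simp add: \<Gamma>.m_assoc) (simp add: \<Gamma>.m_assoc[symmetric])
  then have "inv g \<in> conj_transporter \<Gamma> x h" using g by (simp add: conj_transporter_def)
  then show ?thesis by (rule that)
qed

definition class_generators :: "nat \<Rightarrow> (('g \<Rightarrow> 'a) list \<Rightarrow> complex) set set" where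
  "class_generators n = {crossed_tensor \<Gamma> A \<phi> bs hs | bs hs.
     length bs = Suc n \<and> length hs = Suc n \<and>
     set bs \<subseteq> carrier A \<and> set hs \<subseteq> carrier \<Gamma> \<and> cyclic_product \<Gamma> hs \<in> conj_class \<Gamma> h}"

abbreviation "HB n \<equiv> hochschild_chains B n"
abbreviation "HA n \<equiv> hochschild_chains A n"
abbreviation "coordB n \<equiv> tensor_coord B (Suc n)"
abbreviation "coordA n \<equiv> tensor_coord A (Suc n)"

lemma embed_B: "lin_embedding (HB n) (coordB n)"
  unfolding hochschild_chains_def by (rule tensor_coord_embedding[OF module_crossed])

lemma embed_A: "lin_embedding (HA n) (coordA n)"
  unfolding hochschild_chains_def by (rule tensor_coord_embedding[OF module_A])

lemma coordA_image: "coordA n ` carrier (HA n) = tensor_coords A (Suc n)"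
  unfolding hochschild_chains_def by (rule tensor_coord_facts(1)[OF module_A])

lemma crossed_tensor_roll:
  assumes "bs \<in> vectors A (Suc n)" "hs \<in> group_lists (Suc n)"
    "g \<in> conj_transporter \<Gamma> (cyclic_product \<Gamma> hs) h"
  shows "crossed_tensor \<Gamma> A \<phi> bs hs \<in> carrier (HB n)"
    "coordB n (crossed_tensor \<Gamma> A \<phi> bs hs) = rolled_tensor (unrolled_entries bs hs g) (path hs g)"
proof -
  have e: "crossed_tensor \<Gamma> A \<phi> bs hs = tensor B (roll (unrolled_entries bs hs g) (path hs g))"
    unfolding crossed_tensor_def roll_unrolled_entries[OF assms] ..
  note gc = transporterD(1)[OF assms(2,3)]
  have v: "roll (unrolled_entries bs hs g) (path hs g) \<in> vectors B (Suc n)"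
    by (intro roll_vectors unrolled_entries_vectors path_group_lists assms gc)
  show "crossed_tensor \<Gamma> A \<phi> bs hs \<in> carrier (HB n)"
    unfolding e hochschild_chains_def by (rule tensor_carrier[OF module_crossed v])
  show "coordB n (crossed_tensor \<Gamma> A \<phi> bs hs) = rolled_tensor (unrolled_entries bs hs g) (path hs g)"
    unfolding e rolled_tensor_def by (rule tensor_coord_tensor[OF module_crossed v])
qed

lemma class_generators_props:
  "class_generators n \<subseteq> carrier (HB n)"
  "coordB n ` class_generators n = rolled_tensors n"
proof -
  have 1: "T \<in> carrier (HB n) \<and> (\<exists>as gs. coordB n T = rolled_tensor as gs \<and> as \<in> vectors A (Suc n) \<and> gs \<in> group_lists (Suc n))"
    if T: "T \<in> class_generators n" for T
  proof -
    obtain bs hs where *: "T = crossed_tensor \<Gamma> A \<phi> bs hs" "bs \<in> vectors A (Suc n)" "hs \<in> group_lists (Suc n)"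
      and c: "cyclic_product \<Gamma> hs \<in> conj_class \<Gamma> h"
      using T by (auto simp: class_generators_def vectors_def group_lists_def)
    obtain t where t: "t \<in> conj_transporter \<Gamma> (cyclic_product \<Gamma> hs) h" by (rule transporter_nonempty[OF c])
    note tc = transporterD(1)[OF *(3) t]
    show ?thesis
      unfolding *(1)
      by (intro conjI exI[of _ "unrolled_entries bs hs t"] exI[of _ "path hs t"] crossed_tensor_roll[OF *(2,3) t] unrolled_entries_vectors path_group_lists *(2,3) tc)
  qed
  show "class_generators n \<subseteq> carrier (HB n)"
    by (rule subsetI, rule conjunct1[OF 1])
  show "coordB n ` class_generators n = rolled_tensors n"
  proof
    show "coordB n ` class_generators n \<subseteq> rolled_tensors n"
    proof
      fix x assume "x \<in> coordB n ` class_generators n"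
      then obtain T where T: "T \<in> class_generators n" "x = coordB n T" by (rule imageE)
      show "x \<in> rolled_tensors n"
        using 1[OF T(1)] unfolding T(2) by blast
    qed
    show "rolled_tensors n \<subseteq> coordB n ` class_generators n"
    proof
      fix x assume "x \<in> rolled_tensors n"
      then obtain as gs where x: "x = rolled_tensor as gs" and as: "as \<in> vectors A (Suc n)" and gs: "gs \<in> group_lists (Suc n)"
        by blast
      note a = vectorsD[OF as] and g = group_listsD[OF gs] and st = source_target_closed[OF gs]
      let ?bs = "map (\<lambda>i. \<phi> (inv (source gs i)) (as ! i)) [0..<Suc n]"
      let ?hs = "map (\<lambda>i. inv (source gs i) \<otimes> target gs i) [0..<Suc n]"
      have r: "map2 cmonom ?bs ?hs = roll as gs"
        by (rule nth_equalityI) (use g in \<open>auto simp: nth_roll simp del: upt_Suc\<close>)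
      have bs: "set ?bs \<subseteq> carrier A" using st a by (auto simp: act_simps simp del: upt_Suc)
      have hs: "set ?hs \<subseteq> carrier \<Gamma>" using st by (auto simp del: upt_Suc)
      have "cyclic_product \<Gamma> ?hs = inv (gs ! 0) \<otimes> h \<otimes> inv (inv (gs ! 0))"
        using cyclic_product_roll[OF gs] g(2)[of 0] by simp
      then have "cyclic_product \<Gamma> ?hs \<in> conj_class \<Gamma> h"
        using g(2)[of 0] unfolding conj_class_def by blast
      moreover have "length ?bs = Suc n" "length ?hs = Suc n" by simp_all
      ultimately have "crossed_tensor \<Gamma> A \<phi> ?bs ?hs \<in> class_generators n"
        unfolding class_generators_def using bs hs by blast
      moreover have "coordB n (crossed_tensor \<Gamma> A \<phi> ?bs ?hs) = rolled_tensor as gs"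
        unfolding crossed_tensor_def r rolled_tensor_def
        by (rule tensor_coord_tensor[OF module_crossed roll_vectors[OF as gs]])
      ultimately show "x \<in> coordB n ` class_generators n" unfolding x by (intro image_eqI[OF sym])
    qed
  qed
qed

abbreviation "classC n \<equiv> class_chains \<Gamma> A \<phi> (conj_class \<Gamma> h) n"
abbreviation "invC n \<equiv> invariant_chains A \<phi> Z n"

lemma class_chains_eq: "classC n = HB n\<lparr>carrier := linear_span (HB n) (class_generators n)\<rparr>"
  by (simp add: class_chains_def class_generators_def Let_def)

lemma classC_eq: "classC n = HB n\<lparr>carrier := carrier (classC n)\<rparr>"
  by (simp add: class_chains_eq)

lemma class_span_submodule: "submodule (linear_span (HB n) (class_generators n)) complex_ring (HB n)"
  by (rule linear_span_submodule[OF lin_embeddingD(1)[OF embed_B] class_generators_props(1)])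

lemma embed_classC: "lin_embedding (classC n) (coordB n)"
  unfolding class_chains_eq by (rule lin_embedding_submodule[OF embed_B class_span_submodule])

lemma classC_image: "coordB n ` carrier (classC n) = class_coords n"
proof -
  have "carrier (classC n) = linear_span (HB n) (class_generators n)" by (simp add: class_chains_eq)
  then show ?thesis
    using lin_embedding_span[OF embed_B class_generators_props(1), of n]
    unfolding class_coords_def class_generators_props(2) by simp
qed

lemma classC_carrier: "T \<in> carrier (classC n) \<longleftrightarrow> T \<in> carrier (HB n) \<and> coordB n T \<in> class_coords n"
proof
  have sub: "carrier (classC n) \<subseteq> carrier (HB n)"
    using complex_submoduleD(1)[OF lin_embeddingD(1)[OF embed_B] class_span_submodule]
    by (simp add: class_chains_eq)
  show "T \<in> carrier (HB n) \<and> coordB n T \<in> class_coords n" if "T \<in> carrier (classC n)"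
    using that sub classC_image[of n] by blast
  assume T: "T \<in> carrier (HB n) \<and> coordB n T \<in> class_coords n"
  then obtain S where S: "S \<in> carrier (classC n)" "coordB n T = coordB n S" using classC_image[of n] by blast
  have "T = S" by (rule lin_embeddingD(5)[OF embed_B]) (use T S sub in auto)
  then show "T \<in> carrier (classC n)" using S by simp
qed

text \<open>
  In coordinates the diagonal action is the linear extension of the entrywise action.
\<close>

lemma diagonal_action_coord:
  assumes g: "g \<in> carrier \<Gamma>" and T: "T \<in> carrier (HA n)"
  shows "diagonal_action A \<phi> n g T \<in> carrier (HA n)"
    "coordA n (diagonal_action A \<phi> n g T) = act_map g (coordA n T)"
proof -
  have 1: "tensor A (map (\<phi> g) as) \<in> carrier (HA n)" if "as \<in> vectors A (Suc n)" for as
    unfolding hochschild_chains_def by (rule tensor_carrier[OF module_A map_act_vectors[OF g that]])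
  have 2: "coordA n (tensor A (map (\<phi> g) as)) = tensor_vec A (map (\<phi> g) as)" if "as \<in> vectors A (Suc n)" for as
    by (rule tensor_coord_tensor[OF module_A map_act_vectors[OF g that]])
  note L = tensor_lift_facts[OF module_A embed_A 1 2 multilinear_act[OF g]]
  have T': "T \<in> carrier (tensor_power A (Suc n))" using T by (simp add: hochschild_chains_def)
  show "diagonal_action A \<phi> n g T \<in> carrier (HA n)"
    "coordA n (diagonal_action A \<phi> n g T) = act_map g (coordA n T)"
    unfolding diagonal_action_def act_map_def using L(1,2)[OF _ _ T'] by simp_all
qed

lemma invC_carrier: "T \<in> carrier (invC n) \<longleftrightarrow> T \<in> carrier (HA n) \<and> (\<forall>z\<in>Z. act_map z (coordA n T) = coordA n T)"
proof -
  have "diagonal_action A \<phi> n z T = T \<longleftrightarrow> act_map z (coordA n T) = coordA n T"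
    if T: "T \<in> carrier (HA n)" and z: "z \<in> Z" for z
  proof -
    note d = diagonal_action_coord[OF centralizerD(1)[OF z] T]
    show ?thesis
    proof
      show "act_map z (coordA n T) = coordA n T" if "diagonal_action A \<phi> n z T = T"
        using d(2) unfolding that by (rule sym)
      show "diagonal_action A \<phi> n z T = T" if e: "act_map z (coordA n T) = coordA n T"
        by (rule lin_embeddingD(5)[OF embed_A d(1) T]) (simp only: d(2) e)
    qed
  qed
  then have "(\<forall>z\<in>Z. diagonal_action A \<phi> n z T = T) \<longleftrightarrow> (\<forall>z\<in>Z. act_map z (coordA n T) = coordA n T)"
    if "T \<in> carrier (HA n)" using that by blast
  moreover have "T \<in> carrier (invC n) \<longleftrightarrow> T \<in> carrier (HA n) \<and> (\<forall>z\<in>Z. diagonal_action A \<phi> n z T = T)"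
    by (simp add: invariant_chains_def Let_def)
  ultimately show ?thesis by blast
qed

lemma invC_eq: "invC n = HA n\<lparr>carrier := carrier (invC n)\<rparr>"
  by (simp add: invariant_chains_def Let_def)

lemma embed_invC: "lin_embedding (invC n) (coordA n)"
proof -
  note D = lin_embeddingD[OF embed_A[of n]]
  interpret HA: module complex_ring "HA n" by (rule D(1))
  have im: "coordA n T \<in> tensor_coords A (Suc n)" if "T \<in> carrier (HA n)" for T
    using coordA_image that by blast
  note L = lin_onD[OF lin_act_map]
  have "submodule (carrier (invC n)) complex_ring (HA n)"
  proof (rule complex_submoduleI[OF D(1)])
    show "carrier (invC n) \<subseteq> carrier (HA n)" by (auto simp: invC_carrier)
    have "act_map z 0 = 0" for z
      using lin_on_zero[OF lin_act_map cfun.subspace_0[OF subspace_coords[of A "Suc n"]]] .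
    then show "\<zero>\<^bsub>HA n\<^esub> \<in> carrier (invC n)" by (simp add: invC_carrier D(6))
    show "S \<oplus>\<^bsub>HA n\<^esub> T \<in> carrier (invC n)" if "S \<in> carrier (invC n)" "T \<in> carrier (invC n)" for S T
    proof -
      have ST: "S \<in> carrier (HA n)" "T \<in> carrier (HA n)" using that by (auto simp: invC_carrier)
      have "act_map z (coordA n S + coordA n T) = act_map z (coordA n S) + act_map z (coordA n T)" for z
        by (rule L(1)[OF im[OF ST(1)] im[OF ST(2)]])
      then show ?thesis using that ST by (simp add: invC_carrier D(3))
    qed
    show "c \<odot>\<^bsub>HA n\<^esub> T \<in> carrier (invC n)" if "T \<in> carrier (invC n)" for c T
    proof -
      have T: "T \<in> carrier (HA n)" using that by (auto simp: invC_carrier)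
      have "act_map z (c *\<^sub>c coordA n T) = c *\<^sub>c act_map z (coordA n T)" for z
        by (rule L(2)[OF im[OF T]])
      then show ?thesis using that T by (simp add: invC_carrier D(4))
    qed
  qed
  then show ?thesis by (subst invC_eq) (rule lin_embedding_submodule[OF embed_A])
qed

abbreviation "diffB \<equiv> hochschild_diff B (\<lambda>u. u)"
abbreviation "diffA \<equiv> hochschild_diff A (\<phi> h)"

lemma diffB_coord:
  "diffB n \<in> linear_maps (HB (Suc n)) (HB n)"
  "T \<in> carrier (HB (Suc n)) \<Longrightarrow> coordB n (diffB n T) = crossed_diff n (coordB (Suc n) T)"
  unfolding crossed_diff_def using hochschild_diff_facts[OF bilinear_crossed linear_maps_id] by auto

lemma diffA_coord:
  "diffA n \<in> linear_maps (HA (Suc n)) (HA n)"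
  "T \<in> carrier (HA (Suc n)) \<Longrightarrow> coordA n (diffA n T) = twisted_diff n (coordA (Suc n) T)"
  unfolding twisted_diff_def using hochschild_diff_facts[OF bilinear_A act_linear[OF h]] by auto

lemma linear_maps_restrict:
  "f \<in> linear_maps M N \<Longrightarrow> S \<subseteq> carrier M \<Longrightarrow> f ` S \<subseteq> T \<Longrightarrow> f \<in> linear_maps (M\<lparr>carrier := S\<rparr>) (N\<lparr>carrier := T\<rparr>)"
  by (auto simp: linear_maps_def subset_iff)

lemma diffB_classC: "T \<in> carrier (classC (Suc n)) \<Longrightarrow> diffB n T \<in> carrier (classC n)"
  using linear_maps_facts(1)[OF diffB_coord(1) lin_embeddingD(1)[OF embed_B] lin_embeddingD(1)[OF embed_B]]
  by (simp add: classC_carrier diffB_coord(2) crossed_diff_class_coords)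

lemma act_map_twisted_diff:
  assumes z: "z \<in> Z" and y: "y \<in> tensor_coords A (Suc (Suc n))"
  shows "act_map z (twisted_diff n y) = twisted_diff n (act_map z y)"
proof (rule coords_eqI[of "Suc (Suc n)" "\<lambda>y. act_map z (twisted_diff n y)" "\<lambda>y. twisted_diff n (act_map z y)", OF _ _ _ y])
  note zc = centralizerD(1)[OF z]
  show "lin_on (tensor_coords A (Suc (Suc n))) (\<lambda>y. act_map z (twisted_diff n y))"
    by (rule lin_on_comp[OF lin_twisted_diff _ lin_act_map]) (use twisted_diff_coords in blast)
  show "lin_on (tensor_coords A (Suc (Suc n))) (\<lambda>y. twisted_diff n (act_map z y))"
    by (rule lin_on_comp[OF lin_act_map _ lin_twisted_diff]) (use act_map_coords[OF zc] in blast)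
  fix as assume as: "as \<in> vectors A (Suc (Suc n))"
  have "act_map z (twisted_diff n (tensor_vec A as)) = (\<Sum>i\<le>Suc n. (- 1) ^ i *\<^sub>c act_map z (tensor_vec A (twisted_face (Suc n) i as)))"
    unfolding twisted_diff_tensor_vec[OF as]
    by (rule lin_on_lincomb[OF lin_act_map subspace_coords[of A "Suc n"]], intro tensor_vec_coords face_vectors as) auto
  also have "\<dots> = (\<Sum>i\<le>Suc n. (- 1) ^ i *\<^sub>c tensor_vec A (twisted_face (Suc n) i (map (\<phi> z) as)))"
    by (rule sum.cong[OF refl]) (simp add: act_map_tensor_vec[OF zc face_vectors[OF as]] face_map[OF as _ z])
  also have "\<dots> = twisted_diff n (act_map z (tensor_vec A as))"
    unfolding act_map_tensor_vec[OF zc as] twisted_diff_tensor_vec[OF map_act_vectors[OF zc as]] ..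
  finally show "act_map z (twisted_diff n (tensor_vec A as)) = twisted_diff n (act_map z (tensor_vec A as))" .
qed

lemma diffA_invC: "T \<in> carrier (invC (Suc n)) \<Longrightarrow> diffA n T \<in> carrier (invC n)"
proof -
  assume T: "T \<in> carrier (invC (Suc n))"
  then have T': "T \<in> carrier (HA (Suc n))" "coordA (Suc n) T \<in> tensor_coords A (Suc (Suc n))"
    using coordA_image[of "Suc n"] by (auto simp: invC_carrier)
  show ?thesis
    using T T' linear_maps_facts(1)[OF diffA_coord(1) lin_embeddingD(1)[OF embed_A] lin_embeddingD(1)[OF embed_A] T'(1)]
    by (simp add: invC_carrier diffA_coord(2) act_map_twisted_diff)
qed

lemma chain_complex_classC: "chain_complex classC diffB"
  unfolding chain_complex_def
proof (intro conjI allI ballI)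
  show "module complex_ring (classC n)" for n by (rule lin_embeddingD(1)[OF embed_classC])
  show "diffB n \<in> linear_maps (classC (Suc n)) (classC n)" for n
  proof -
    have "diffB n \<in> linear_maps (HB (Suc n)\<lparr>carrier := carrier (classC (Suc n))\<rparr>) (HB n\<lparr>carrier := carrier (classC n)\<rparr>)"
      by (rule linear_maps_restrict[OF diffB_coord(1)]) (use diffB_classC in \<open>auto simp: classC_carrier[of _ "Suc n"]\<close>)
    then show ?thesis by (simp only: classC_eq[symmetric])
  qed
  fix n T assume T: "T \<in> carrier (classC (Suc (Suc n)))"
  have c: "diffB (Suc n) T \<in> carrier (classC (Suc n))" "diffB n (diffB (Suc n) T) \<in> carrier (classC n)"
    using diffB_classC T by auto
  interpret classC: module complex_ring "classC n" by (rule lin_embeddingD(1)[OF embed_classC])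
  show "diffB n (diffB (Suc n) T) = \<zero>\<^bsub>classC n\<^esub>"
  proof (rule lin_embeddingD(5)[OF embed_classC c(2) classC.zero_closed])
    show "coordB n (diffB n (diffB (Suc n) T)) = coordB n \<zero>\<^bsub>classC n\<^esub>"
      using c(1) T crossed_diff_crossed_diff by (simp add: classC_carrier diffB_coord(2) lin_embeddingD(6)[OF embed_classC])
  qed
qed

lemma chain_complex_invC: "chain_complex invC diffA"
  unfolding chain_complex_def
proof (intro conjI allI ballI)
  show "module complex_ring (invC n)" for n by (rule lin_embeddingD(1)[OF embed_invC])
  show "diffA n \<in> linear_maps (invC (Suc n)) (invC n)" for n
  proof -
    have "diffA n \<in> linear_maps (HA (Suc n)\<lparr>carrier := carrier (invC (Suc n))\<rparr>) (HA n\<lparr>carrier := carrier (invC n)\<rparr>)"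
      by (rule linear_maps_restrict[OF diffA_coord(1)]) (use diffA_invC in \<open>auto simp: invC_carrier[of _ "Suc n"]\<close>)
    then show ?thesis by (simp only: invC_eq[symmetric])
  qed
  fix n T assume T: "T \<in> carrier (invC (Suc (Suc n)))"
  have c: "diffA (Suc n) T \<in> carrier (invC (Suc n))" "diffA n (diffA (Suc n) T) \<in> carrier (invC n)"
    using diffA_invC T by auto
  have t: "coordA (Suc (Suc n)) T \<in> tensor_coords A (Suc (Suc (Suc n)))"
    using T coordA_image[of "Suc (Suc n)"] by (auto simp: invC_carrier)
  interpret invC: module complex_ring "invC n" by (rule lin_embeddingD(1)[OF embed_invC])
  show "diffA n (diffA (Suc n) T) = \<zero>\<^bsub>invC n\<^esub>"
  proof (rule lin_embeddingD(5)[OF embed_invC c(2) invC.zero_closed])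
    show "coordA n (diffA n (diffA (Suc n) T)) = coordA n \<zero>\<^bsub>invC n\<^esub>"
      using c(1) T twisted_diff_twisted_diff[OF t] by (simp add: invC_carrier diffA_coord(2) lin_embeddingD(6)[OF embed_invC])
  qed
qed

text \<open>
  The invariant chain with the prescribed normal form; it exists and is unique by
  \<open>invC_preimage\<close>, \<open>act_map_to_twisted\<close> and the injectivity of normal forms.
\<close>

definition comparison_map :: "nat \<Rightarrow> (('g \<Rightarrow> 'a) list \<Rightarrow> complex) set \<Rightarrow> ('a list \<Rightarrow> complex) set" where
  "comparison_map n T = inv_into (carrier (invC n)) (coordA n) (to_twisted n (coordB n T))"

lemma classC_preimage:
  assumes "x \<in> class_coords n"
  obtains T where "T \<in> carrier (classC n)" "coordB n T = x"
proof -
  have "x \<in> coordB n ` carrier (classC n)" using assms by (simp only: classC_image)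
  then show ?thesis by (rule imageE) (rule that, simp_all)
qed

lemma invC_preimage:
  assumes "y \<in> tensor_coords A (Suc n)" "\<And>z. z \<in> Z \<Longrightarrow> act_map z y = y"
  obtains T where "T \<in> carrier (invC n)" "coordA n T = y"
proof -
  obtain T where "T \<in> carrier (HA n)" "coordA n T = y" using assms(1) unfolding coordA_image[symmetric] by blast
  then show ?thesis using assms(2) that[of T] by (simp add: invC_carrier)
qed

lemma comparison_map_facts:
  "comparison_map n \<in> linear_maps (classC n) (invC n)"
  "T \<in> carrier (classC n) \<Longrightarrow> coordA n (comparison_map n T) = to_twisted n (coordB n T)"
proof -
  have im: "to_twisted n ` coordB n ` carrier (classC n) \<subseteq> coordA n ` carrier (invC n)"
    unfolding classC_image
  proof
    fix y assume "y \<in> to_twisted n ` class_coords n"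
    then obtain x where x: "x \<in> class_coords n" "y = to_twisted n x" by blast
    obtain T where "T \<in> carrier (invC n)" "coordA n T = y"
      by (rule invC_preimage[of y n]) (use x to_twisted_coords act_map_to_twisted in auto)
    then show "y \<in> coordA n ` carrier (invC n)" by blast
  qed
  note L = linear_map_from_coords[OF embed_classC embed_invC lin_on_class_coords[OF lin_to_twisted, folded classC_image] im, folded comparison_map_def[abs_def]]
  show "comparison_map n \<in> linear_maps (classC n) (invC n)" "T \<in> carrier (classC n) \<Longrightarrow> coordA n (comparison_map n T) = to_twisted n (coordB n T)"
    using L by (simp_all add: comparison_map_def[abs_def])
qed

lemma quasi_isomorphism_comparison: "quasi_isomorphism classC diffB invC diffA comparison_map"
proof (rule quasi_isomorphismI)
  note M = lin_embeddingD(1)[OF embed_classC] lin_embeddingD(1)[OF embed_invC]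
  have Gc: "comparison_map n T \<in> carrier (invC n)" if "T \<in> carrier (classC n)" for n T
    by (rule linear_maps_facts(1)[OF comparison_map_facts(1) M that])
  have HB: "T \<in> carrier (HB n)" "coordB n T \<in> class_coords n" if "T \<in> carrier (classC n)" for n T
    using that by (auto simp: classC_carrier)
  have HA: "T \<in> carrier (HA n)" "coordA n T \<in> tensor_coords A (Suc n)"
    "z \<in> Z \<Longrightarrow> act_map z (coordA n T) = coordA n T" if "T \<in> carrier (invC n)" for n T z
    using that coordA_image by (auto simp: invC_carrier)
  show "chain_map classC diffB invC diffA comparison_map"
    unfolding chain_map_def
  proof (intro conjI allI ballI chain_complex_classC chain_complex_invC comparison_map_facts(1))
    fix n T assume T: "T \<in> carrier (classC (Suc n))"
    show "comparison_map n (diffB n T) = diffA n (comparison_map (Suc n) T)"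
    proof (rule lin_embeddingD(5)[OF embed_invC])
      show "coordA n (comparison_map n (diffB n T)) = coordA n (diffA n (comparison_map (Suc n) T))"
        using comparison_map_facts(2)[OF diffB_classC[OF T]] comparison_map_facts(2)[OF T] diffA_coord(2)[OF HA(1)[OF Gc[OF T]]]
          diffB_coord(2)[OF HB(1)[OF T]] to_twisted_crossed_diff[OF HB(2)[OF T]] by simp
    qed (use Gc diffB_classC diffA_invC T in auto)
  qed
  fix n
  show "\<exists>T\<in>cycles classC diffB n. comparison_map n T = U" if U: "U \<in> cycles invC diffA n" for U
  proof -
    have Uc: "U \<in> carrier (invC n)" using U by (simp add: cycles_iff)
    have "from_twisted n (coordA n U) \<in> class_coords n" by (rule from_twisted_class_coords[OF HA(2)[OF Uc]])
    then obtain T where T: "T \<in> carrier (classC n)" "coordB n T = from_twisted n (coordA n U)" by (rule classC_preimage)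
    have "diffB m T = \<zero>\<^bsub>classC m\<^esub>" if n: "n = Suc m" for m
    proof -
      have T': "T \<in> carrier (classC (Suc m))" using T(1) unfolding n .
      have U': "U \<in> carrier (invC (Suc m))" using Uc unfolding n .
      have z: "diffA m U = \<zero>\<^bsub>invC m\<^esub>" using U n unfolding cycles_iff by blast
      interpret classC: module complex_ring "classC m" by (rule M(1))
      have "coordA m (diffA m U) = 0" unfolding z by (rule lin_embeddingD(6)[OF embed_invC])
      then have "twisted_diff m (coordA n U) = 0" using diffA_coord(2)[OF HA(1)[OF U']] n by simp
      then have "crossed_diff m (coordB n T) = from_twisted m 0" using crossed_diff_from_twisted[OF HA(2)[OF U']] T(2) n by simp
      also have "\<dots> = 0" by (rule lin_on_zero[OF lin_from_twisted cfun.subspace_0[OF subspace_coords[of A "Suc m"]]])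
      finally have "coordB m (diffB m T) = 0" using diffB_coord(2)[OF HB(1)[OF T']] n by simp
      then show ?thesis
        using lin_embeddingD(5)[OF embed_classC diffB_classC[OF T'] classC.zero_closed] lin_embeddingD(6)[OF embed_classC] by simp
    qed
    moreover have "comparison_map n T = U"
    proof (rule lin_embeddingD(5)[OF embed_invC Gc[OF T(1)] Uc])
      show "coordA n (comparison_map n T) = coordA n U"
        using comparison_map_facts(2)[OF T(1)] T(2) to_twisted_from_twisted[OF HA(2)[OF Uc] HA(3)[OF Uc]] by simp
    qed
    ultimately show ?thesis using T(1) by (auto simp: cycles_iff)
  qed
  show "T \<in> boundaries classC diffB n" if T: "T \<in> cycles classC diffB n" and GT: "comparison_map n T \<in> boundaries invC diffA n" for T
  proof -
    have Tc: "T \<in> carrier (classC n)" using T by (simp add: cycles_iff)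
    obtain U where U: "U \<in> carrier (invC (Suc n))" "comparison_map n T = diffA n U" using GT by (auto simp: boundaries_def)
    have cyc: "crossed_diff m (coordB n T) = 0" if n: "n = Suc m" for m
    proof -
      have z: "diffB m T = \<zero>\<^bsub>classC m\<^esub>" using T n by (simp add: cycles_iff)
      have "coordB m (diffB m T) = 0" unfolding z by (rule lin_embeddingD(6)[OF embed_classC])
      then show ?thesis using diffB_coord(2)[of T m] HB(1)[OF Tc] n by simp
    qed
    have "to_twisted n (coordB n T) = twisted_diff n (coordA (Suc n) U)"
      using comparison_map_facts(2)[OF Tc] U(2) diffA_coord(2)[OF HA(1)[OF U(1)]] by simp
    then obtain w where w: "w \<in> class_coords (Suc n)" "crossed_diff n w = coordB n T"
      using boundary_lift[OF HB(2)[OF Tc] cyc HA(2)[OF U(1)]] by blast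
    obtain W where W: "W \<in> carrier (classC (Suc n))" "coordB (Suc n) W = w" by (rule classC_preimage[OF w(1)])
    have "T = diffB n W"
      by (rule lin_embeddingD(5)[OF embed_classC Tc diffB_classC[OF W(1)]])
        (use diffB_coord(2)[OF HB(1)[OF W(1)]] W(2) w(2) in simp)
    then show ?thesis using W(1) by (auto simp: boundaries_def)
  qed
qed

text \<open>
  The vertices that start at the elements of the transporter are the translates by the centralizer of
  one of them, so that the average over the centralizer becomes a sum over the transporter.
\<close>

lemma comparison_map_crossed_tensor:
  assumes b: "b \<in> {..n} \<rightarrow> carrier A" and k: "k \<in> {..n} \<rightarrow> carrier \<Gamma>"
    and cyc: "cyclic_product \<Gamma> (map k [0..<Suc n]) \<in> conj_class \<Gamma> h"
  shows "comparison_map n (crossed_tensor \<Gamma> A \<phi> (map b [0..<Suc n]) (map k [0..<Suc n])) =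
           (1 / of_nat (card Z)) \<odot>\<^bsub>HA n\<^esub>
           (\<Oplus>\<^bsub>HA n\<^esub>
              g\<^sub>0\<in>conj_transporter \<Gamma> (cyclic_product \<Gamma> (map k [0..<Suc n])) h.
              tensor A (\<phi> (h \<otimes> g\<^sub>0 \<otimes> inv (k 0)) (b 0) #
                        map (\<lambda>i. \<phi> (g\<^sub>0 \<otimes> list_product \<Gamma> (map k [1..<i])) (b i)) [1..<Suc n]))"
proof -
  let ?bs = "map b [0..<Suc n]" and ?hs = "map k [0..<Suc n]"
  let ?x = "cyclic_product \<Gamma> ?hs"
  let ?T = "conj_transporter \<Gamma> ?x h"
  let ?l = "\<lambda>g. \<phi> (h \<otimes> g \<otimes> inv (k 0)) (b 0) #
                        map (\<lambda>i. \<phi> (g \<otimes> list_product \<Gamma> (map k [1..<i])) (b i)) [1..<Suc n]"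
  have bs: "?bs \<in> vectors A (Suc n)" by (rule vectorsI) (use b in \<open>auto simp del: upt_Suc\<close>)
  have hs: "?hs \<in> group_lists (Suc n)" by (rule group_listsI) (use k in \<open>auto simp del: upt_Suc\<close>)
  have l: "?l g = unrolled_entries ?bs ?hs g" if g: "g \<in> ?T" for g
  proof (rule nth_equalityI)
    note t = transporterD[OF hs g]
    show "length (?l g) = length (unrolled_entries ?bs ?hs g)" by (simp add: unrolled_entries_def del: upt_Suc)
    fix i assume "i < length (?l g)"
    then have i: "i < Suc n" by (simp del: upt_Suc)
    have len: "length (path ?hs g) = Suc n" by (simp add: path_def)
    have u: "unrolled_entries ?bs ?hs g ! i = \<phi> (source (path ?hs g) i) (b i)"
      using i by (simp add: unrolled_entries_def del: upt_Suc)
    have tl: "tl ?hs = map k [1..<Suc n]" by (simp add: map_tl[symmetric] tl_upt del: upt_Suc)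
    show "?l g ! i = unrolled_entries ?bs ?hs g ! i"
    proof (cases i)
      case 0
      have k0: "k 0 \<in> carrier \<Gamma>" using k by auto
      have lc: "list_product \<Gamma> (tl ?hs) \<in> carrier \<Gamma>" using list_product_tl_closed[OF hs, of "length ?hs"] by simp
      have "h \<otimes> g \<otimes> inv (k 0) = g \<otimes> list_product \<Gamma> (tl ?hs)"
        using t k0 lc by (simp add: \<Gamma>.m_assoc del: upt_Suc)
      also have "\<dots> = path ?hs g ! n" using nth_path[OF hs, of n g] by (simp add: tl)
      finally show ?thesis unfolding u using 0 len by (simp add: source_def)
    next
      case (Suc j)
      have "path ?hs g ! j = g \<otimes> list_product \<Gamma> (map k [1..<i])"
        using nth_path[OF hs, of j g] i Suc unfolding tl by (simp add: take_map del: upt_Suc)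
      then show ?thesis unfolding u using Suc i by (simp add: source_def del: upt_Suc)
    qed
  qed
  obtain t where t: "t \<in> ?T" by (rule transporter_nonempty[OF cyc])
  note tc = transporterD(1)[OF hs t]
  let ?as = "unrolled_entries ?bs ?hs t"
  have asv: "?as \<in> vectors A (Suc n)" by (rule unrolled_entries_vectors[OF bs hs tc])
  have xc: "?x \<in> carrier \<Gamma>"
    using cyc h by (auto simp: conj_class_def)
  have T: "?T = (\<lambda>z. z \<otimes> t) ` Z"
    using \<Gamma>.conj_transporter_coset[OF xc h t] by (auto simp: r_coset_def)
  have inj: "inj_on (\<lambda>z. z \<otimes> t) Z" using tc centralizerD(1) by (auto intro!: inj_onI)
  have fin: "finite ?T" unfolding T using finite_centralizer by simp
  have car: "tensor A (?l g) \<in> carrier (HA n)" and coord: "coordA n (tensor A (?l g)) = tensor_vec A (?l g)" if "g \<in> ?T" for g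
    unfolding l[OF that] hochschild_chains_def
    using unrolled_entries_vectors[OF bs hs transporterD(1)[OF hs that]]
    by (auto intro: tensor_carrier[OF module_A] tensor_coord_tensor[OF module_A])
  interpret HA: module complex_ring "HA n" by (rule lin_embeddingD(1)[OF embed_A])
  have sc: "(\<Oplus>\<^bsub>HA n\<^esub> g\<in>?T. tensor A (?l g)) \<in> carrier (HA n)"
    by (rule HA.finsum_closed) (use car in blast)
  have crossed: "crossed_tensor \<Gamma> A \<phi> ?bs ?hs \<in> carrier (classC n)"
    using crossed_tensor_roll[OF bs hs t] rolled_tensor_class_coords[OF asv path_group_lists[OF hs tc]] by (simp add: classC_carrier)
  show ?thesis
  proof (rule lin_embeddingD(5)[OF embed_A])
    show "comparison_map n (crossed_tensor \<Gamma> A \<phi> ?bs ?hs) \<in> carrier (HA n)"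
      using linear_maps_facts(1)[OF comparison_map_facts(1) lin_embeddingD(1)[OF embed_classC] lin_embeddingD(1)[OF embed_invC] crossed]
      by (simp add: invC_carrier)
    show "(1 / of_nat (card Z)) \<odot>\<^bsub>HA n\<^esub> (\<Oplus>\<^bsub>HA n\<^esub> g\<in>?T. tensor A (?l g)) \<in> carrier (HA n)"
      using sc by simp
    have "coordA n (comparison_map n (crossed_tensor \<Gamma> A \<phi> ?bs ?hs)) = to_twisted n (rolled_tensor ?as (path ?hs t))"
      using comparison_map_facts(2)[OF crossed] crossed_tensor_roll(2)[OF bs hs t] by simp
    also have "\<dots> = average_chain ?as" by (rule to_twisted_rolled_tensor[OF asv path_group_lists[OF hs tc]])
    also have "\<dots> = (1 / of_nat (card Z)) *\<^sub>c (\<Sum>g\<in>?T. tensor_vec A (?l g))"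
    proof -
      have "(\<Sum>g\<in>?T. tensor_vec A (?l g)) = (\<Sum>g\<in>?T. tensor_vec A (unrolled_entries ?bs ?hs g))"
        by (rule sum.cong[OF refl]) (simp only: l)
      also have "\<dots> = (\<Sum>z\<in>Z. tensor_vec A (unrolled_entries ?bs ?hs (z \<otimes> t)))"
        unfolding T by (rule sum.reindex_cong[OF inj refl refl])
      also have "\<dots> = (\<Sum>z\<in>Z. tensor_vec A (map (\<phi> z) ?as))"
        by (rule sum.cong[OF refl]) (simp only: unrolled_entries_translate[OF bs hs tc])
      finally show ?thesis by (simp only: average_chain_def)
    qed
    also have "(\<Sum>g\<in>?T. tensor_vec A (?l g)) = (\<Sum>g\<in>?T. coordA n (tensor A (?l g)))"
      by (rule sum.cong[OF refl]) (simp only: coord)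
    also have "\<dots> = coordA n (\<Oplus>\<^bsub>HA n\<^esub> g\<in>?T. tensor A (?l g))"
      by (rule lin_embedding_finsum[OF embed_A fin car, symmetric])
    also have "(1 / of_nat (card Z)) *\<^sub>c \<dots> = coordA n ((1 / of_nat (card Z)) \<odot>\<^bsub>HA n\<^esub> (\<Oplus>\<^bsub>HA n\<^esub> g\<in>?T. tensor A (?l g)))"
      by (rule lin_embeddingD(4)[OF embed_A sc, symmetric])
    finally show "coordA n (comparison_map n (crossed_tensor \<Gamma> A \<phi> ?bs ?hs)) =
        coordA n ((1 / of_nat (card Z)) \<odot>\<^bsub>HA n\<^esub> (\<Oplus>\<^bsub>HA n\<^esub> g\<in>?T. tensor A (?l g)))" .
  qed
qed

end

lemma (in group) conj_class_eq:
  assumes \<gamma>: "\<gamma> \<in> carrier G" and h: "h \<in> conj_class G \<gamma>"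
  shows "h \<in> carrier G" "conj_class G \<gamma> = conj_class G h"
proof -
  obtain g where g: "g \<in> carrier G" "h = g \<otimes> \<gamma> \<otimes> inv g" using h by (auto simp: conj_class_def)
  show hc: "h \<in> carrier G" using g \<gamma> by simp
  have \<gamma>h: "\<gamma> = inv g \<otimes> h \<otimes> g"
    unfolding g(2) using g(1) \<gamma> by (simp add: m_assoc) (simp add: m_assoc[symmetric])
  show "conj_class G \<gamma> = conj_class G h"
  proof
    show "conj_class G \<gamma> \<subseteq> conj_class G h"
    proof
      fix x assume "x \<in> conj_class G \<gamma>"
      then obtain k where k: "k \<in> carrier G" "x = k \<otimes> \<gamma> \<otimes> inv k" by (auto simp: conj_class_def)
      have "x = (k \<otimes> inv g) \<otimes> h \<otimes> inv (k \<otimes> inv g)"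
        unfolding k(2) \<gamma>h using k(1) g(1) hc by (simp add: inv_mult_group m_assoc)
      then show "x \<in> conj_class G h" using k(1) g(1) unfolding conj_class_def by blast
    qed
    show "conj_class G h \<subseteq> conj_class G \<gamma>"
    proof
      fix x assume "x \<in> conj_class G h"
      then obtain k where k: "k \<in> carrier G" "x = k \<otimes> h \<otimes> inv k" by (auto simp: conj_class_def)
      have "x = (k \<otimes> g) \<otimes> \<gamma> \<otimes> inv (k \<otimes> g)"
        unfolding k(2) g(2) using k(1) g(1) \<gamma> by (simp add: inv_mult_group m_assoc)
      then show "x \<in> conj_class G \<gamma>" using k(1) g(1) unfolding conj_class_def by blast
    qed
  qed
qed

theorem proposition2p3:
  fixes \<Gamma> :: "('g, 'k) monoid_scheme" (structure)
    and A :: "(complex, 'a, 'm) module_scheme"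
    and \<phi> :: "'g \<Rightarrow> 'a \<Rightarrow> 'a"
  assumes "algebra complex_ring A"
    and "group \<Gamma>" and "finite (carrier \<Gamma>)"
    and "algebra_action \<Gamma> A \<phi>"
    and "\<gamma> \<in> carrier \<Gamma>" and "h \<in> conj_class \<Gamma> \<gamma>"
  shows "\<exists>G :: nat \<Rightarrow> (('g \<Rightarrow> 'a) list \<Rightarrow> complex) set \<Rightarrow> ('a list \<Rightarrow> complex) set.
      quasi_isomorphism
        (class_chains \<Gamma> A \<phi> (conj_class \<Gamma> \<gamma>)) (hochschild_diff (crossed_product \<Gamma> A \<phi>) (\<lambda>u. u))
        (invariant_chains A \<phi> (centralizer \<Gamma> h)) (hochschild_diff A (\<phi> h))
        G \<and>
      (\<forall>n b k. b \<in> {..n} \<rightarrow> carrier A \<longrightarrow> k \<in> {..n} \<rightarrow> carrier \<Gamma> \<longrightarrow>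
         cyclic_product \<Gamma> (map k [0..<Suc n]) \<in> conj_class \<Gamma> \<gamma> \<longrightarrow>
         G n (crossed_tensor \<Gamma> A \<phi> (map b [0..<Suc n]) (map k [0..<Suc n])) =
           (1 / of_nat (card (centralizer \<Gamma> h))) \<odot>\<^bsub>hochschild_chains A n\<^esub>
           (\<Oplus>\<^bsub>hochschild_chains A n\<^esub>
              g\<^sub>0\<in>conj_transporter \<Gamma> (cyclic_product \<Gamma> (map k [0..<Suc n])) h.
              tensor A (\<phi> (h \<otimes> g\<^sub>0 \<otimes> inv (k 0)) (b 0) #
                        map (\<lambda>i. \<phi> (g\<^sub>0 \<otimes> list_product \<Gamma> (map k [1..<i])) (b i)) [1..<Suc n])))"
proof -
  note hK = group.conj_class_eq[OF assms(2,5,6)]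
  interpret twisted_group_algebra_action \<Gamma> A \<phi> h
    by (intro twisted_group_algebra_action.intro group_algebra_action.intro
        twisted_group_algebra_action_axioms.intro assms hK(1))
  show ?thesis
    unfolding hK(2)
    by (intro exI[of _ comparison_map] conjI allI impI quasi_isomorphism_comparison
        comparison_map_crossed_tensor)
qed

end
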